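(* Let $\epsilon>0$ and let $\Lambda$ be a vertical plane. Then there exist periodic orbits $\mathbf r(t)$, $\mathbf s(t)$ in $\Lambda$ of the fixed homogeneous circle problem such that: (i) $\|\mathbf r(t)\|\ge \frac1\epsilon$ for all $t$. Moreover, the trace of $\mathbf r(t)$ is a simple closed curve, symmetric with respect to the horizontal plane and the $z$-axis, and encloses the origin. (ii) $\mathrm{dist}(\mathbf s(t),\mathcal C)\le\epsilon$ for all $t$. Moreover, the trace of $\mathbf s(t)$ is a simple closed curve in $\Lambda$, symmetric with respect to the horizontal plane, and encloses the fixed homogeneous circle, i.e. encloses (in the plane $\Lambda$) one of the two points of $\mathcal C\cap\Lambda$.
   Context: $\mathcal C=\{(x,y,0)\in\mathbb R^3: x^2+y^2=1\}$ is the unit circle in the $xy$-plane centered at the origin, with constant mass density $\lambda>0$. Its potential is $V(\mathbf r)=-\int_{\mathcal C}\frac{\lambda\,du}{\|\mathbf r-u\|}$ for $\mathbf r\in\mathbb R^3\setminus\mathcal C$ ($du$ is arc length). The fixed homogeneous circle problem is the differential equation $\ddot{\mathbf r}=-\nabla V(\mathbf r)$ in $\mathbb R^3\setminus\mathcal C$; an orbit is a solution of it. The horizontal plane is the $xy$-plane; a vertical plane is a plane containing the $z$-axis. Vertical planes are invariant: a solution with initial position and velocity in such a plane stays in it. The trace of an orbit is its image. $\mathrm{dist}$ is Euclidean distance. A simple closed curve in a plane encloses a point if the point lies in the bounded component of the complement of the curve in that plane. *)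

theory Defs
  imports "HOL-Analysis.Analysis"
begin

definition unit_circle :: "(real^3) set" where
  "unit_circle = {x. x$1 ^ 2 + x$2 ^ 2 = 1 \<and> x$3 = 0}"

text \<open>The integral over the circle is taken in the arc length parametrisation
  \<open>\<theta> \<mapsto> (cos \<theta>, sin \<theta>, 0)\<close>, \<open>0 \<le> \<theta> \<le> 2\<pi>\<close>. The values on the circle itself are
  meaningless.\<close>

definition circle_potential :: "real \<Rightarrow> real^3 \<Rightarrow> real" where
  "circle_potential dens x =
     - integral {0..2*pi} (\<lambda>\<theta>. dens / norm (x - vector [cos \<theta>, sin \<theta>, 0]))"

text \<open>Solutions of \<open>r'' = - \<nabla>V(r)\<close> outside the circle. Only solutions defined for all
  times are considered, which is no restriction for periodic ones. The gradient condition
  includes differentiability of the potential at \<open>r t\<close>.\<close>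

definition circle_orbit :: "real \<Rightarrow> (real \<Rightarrow> real^3) \<Rightarrow> bool" where
  "circle_orbit dens r \<longleftrightarrow>
     (\<forall>t. r t \<notin> unit_circle) \<and>
     (\<exists>v a. \<forall>t. (r has_vector_derivative v t) (at t) \<and>
                (v has_vector_derivative a t) (at t) \<and>
                (GDERIV (circle_potential dens) (r t) :> - a t))"

definition periodic_circle_orbit :: "real \<Rightarrow> (real \<Rightarrow> real^3) \<Rightarrow> bool" where
  "periodic_circle_orbit dens r \<longleftrightarrow>
     circle_orbit dens r \<and> (\<exists>T>0. \<forall>t. r (t + T) = r t)"

definition z_axis :: "(real^3) set" where
  "z_axis = {x. x$1 = 0 \<and> x$2 = 0}"

definition vertical_plane :: "(real^3) set \<Rightarrow> bool" where
  "vertical_plane P \<longleftrightarrow> affine P \<and> aff_dim P = 2 \<and> z_axis \<subseteq> P"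

definition simple_closed_curve :: "(real^3) set \<Rightarrow> bool" where
  "simple_closed_curve S \<longleftrightarrow>
     (\<exists>g. simple_path g \<and> pathfinish g = pathstart g \<and> path_image g = S)"

definition symmetric_horizontal_plane :: "(real^3) set \<Rightarrow> bool" where
  "symmetric_horizontal_plane S \<longleftrightarrow> (\<lambda>x. vector [x$1, x$2, - (x$3)]) ` S = S"

text \<open>The half turn about the \<open>z\<close>-axis restricts to the reflection in the \<open>z\<close>-axis on
  every vertical plane.\<close>

definition symmetric_z_axis :: "(real^3) set \<Rightarrow> bool" where
  "symmetric_z_axis S \<longleftrightarrow> (\<lambda>x. vector [- (x$1), - (x$2), x$3]) ` S = S"

text \<open>Here \<open>S\<close> is a simple closed curve in the plane \<open>P\<close>; the complement is taken in
  \<open>P\<close>, not in space.\<close>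

definition encloses_in :: "(real^3) set \<Rightarrow> (real^3) set \<Rightarrow> real^3 \<Rightarrow> bool" where
  "encloses_in P S p \<longleftrightarrow> (\<exists>K \<in> components (P - S). bounded K \<and> p \<in> K)"

end

theory Submission
  imports Defs "HOL-Complex_Analysis.Complex_Analysis"
begin

text \<open>The potential is invariant under rotations about the \<open>z\<close>-axis and under reflections in vertical
planes, so the problem can be studied in one vertical plane. That plane is identified with \<open>\<complex>\<close> by
\<open>meridian\<close>, the ring meeting it in \<open>1\<close> and \<open>-1\<close>, and the acceleration at \<open>q\<close> is
\<open>- dens *\<^sub>R ring_pull q\<close> by \<open>meridian_gradient\<close>.

Both orbits are perturbed circles. Seen from far away the ring is a point mass, whose attraction is
\<open>-z / |z|^3\<close> up to scale; seen from very close to \<open>1\<close> it is a straight wire, whose attraction is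
\<open>-z / |z|^2\<close>. Either field has the circular motion \<open>t \<mapsto> cis t\<close>. In rescaled space and time the
equation therefore reads \<open>Q'' = - Q / |Q|^n + P Q\<close> with \<open>n = 3\<close> or \<open>n = 2\<close>, where near the unit
circle both \<open>P\<close> and its Lipschitz constant become arbitrarily small when the scale is chosen well
(\<open>far_perturbation_mild\<close>, \<open>near_perturbation_mild\<close>). What has to be shown is that the circular
motion survives such a perturbation (\<open>perturbed_circular_orbit\<close>).

For this the period is fixed and \<open>Q t = cis t * (1 + w t)\<close> is inserted, which gives
\<open>w'' + 2 \<i> w' - n Re w\<close> \<open>=\<close> (a forcing that is small and weakly dependent on \<open>w\<close>). The linear operator
on the left splits into an oscillator of frequency \<open>\<omega> = sqrt (4 - n)\<close> for \<open>Re w\<close> and an integration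
for \<open>Im w\<close>. On functions of period \<open>2L\<close> with \<open>w (-t) = cnj (w t)\<close> it is invertible as soon as
\<open>sin (\<omega> L) \<noteq> 0\<close>, and then the contraction principle yields \<open>w\<close>. For the wire, \<open>\<omega> = sqrt 2\<close>
and the period \<open>2 pi\<close> of the circle will do. For the point mass, \<open>\<omega> = 1\<close> is in resonance with that
period, as it must be: Kepler ellipses of the same major axis have the same period. The resonance
disappears if \<open>w\<close> has period \<open>pi\<close>, that is \<open>Q (t + pi) = - Q t\<close>. The field is odd, so this can be
imposed, and it is exactly what makes the distant orbit symmetric about the \<open>z\<close>-axis.

The same estimates bound \<open>w'\<close>. Hence the curve moves along with \<open>cis t\<close> closely enough to be injective
over one period and to have winding number \<open>1\<close> about the centre (\<open>near_circular_trace\<close>), which gives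
the simple closed curve and the enclosed point.\<close>

section \<open>Antiderivatives and reflections on the real line\<close>

text \<open>The energy of a harmonic oscillation is conserved.\<close>

lemma harmonic_uniqueness:
  fixes u u' :: "real \<Rightarrow> real"
  assumes u: "\<And>t. (u has_real_derivative u' t) (at t)"
    and u': "\<And>t. (u' has_real_derivative - \<omega>\<^sup>2 * u t) (at t)"
    and "u t0 = 0" "u' t0 = 0" "\<omega> \<noteq> 0"
  shows "u t = 0"
proof -
  have "((\<lambda>t. (u' t)\<^sup>2 + \<omega>\<^sup>2 * (u t)\<^sup>2) has_real_derivative 0) (at t)" for t
    by (rule derivative_eq_intros u u' refl | simp add: power2_eq_square algebra_simps)+
  then have "(u' t)\<^sup>2 + \<omega>\<^sup>2 * (u t)\<^sup>2 = (u' t0)\<^sup>2 + \<omega>\<^sup>2 * (u t0)\<^sup>2"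
    using DERIV_isconst_all by blast
  then have "(u' t)\<^sup>2 + (\<omega> * u t)\<^sup>2 = 0"
    using assms(3,4) by (simp add: power_mult_distrib)
  then have "\<omega> * u t = 0" by (simp only: sum_power2_eq_zero_iff)
  then show ?thesis using \<open>\<omega> \<noteq> 0\<close> by simp
qed

lemma antiderivative_on_line:
  fixes f :: "real \<Rightarrow> 'a::euclidean_space"
  assumes "continuous_on UNIV f"
  obtains F where "\<And>t. (F has_vector_derivative f t) (at t)"
proof -
  have "\<exists>F. \<forall>x::real. -\<infinity> < ereal x \<longrightarrow> ereal x < \<infinity> \<longrightarrow> (F has_vector_derivative f x) (at x)"
    by (rule einterval_antiderivative)
      (use assms in \<open>auto simp: continuous_on_eq_continuous_at\<close>)
  then show thesis using that by auto
qed

lemma global_antiderivative: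
  fixes h :: "real \<Rightarrow> real"
  assumes "continuous_on UNIV h"
  obtains H where "\<And>t. (H has_real_derivative h t) (at t)" "H 0 = 0"
proof -
  obtain F where F: "\<And>x. (F has_real_derivative h x) (at x)"
    using antiderivative_on_line[OF assms] by (auto simp: has_real_derivative_iff_has_vector_derivative)
  show thesis
    by (rule that[of "\<lambda>t. F t - F 0"]) (auto intro!: derivative_eq_intros F)
qed

lemma derivative_zero_const:
  fixes f :: "real \<Rightarrow> real"
  assumes "\<And>t. (f has_real_derivative 0) (at t)"
  shows "f s = f t"
  using DERIV_isconst_all[of f s t] assms by blast

lemma DERIV_reflect:
  fixes f :: "real \<Rightarrow> real"
  assumes "\<And>t. (f has_real_derivative f' t) (at t)"
  shows "((\<lambda>t. f (c - t)) has_real_derivative - f' (c - t)) (at t)"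
proof -
  have "((\<lambda>t. c - t) has_real_derivative -1) (at t)" by (auto intro!: derivative_eq_intros)
  from DERIV_chain2[OF assms this] show ?thesis by simp
qed

lemma antiderivative_bound:
  fixes H h :: "real \<Rightarrow> real"
  assumes "\<And>t. (H has_real_derivative h t) (at t)" "H 0 = 0"
    and "\<And>t. \<lbrakk>0 \<le> t; t \<le> L\<rbrakk> \<Longrightarrow> \<bar>h t\<bar> \<le> B" and "0 \<le> t" "t \<le> L"
  shows "\<bar>H t\<bar> \<le> L * B"
proof -
  have "norm (H t - H 0) \<le> B * norm (t - 0)"
  proof (rule differentiable_bound[of "{0..L}" H "\<lambda>x. (*) (h x)" B])
    show "(H has_derivative (*) (h x)) (at x within {0..L})" for x
      using assms(1)[of x] by (simp add: has_field_derivative_def has_derivative_at_withinI)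
    show "onorm ((*) (h x)) \<le> B" if "x \<in> {0..L}" for x
      by (rule onorm_le) (use assms(3)[of x] that in \<open>auto simp: abs_mult intro!: mult_right_mono\<close>)
  qed (use assms in auto)
  moreover have "B \<ge> 0" using assms(3)[of 0] assms(4,5) by linarith
  ultimately show ?thesis
    using assms(2,4,5) mult_left_mono[of t L B] by (simp add: mult.commute)
qed

text \<open>Even functions of period \<open>2L\<close> are those whose graph is symmetric about both ends of
  \<open>[0, L]\<close>, so that this interval is a fundamental domain.\<close>

lemma reduce_to_half_period:
  fixes f :: "real \<Rightarrow> real"
  assumes "L > 0" and even: "\<And>t. f (-t) = f t" and per: "\<And>t. f (t + 2*L) = f t"
    and bd: "\<And>t. \<lbrakk>0 \<le> t; t \<le> L\<rbrakk> \<Longrightarrow> f t \<le> B"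
  shows "f t \<le> B"
proof -
  interpret periodic_fun_simple f "2*L" by standard (rule per)
  define k where "k = \<lfloor>t / (2*L)\<rfloor>"
  define s where "s = t - of_int k * (2*L)"
  have "of_int k \<le> t / (2*L)" "t / (2*L) < of_int k + 1"
    unfolding k_def by linarith+
  then have s: "0 \<le> s" "s < 2*L"
    using \<open>L > 0\<close> by (auto simp: s_def field_simps)
  have ft: "f t = f s" using plus_of_int[of s k] by (simp add: s_def)
  show ?thesis
  proof (cases "s \<le> L")
    case True then show ?thesis using bd[of s] s ft by simp
  next
    case False
    have "f s = f (2*L - s)" using even[of "s"] per[of "-s"] by (simp add: algebra_simps)
    then show ?thesis using bd[of "2*L - s"] s ft False by simp
  qed
qed

section \<open>The linearised problem in a rotating frame\<close>

text \<open>Variation of constants solves the equation with \<open>x' 0 = 0\<close> for any initial value \<open>A\<close>. The value of \<open>A\<close> that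
also makes \<open>x' L = 0\<close> exists because \<open>sin (\<omega> * L) \<noteq> 0\<close>, and by uniqueness of the initial
value problem the solution is then symmetric about both \<open>0\<close> and \<open>L\<close>. Bounds are claimed on \<open>[0, L]\<close>
only, where the two integrals of the forcing are controlled by \<open>L\<close>.\<close>

lemma neumann_oscillator:
  fixes \<omega> L :: real
  assumes "\<omega> > 0" "L > 0" "sin (\<omega> * L) \<noteq> 0"
  obtains K where "K \<ge> 0"
    "\<And>h B. \<lbrakk>continuous_on UNIV h; \<And>t. h (-t) = h t; \<And>t. h (t + 2*L) = h t;
        \<And>t. \<lbrakk>0 \<le> t; t \<le> L\<rbrakk> \<Longrightarrow> \<bar>h t\<bar> \<le> B\<rbrakk> \<Longrightarrow>
      \<exists>x x'. (\<forall>t. (x has_real_derivative x' t) (at t)) \<and>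
        (\<forall>t. (x' has_real_derivative h t - \<omega>\<^sup>2 * x t) (at t)) \<and>
        (\<forall>t. x (-t) = x t) \<and> (\<forall>t. x (t + 2*L) = x t) \<and> x' 0 = 0 \<and> x' L = 0 \<and>
        (\<forall>t. 0 \<le> t \<longrightarrow> t \<le> L \<longrightarrow> \<bar>x t\<bar> \<le> K * B \<and> \<bar>x' t\<bar> \<le> K * B)"
proof -
  define a where "a = 2*L / (\<omega> * \<bar>sin (\<omega>*L)\<bar>)"
  define K where "K = a + 2*L/\<omega> + \<omega> * a + 2*L"
  have a0: "a \<ge> 0" using assms by (simp add: a_def)
  have main: "\<exists>x x'. (\<forall>t. (x has_real_derivative x' t) (at t)) \<and>
        (\<forall>t. (x' has_real_derivative h t - \<omega>\<^sup>2 * x t) (at t)) \<and>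
        (\<forall>t. x (-t) = x t) \<and> (\<forall>t. x (t + 2*L) = x t) \<and> x' 0 = 0 \<and> x' L = 0 \<and>
        (\<forall>t. 0 \<le> t \<longrightarrow> t \<le> L \<longrightarrow> \<bar>x t\<bar> \<le> K * B \<and> \<bar>x' t\<bar> \<le> K * B)"
    if cont: "continuous_on UNIV h" and even: "\<And>t. h (-t) = h t"
      and per: "\<And>t. h (t + 2*L) = h t"
      and hB: "\<And>t. \<lbrakk>0 \<le> t; t \<le> L\<rbrakk> \<Longrightarrow> \<bar>h t\<bar> \<le> B" for h B
  proof -
    have B0: "B \<ge> 0" using hB[of 0] assms by linarith
    have "continuous_on UNIV (\<lambda>t. h t * cos (\<omega>*t))" by (intro continuous_intros cont)
    from global_antiderivative[OF this]
    obtain C where C: "\<And>t. (C has_real_derivative h t * cos (\<omega>*t)) (at t)" "C 0 = 0" by blast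
    have "continuous_on UNIV (\<lambda>t. h t * sin (\<omega>*t))" by (intro continuous_intros cont)
    from global_antiderivative[OF this]
    obtain S where S: "\<And>t. (S has_real_derivative h t * sin (\<omega>*t)) (at t)" "S 0 = 0" by blast
    define A where "A = (cos (\<omega>*L) * C L + sin (\<omega>*L) * S L) / (\<omega> * sin (\<omega>*L))"
    define x where "x t = A * cos (\<omega>*t) + (sin (\<omega>*t) * C t - cos (\<omega>*t) * S t) / \<omega>" for t
    define x' where "x' t = - A * \<omega> * sin (\<omega>*t) + (cos (\<omega>*t) * C t + sin (\<omega>*t) * S t)" for t
    have dx: "(x has_real_derivative x' t) (at t)" for t
      unfolding x_def x'_def using \<open>\<omega> > 0\<close>
      by (auto intro!: derivative_eq_intros C S simp: field_simps)
    have dx': "(x' has_real_derivative h t - \<omega>\<^sup>2 * x t) (at t)" for t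
    proof -
      have d: "(x' has_real_derivative (- A * \<omega>\<^sup>2 * cos (\<omega>*t) +
         (- \<omega> * sin (\<omega>*t) * C t + cos (\<omega>*t) * (h t * cos (\<omega>*t))
          + \<omega> * cos (\<omega>*t) * S t + sin (\<omega>*t) * (h t * sin (\<omega>*t))))) (at t)"
        unfolding x'_def by (auto intro!: derivative_eq_intros C S simp: power2_eq_square)
      have e1: "cos (\<omega>*t) * (h t * cos (\<omega>*t)) + sin (\<omega>*t) * (h t * sin (\<omega>*t)) = h t"
        using sin_cos_squared_add3[of "\<omega>*t"] by (metis distrib_left mult.left_commute mult.right_neutral)
      have e2: "\<omega>\<^sup>2 * x t = A * \<omega>\<^sup>2 * cos (\<omega>*t) + \<omega> * sin (\<omega>*t) * C t - \<omega> * cos (\<omega>*t) * S t"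
        using \<open>\<omega> > 0\<close> by (simp add: x_def field_simps power2_eq_square)
      show ?thesis by (rule DERIV_cong[OF d]) (use e1 e2 in \<open>simp add: algebra_simps\<close>)
    qed
    have x'0: "x' 0 = 0" by (simp add: x'_def C S)
    have x'L: "x' L = 0" using assms by (simp add: x'_def A_def)
    have refl_sym: "x (2*c - t) = x t" if "x' c = 0" "\<And>t. h (2*c - t) = h t" for c t
    proof -
      have "x t - x (2*c - t) = 0"
      proof (rule harmonic_uniqueness[of "\<lambda>t. x t - x (2*c - t)" "\<lambda>t. x' t + x' (2*c - t)" \<omega> c])
        show "((\<lambda>t. x t - x (2*c - t)) has_real_derivative x' t + x' (2*c - t)) (at t)" for t
          using DERIV_diff[OF dx[of t] DERIV_reflect[of x x', OF dx, of "2*c" t]] by simp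
        show "((\<lambda>t. x' t + x' (2*c - t)) has_real_derivative - \<omega>\<^sup>2 * (x t - x (2*c - t))) (at t)" for t
          using DERIV_add[OF dx'[of t] DERIV_reflect[of x' "\<lambda>t. h t - \<omega>\<^sup>2 * x t", OF dx', of "2*c" t]]
          that(2)[of t] by (simp add: algebra_simps)
      qed (use that \<open>\<omega> > 0\<close> in auto)
      then show ?thesis by simp
    qed
    have ev: "x (-t) = x t" for t using refl_sym[of 0 t] x'0 even by simp
    have "h (2*L - t) = h t" for t using per[of "-t"] even[of t] by (simp add: add.commute)
    then have "x (2*L - t) = x t" for t using refl_sym[of L t] x'L by simp
    then have pr: "x (t + 2*L) = x t" for t using ev[of t] by (metis add.commute diff_minus_eq_add)
    have CB: "\<bar>C t\<bar> \<le> L * B" if "0 \<le> t" "t \<le> L" for t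
    proof (rule antiderivative_bound[OF C])
      fix s assume "0 \<le> s" "s \<le> L"
      then show "\<bar>h s * cos (\<omega> * s)\<bar> \<le> B"
        using hB[of s] mult_mono[of "\<bar>h s\<bar>" B "\<bar>cos (\<omega> * s)\<bar>" 1] B0 by (simp add: abs_mult)
    qed (use that in auto)
    have SB: "\<bar>S t\<bar> \<le> L * B" if "0 \<le> t" "t \<le> L" for t
    proof (rule antiderivative_bound[OF S])
      fix s assume "0 \<le> s" "s \<le> L"
      then show "\<bar>h s * sin (\<omega> * s)\<bar> \<le> B"
        using hB[of s] mult_mono[of "\<bar>h s\<bar>" B "\<bar>sin (\<omega> * s)\<bar>" 1] B0 by (simp add: abs_mult)
    qed (use that in auto)
    have trig: "\<bar>p * X + q * Y\<bar> \<le> 2 * (L * B)"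
      if "\<bar>X\<bar> \<le> L * B" "\<bar>Y\<bar> \<le> L * B" "\<bar>p\<bar> \<le> 1" "\<bar>q\<bar> \<le> 1" for p q X Y :: real
    proof -
      have "\<bar>p\<bar> * \<bar>X\<bar> \<le> 1 * (L*B)" "\<bar>q\<bar> * \<bar>Y\<bar> \<le> 1 * (L*B)"
        by (rule mult_mono; use that in auto)+
      then show ?thesis by (simp add: abs_mult[symmetric])
    qed
    have AB: "\<bar>A\<bar> \<le> a * B"
    proof -
      have "\<bar>A\<bar> = \<bar>cos (\<omega>*L) * C L + sin (\<omega>*L) * S L\<bar> / (\<omega> * \<bar>sin (\<omega>*L)\<bar>)"
        using assms by (simp add: A_def abs_mult)
      also have "\<dots> \<le> 2 * (L * B) / (\<omega> * \<bar>sin (\<omega>*L)\<bar>)"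
        by (rule divide_right_mono[OF trig]) (use CB SB assms in auto)
      finally show ?thesis by (simp add: a_def)
    qed
    have bd: "\<bar>x t\<bar> \<le> K * B \<and> \<bar>x' t\<bar> \<le> K * B" if t: "0 \<le> t" "t \<le> L" for t
    proof -
      have 1: "\<bar>sin (\<omega>*t) * C t + (- cos (\<omega>*t)) * S t\<bar> \<le> 2*(L*B)"
        by (rule trig) (use CB SB t in auto)
      have 2: "\<bar>cos (\<omega>*t) * C t + sin (\<omega>*t) * S t\<bar> \<le> 2*(L*B)"
        by (rule trig) (use CB SB t in auto)
      have 3: "\<bar>A * cos (\<omega>*t)\<bar> \<le> a*B" 
        using mult_mono[OF AB, of "\<bar>cos (\<omega>*t)\<bar>" 1] a0 B0 by (simp add: abs_mult)
      have 4: "\<bar>A * sin (\<omega>*t)\<bar> \<le> a*B" 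
        using mult_mono[OF AB, of "\<bar>sin (\<omega>*t)\<bar>" 1] a0 B0 by (simp add: abs_mult)
      have "\<bar>x t\<bar> \<le> a*B + 2*(L*B)/\<omega>"
      proof -
        have "\<bar>(sin (\<omega>*t) * C t - cos (\<omega>*t) * S t) / \<omega>\<bar> \<le> 2*(L*B)/\<omega>"
          using divide_right_mono[OF 1, of \<omega>] \<open>\<omega> > 0\<close> by simp
        then show ?thesis using 3 unfolding x_def by linarith
      qed
      moreover have "\<bar>x' t\<bar> \<le> \<omega> * (a*B) + 2*(L*B)"
      proof -
        have "\<bar>- A * \<omega> * sin (\<omega>*t)\<bar> \<le> \<omega> * (a*B)"
          using mult_left_mono[OF 4, of \<omega>] \<open>\<omega> > 0\<close> by (simp add: abs_mult mult.assoc mult.left_commute)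
        then show ?thesis using 2 unfolding x'_def by linarith
      qed
      moreover have "0 \<le> a*B" "0 \<le> 2*(L*B)/\<omega>" "0 \<le> \<omega>*(a*B)" "0 \<le> L*B"
        using a0 B0 assms by auto
      moreover have "K * B = a*B + 2*(L*B)/\<omega> + \<omega>*(a*B) + 2*(L*B)"
        by (simp add: K_def algebra_simps)
      ultimately show ?thesis by linarith
    qed
    show ?thesis using dx dx' ev pr x'0 x'L bd by blast
  qed
  show thesis
    by (rule that[OF _ main]) (use a0 assms in \<open>auto simp: K_def\<close>)
qed

text \<open>The symmetry of an orbit that crosses the horizontal axis at a right angle, expressed in the frame
rotating with the circular motion. Real parts are even and imaginary parts odd.\<close>

definition reversible :: "real \<Rightarrow> (real \<Rightarrow> complex) \<Rightarrow> bool" where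
  "reversible L w \<longleftrightarrow> (\<forall>t. w (- t) = cnj (w t)) \<and> (\<forall>t. w (t + 2*L) = w t)"

lemma antiderivative_reflect:
  fixes F f :: "real \<Rightarrow> real"
  assumes F: "\<And>t. (F has_real_derivative f t) (at t)" and "\<And>t. f (2*c - t) = - f t"
  shows "F (2*c - t) = F t"
proof -
  have "((\<lambda>t. F t - F (2*c - t)) has_real_derivative 0) (at t)" for t
    using DERIV_diff[OF F[of t] DERIV_reflect[of F f, OF F, of "2*c" t]] assms(2)[of t] by simp
  from derivative_zero_const[of "\<lambda>t. F t - F (2*c - t)", OF this, of t c] show ?thesis by simp
qed

lemma antiderivative_antireflect:
  fixes F f :: "real \<Rightarrow> real"
  assumes F: "\<And>t. (F has_real_derivative f t) (at t)" and "\<And>t. f (2*c - t) = f t" and "F c = 0"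
  shows "F (2*c - t) = - F t"
proof -
  have "((\<lambda>t. F t + F (2*c - t)) has_real_derivative 0) (at t)" for t
    using DERIV_add[OF F[of t] DERIV_reflect[of F f, OF F, of "2*c" t]] assms(2)[of t] by simp
  from derivative_zero_const[of "\<lambda>t. F t + F (2*c - t)", OF this, of t c] show ?thesis
    using \<open>F c = 0\<close> by simp
qed

lemma reversible_derivative:
  assumes w: "reversible L w" and d: "\<And>t. (w has_vector_derivative w' t) (at t)"
  shows "w' (- t) = - cnj (w' t)" "w' (t + 2*L) = w' t"
proof -
  have "((\<lambda>t. w (- t)) has_vector_derivative - w' (- t)) (at t)"
  proof -
    have "((\<lambda>t::real. - t) has_vector_derivative -1) (at t)"
      by (auto intro!: derivative_eq_intros)
    from vector_diff_chain_at[OF this d] show ?thesis by (simp add: o_def)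
  qed
  moreover have "((\<lambda>t. w (- t)) has_vector_derivative cnj (w' t)) (at t)"
    using w bounded_linear.has_vector_derivative[OF bounded_linear_cnj d[of t]]
    by (simp add: reversible_def)
  ultimately show "w' (- t) = - cnj (w' t)"
    using vector_derivative_unique_at by (metis minus_equation_iff)
  have "((\<lambda>t. w (t + 2*L)) has_vector_derivative w' (t + 2*L)) (at t)"
  proof -
    have "((\<lambda>t::real. t + 2*L) has_vector_derivative 1) (at t)"
      by (auto intro!: derivative_eq_intros)
    from vector_diff_chain_at[OF this d] show ?thesis by (simp add: o_def)
  qed
  moreover have "((\<lambda>t. w (t + 2*L)) has_vector_derivative w' t) (at t)"
    using w d by (simp add: reversible_def)
  ultimately show "w' (t + 2*L) = w' t"
    using vector_derivative_unique_at by blast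
qed

text \<open>The imaginary part is odd about \<open>0\<close> and, by periodicity, about \<open>L\<close>.\<close>

lemma reversible_ends:
  assumes "reversible L w"
  shows "Im (w 0) = 0" "Im (w L) = 0"
proof -
  show "Im (w 0) = 0" using assms unfolding reversible_def by (metis add.inverse_neutral cnj.simps(2) neg_equal_zero)
  have "w L = w (- L)" using assms unfolding reversible_def
    by (metis add.commute add_minus_cancel mult_2)
  then have "Im (w L) = - Im (w L)" using assms unfolding reversible_def by (metis cnj.simps(2))
  then show "Im (w L) = 0" by simp
qed

text \<open>In components the equation is \<open>x'' - 2 y' - b x = Re N\<close> and \<open>y'' + 2 x' = Im N\<close>. The second equation
integrates to \<open>y' = M + c - 2 x\<close> with \<open>M' = Im N\<close>, which turns the first one into an oscillator of
frequency \<open>\<omega>\<close> with forcing \<open>Re N + 2 M + 2 c\<close>. The free constant \<open>c\<close> serves to close up \<open>y\<close>,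
and this is where \<open>b > 0\<close> enters.\<close>

lemma rotating_linear_problem_exists:
  fixes \<omega> L b :: real
  assumes "\<omega> > 0" "L > 0" "sin (\<omega> * L) \<noteq> 0" "b > 0" "\<omega>\<^sup>2 = 4 - b"
  obtains K where "K \<ge> 0"
    "\<And>N B. \<lbrakk>continuous_on UNIV N; reversible L N; \<And>t. norm (N t) \<le> B\<rbrakk> \<Longrightarrow>
      \<exists>w w'. (\<forall>t. (w has_vector_derivative w' t) (at t)) \<and>
        (\<forall>t. (w' has_vector_derivative N t + of_real (b * Re (w t)) - 2 * \<i> * w' t) (at t)) \<and>
        reversible L w \<and> (\<forall>t. norm (w t) \<le> K * B) \<and> (\<forall>t. norm (w' t) \<le> K * B)"
proof -
  obtain K0 where K0: "K0 \<ge> 0" and osc: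
    "\<And>h B. \<lbrakk>continuous_on UNIV h; \<And>t. h (-t) = h t; \<And>t. h (t + 2*L) = h t;
        \<And>t. \<lbrakk>0 \<le> t; t \<le> L\<rbrakk> \<Longrightarrow> \<bar>h t\<bar> \<le> B\<rbrakk> \<Longrightarrow>
      \<exists>x x'. (\<forall>t. (x has_real_derivative x' t) (at t)) \<and>
        (\<forall>t. (x' has_real_derivative h t - \<omega>\<^sup>2 * x t) (at t)) \<and>
        (\<forall>t. x (-t) = x t) \<and> (\<forall>t. x (t + 2*L) = x t) \<and> x' 0 = 0 \<and> x' L = 0 \<and>
        (\<forall>t. 0 \<le> t \<longrightarrow> t \<le> L \<longrightarrow> \<bar>x t\<bar> \<le> K0 * B \<and> \<bar>x' t\<bar> \<le> K0 * B)"
    by (rule neumann_oscillator[OF assms(1-3)], rule that, assumption, blast)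
  define H where "H = 1 + 2*L + 2*(2/b + L)"
  define Y where "Y = L + (2/b + L) + 2*(K0*H)"
  define K where "K = K0*H + Y + L*Y"
  have nn: "0 \<le> H" "0 \<le> Y" "0 \<le> K" using assms K0 by (auto simp: H_def Y_def K_def)
  have main: "\<exists>w w'. (\<forall>t. (w has_vector_derivative w' t) (at t)) \<and>
        (\<forall>t. (w' has_vector_derivative N t + of_real (b * Re (w t)) - 2 * \<i> * w' t) (at t)) \<and>
        reversible L w \<and> (\<forall>t. norm (w t) \<le> K * B) \<and> (\<forall>t. norm (w' t) \<le> K * B)"
    if cN: "continuous_on UNIV N" and rN: "reversible L N" and NB: "\<And>t. norm (N t) \<le> B" for N B
  proof -
    have B0: "B \<ge> 0" using NB[of 0] norm_ge_zero[of "N 0"] by linarith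
    have N1B: "\<bar>Re (N t)\<bar> \<le> B" and N2B: "\<bar>Im (N t)\<bar> \<le> B" for t
      using NB[of t] abs_Re_le_cmod[of "N t"] abs_Im_le_cmod[of "N t"] by linarith+
    have sN: "N (- t) = cnj (N t)" "N (t + 2*L) = N t" "N (2*L - t) = cnj (N t)" for t
      using rN unfolding reversible_def by (auto, metis add.commute diff_conv_add_uminus)
    obtain E where E: "\<And>t. (E has_real_derivative Re (N t)) (at t)" "E 0 = 0"
      using global_antiderivative[OF continuous_on_Re[OF cN]] by blast
    obtain M where M: "\<And>t. (M has_real_derivative Im (N t)) (at t)" "M 0 = 0"
      using global_antiderivative[OF continuous_on_Im[OF cN]] by blast
    have cM: "continuous_on UNIV M"
      using M(1) DERIV_isCont by (auto simp: continuous_on_eq_continuous_at)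
    obtain PM where PM: "\<And>t. (PM has_real_derivative M t) (at t)" "PM 0 = 0"
      using global_antiderivative[OF cM] by blast
    \<comment> \<open>Integrating the equation for \<open>x\<close> over \<open>[0, L]\<close>, where \<open>x'\<close> vanishes at both ends, determines the
      mean of \<open>x\<close>; this value of \<open>c\<close> makes the mean of \<open>y'\<close> vanish.\<close>
    define c where "c = - (2 / b * E L + PM L) / L"
    define h where "h t = Re (N t) + 2 * M t + 2 * c" for t
    have M0: "M (- t) = M t" for t
      using antiderivative_reflect[of M "\<lambda>t. Im (N t)" 0] M sN by simp
    have M2L: "M (2*L - t) = M t" for t
      using antiderivative_reflect[of M "\<lambda>t. Im (N t)" L] M sN by simp
    have Mper: "M (t + 2*L) = M t" for t
      using M0[of t] M2L[of "-t"] by (simp add: add.commute)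
    have MB: "\<bar>M t\<bar> \<le> L * B" if "0 \<le> t" "t \<le> L" for t
      by (rule antiderivative_bound[OF M]) (use N2B that in auto)
    have "\<bar>c\<bar> * L \<le> (2/b + L) * B * L"
    proof -
      have e: "\<bar>E L\<bar> \<le> L * B" by (rule antiderivative_bound[OF E]) (use N1B assms in auto)
      have p: "\<bar>PM L\<bar> \<le> L * (L * B)" by (rule antiderivative_bound[OF PM]) (use MB assms in auto)
      have "\<bar>2 / b * E L\<bar> = 2/b * \<bar>E L\<bar>" using assms by (simp add: abs_mult)
      also have "\<dots> \<le> 2/b * (L*B)"
        by (rule mult_left_mono) (use e assms in auto)
      finally have "\<bar>2 / b * E L + PM L\<bar> \<le> 2/b * (L*B) + L * (L*B)" using p by linarith
      moreover have "\<bar>c\<bar> * L = \<bar>2 / b * E L + PM L\<bar>" using assms by (simp add: c_def)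
      ultimately show ?thesis by (simp add: algebra_simps)
    qed
    then have cB: "\<bar>c\<bar> \<le> (2/b + L) * B" using assms by simp
    have hB: "\<bar>h t\<bar> \<le> H * B" if "0 \<le> t" "t \<le> L" for t
    proof -
      have "\<bar>h t\<bar> \<le> \<bar>Re (N t)\<bar> + 2 * \<bar>M t\<bar> + 2 * \<bar>c\<bar>" unfolding h_def by linarith
      also have "\<dots> \<le> B + 2 * (L*B) + 2 * ((2/b + L) * B)"
        using MB[OF that] N1B[of t] cB by (intro add_mono mult_left_mono) auto
      finally show ?thesis by (simp add: H_def algebra_simps)
    qed
    have "\<exists>x x'. (\<forall>t. (x has_real_derivative x' t) (at t)) \<and>
        (\<forall>t. (x' has_real_derivative h t - \<omega>\<^sup>2 * x t) (at t)) \<and>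
        (\<forall>t. x (-t) = x t) \<and> (\<forall>t. x (t + 2*L) = x t) \<and> x' 0 = 0 \<and> x' L = 0 \<and>
        (\<forall>t. 0 \<le> t \<longrightarrow> t \<le> L \<longrightarrow> \<bar>x t\<bar> \<le> K0 * (H*B) \<and> \<bar>x' t\<bar> \<le> K0 * (H*B))"
    proof (rule osc)
      show "continuous_on UNIV h" unfolding h_def by (intro continuous_intros cN cM)
    qed (use hB in \<open>auto simp: h_def sN M0 Mper\<close>)
    then obtain x x' where dx: "\<And>t. (x has_real_derivative x' t) (at t)"
      and dx': "\<And>t. (x' has_real_derivative h t - \<omega>\<^sup>2 * x t) (at t)"
      and xs: "\<And>t. x (-t) = x t" "\<And>t. x (t + 2*L) = x t" and x'0: "x' 0 = 0" "x' L = 0"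
      and xB: "\<And>t. 0 \<le> t \<Longrightarrow> t \<le> L \<Longrightarrow> \<bar>x t\<bar> \<le> K0 * (H*B)"
      and x'B: "\<And>t. 0 \<le> t \<Longrightarrow> t \<le> L \<Longrightarrow> \<bar>x' t\<bar> \<le> K0 * (H*B)" by blast
    \<comment> \<open>The bracket is a primitive of \<open>- \<omega>\<^sup>2 * x\<close>, by the equation for \<open>x\<close>, so that \<open>y' = M + c - 2 * x\<close>.\<close>
    define y where "y t = PM t + c * t + 2/\<omega>\<^sup>2 * (x' t - E t - 2 * PM t - 2 * c * t)" for t
    define y' where "y' t = M t + c - 2 * x t" for t
    have dy: "(y has_real_derivative y' t) (at t)" for t
      unfolding y_def y'_def
      by (rule derivative_eq_intros PM E dx' refl)+ (use \<open>\<omega> > 0\<close> in \<open>simp add: h_def field_simps\<close>)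
    have dy': "(y' has_real_derivative Im (N t) - 2 * x' t) (at t)" for t
      unfolding y'_def by (auto intro!: derivative_eq_intros M dx)
    have y0: "y 0 = 0" by (simp add: y_def PM E x'0)
    have yL: "y L = 0"
    proof -
      have cL: "c * L = - (2 / b * E L + PM L)" using \<open>L > 0\<close> by (simp add: c_def)
      have "y L = PM L + c * L + 2/\<omega>\<^sup>2 * (- E L - 2 * PM L - 2 * (c * L))"
        by (simp add: y_def x'0)
      also have "\<dots> = - (2/b * E L) + 2/\<omega>\<^sup>2 * ((4/b - 1) * E L)"
        unfolding cL by (simp add: algebra_simps)
      also have "4/b - 1 = \<omega>\<^sup>2 / b" using assms by (simp add: field_simps)
      finally show ?thesis using \<open>\<omega> > 0\<close> by simp
    qed
    have x2L: "x (2*L - t) = x t" for t using xs(2)[of "-t"] xs(1)[of t] by (simp add: add.commute)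
    have yodd: "y (- t) = - y t" for t
      using antiderivative_antireflect[of y y' 0] dy y0 by (simp add: y'_def M0 xs)
    have y2L: "y (2*L - t) = - y t" for t
      using antiderivative_antireflect[of y y' L] dy yL by (simp add: y'_def M2L x2L)
    have yper: "y (t + 2*L) = y t" for t
      using yodd[of t] y2L[of "-t"] by (simp add: add.commute)
    have y'B: "\<bar>y' t\<bar> \<le> Y * B" if "0 \<le> t" "t \<le> L" for t
    proof -
      have "\<bar>y' t\<bar> \<le> \<bar>M t\<bar> + \<bar>c\<bar> + 2 * \<bar>x t\<bar>" unfolding y'_def by linarith
      also have "\<dots> \<le> L*B + (2/b + L) * B + 2 * (K0 * (H*B))"
        using MB[OF that] xB[OF that] cB by (intro add_mono mult_left_mono) auto
      finally show ?thesis by (simp add: Y_def algebra_simps)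
    qed
    have yB: "\<bar>y t\<bar> \<le> L * (Y * B)" if "0 \<le> t" "t \<le> L" for t
      by (rule antiderivative_bound[OF dy y0]) (use y'B that in auto)
    define w where "w t = Complex (x t) (y t)" for t
    define w' where "w' t = Complex (x' t) (y' t)" for t
    have dw: "(w has_vector_derivative w' t) (at t)" for t
      using dx dy by (simp add: w_def w'_def has_vector_derivative_complex_iff)
    have dw': "(w' has_vector_derivative N t + of_real (b * Re (w t)) - 2 * \<i> * w' t) (at t)" for t
    proof -
      have "h t - \<omega>\<^sup>2 * x t = Re (N t) + b * x t + 2 * y' t"
      proof -
        have b: "b = 4 - \<omega>\<^sup>2" using assms by simp
        show ?thesis unfolding b h_def y'_def by (simp add: algebra_simps)
      qed
      then show ?thesis
        using dx'[of t] dy'[of t]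
        by (simp add: w_def w'_def has_vector_derivative_complex_iff)
    qed
    have rw: "reversible L w"
      by (simp add: reversible_def w_def xs yodd yper complex_eq_iff)
    have "norm (w t) \<le> K * B" for t
    proof (rule reduce_to_half_period[OF \<open>L > 0\<close>, of "\<lambda>t. norm (w t)"])
      show "norm (w (-t)) = norm (w t)" "norm (w (t + 2*L)) = norm (w t)" for t
        using rw by (auto simp: reversible_def)
      fix t assume t: "0 \<le> t" "t \<le> L"
      have "norm (w t) \<le> \<bar>x t\<bar> + \<bar>y t\<bar>" using cmod_le[of "w t"] by (simp add: w_def)
      also have "\<dots> \<le> K0*(H*B) + L*(Y*B) + Y*B" using xB[OF t] yB[OF t] nn B0 by (simp add: add_increasing2)
      finally show "norm (w t) \<le> K * B" by (simp add: K_def algebra_simps)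
    qed
    moreover have "norm (w' t) \<le> K * B" for t
    proof (rule reduce_to_half_period[OF \<open>L > 0\<close>, of "\<lambda>t. norm (w' t)"])
      show "norm (w' (-t)) = norm (w' t)" "norm (w' (t + 2*L)) = norm (w' t)" for t
        using reversible_derivative[OF rw dw, of t] by auto
      fix t assume t: "0 \<le> t" "t \<le> L"
      have "norm (w' t) \<le> \<bar>x' t\<bar> + \<bar>y' t\<bar>" using cmod_le[of "w' t"] by (simp add: w'_def)
      also have "\<dots> \<le> K0*(H*B) + Y*B + L*(Y*B)" using x'B[OF t] y'B[OF t] nn B0 assms by (simp add: add_increasing2)
      finally show "norm (w' t) \<le> K * B" by (simp add: K_def algebra_simps)
    qed
    ultimately show ?thesis using dw dw' rw by blast
  qed
  show thesis by (rule that[OF nn(3) main])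
qed

text \<open>Without forcing, \<open>Im w' + 2 Re w\<close> is a constant \<open>c\<close>. Then \<open>Re w\<close> is \<open>2 c / \<omega>\<^sup>2\<close> plus a multiple of
\<open>cos (\<omega> t)\<close>, and the multiple vanishes since its derivative does at \<open>L\<close>. So \<open>Im w\<close> is linear; being zero
at both ends of \<open>[0, L]\<close> it is zero, which forces \<open>c = 0\<close> because \<open>\<omega>\<^sup>2 \<noteq> 4\<close>.\<close>

lemma rotating_linear_problem_unique:
  fixes \<omega> L b :: real
  assumes "\<omega> > 0" "L > 0" "sin (\<omega> * L) \<noteq> 0" "b > 0" "\<omega>\<^sup>2 = 4 - b"
    and w: "\<And>t. (w has_vector_derivative w' t) (at t)"
    and w': "\<And>t. (w' has_vector_derivative of_real (b * Re (w t)) - 2 * \<i> * w' t) (at t)"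
    and r: "reversible L w"
  shows "w t = 0"
proof -
  have dx: "((\<lambda>t. Re (w t)) has_real_derivative Re (w' t)) (at t)"
    and dy: "((\<lambda>t. Im (w t)) has_real_derivative Im (w' t)) (at t)"
    and dx': "((\<lambda>t. Re (w' t)) has_real_derivative b * Re (w t) + 2 * Im (w' t)) (at t)"
    and dy': "((\<lambda>t. Im (w' t)) has_real_derivative - 2 * Re (w' t)) (at t)" for t
    using w[of t] w'[of t] by (simp_all add: has_vector_derivative_complex_iff)
  define c where "c = Im (w' 0) + 2 * Re (w 0)"
  have "((\<lambda>t. Im (w' t) + 2 * Re (w t)) has_real_derivative 0) (at t)" for t
    using DERIV_add[OF dy'[of t] DERIV_cmult[OF dx[of t], of 2]] by simp
  from derivative_zero_const[OF this, of _ 0] have y': "Im (w' t) = c - 2 * Re (w t)" for t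
    by (simp add: c_def algebra_simps eq_diff_eq)
  have "Re (w' 0) = 0" "Re (w' L) = 0"
  proof -
    show "Re (w' 0) = 0" using reversible_derivative(1)[OF r w, of 0] by (simp add: complex_eq_iff)
    have "w' L = w' (- L)" using reversible_derivative(2)[OF r w, of "-L"] by simp
    then show "Re (w' L) = 0" using reversible_derivative(1)[OF r w, of L] by (simp add: complex_eq_iff)
  qed
  define u0 where "u0 = Re (w 0) - 2*c/\<omega>\<^sup>2"
  have u: "Re (w t) - 2*c/\<omega>\<^sup>2 - u0 * cos (\<omega>*t) = 0" for t
  proof (rule harmonic_uniqueness[of "\<lambda>t. Re (w t) - 2*c/\<omega>\<^sup>2 - u0 * cos (\<omega>*t)"
        "\<lambda>t. Re (w' t) + u0 * \<omega> * sin (\<omega>*t)" \<omega> 0])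
    show "((\<lambda>t. Re (w t) - 2*c/\<omega>\<^sup>2 - u0 * cos (\<omega>*t)) has_real_derivative
        Re (w' t) + u0 * \<omega> * sin (\<omega>*t)) (at t)" for t
      by (rule derivative_eq_intros dx refl | simp)+
    show "((\<lambda>t. Re (w' t) + u0 * \<omega> * sin (\<omega>*t)) has_real_derivative
        - \<omega>\<^sup>2 * (Re (w t) - 2*c/\<omega>\<^sup>2 - u0 * cos (\<omega>*t))) (at t)" for t
    proof (rule DERIV_cong[OF DERIV_add[OF dx']])
      show "((\<lambda>t. u0 * \<omega> * sin (\<omega>*t)) has_real_derivative u0 * \<omega> * (\<omega> * cos (\<omega>*t))) (at t)"
        by (auto intro!: derivative_eq_intros)
      define m where "m = 2*c/\<omega>\<^sup>2"
      have b: "b = 4 - \<omega>\<^sup>2" and k: "\<omega>\<^sup>2 * m = 2 * c" using assms by (auto simp: m_def)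
      show "b * Re (w t) + 2 * Im (w' t) + u0 * \<omega> * (\<omega> * cos (\<omega>*t)) =
          - \<omega>\<^sup>2 * (Re (w t) - 2*c/\<omega>\<^sup>2 - u0 * cos (\<omega>*t))"
        unfolding b y' m_def[symmetric] using k by (simp add: algebra_simps power2_eq_square)
    qed
  qed (use \<open>Re (w' 0) = 0\<close> \<open>\<omega> > 0\<close> in \<open>auto simp: u0_def\<close>)
  have du: "((\<lambda>t. Re (w t) - 2*c/\<omega>\<^sup>2 - u0 * cos (\<omega>*t)) has_real_derivative
        Re (w' L) + u0 * \<omega> * sin (\<omega>*L)) (at L)"
    by (auto intro!: derivative_eq_intros w)
  have "Re (w' L) + u0 * \<omega> * sin (\<omega>*L) = 0"
    using DERIV_unique[OF du] u by simp
  then have "u0 = 0" using assms \<open>Re (w' L) = 0\<close> by simp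
  then have x: "Re (w t) = 2*c/\<omega>\<^sup>2" for t using u[of t] by simp
  define k where "k = c - 4*c/\<omega>\<^sup>2"
  have dyk: "((\<lambda>t. Im (w t) - k * t) has_real_derivative 0) (at t)" for t
    by (auto intro!: derivative_eq_intros w simp: y' x k_def)
  have "Im (w t) - k * t = Im (w 0) - k * 0" for t
    by (rule derivative_zero_const[OF dyk])
  then have y: "Im (w t) = k * t" for t using reversible_ends[OF r] by simp
  have "k = 0" using y[of L] reversible_ends[OF r] \<open>L > 0\<close> by simp
  then have "c * (\<omega>\<^sup>2 - 4) = 0" using \<open>\<omega> > 0\<close> by (simp add: k_def field_simps)
  then have "c = 0" using assms by simp
  then show ?thesis using x y \<open>k = 0\<close> by (simp add: complex_eq_iff)
qed

section \<open>Persistence of circular motions under small perturbations\<close>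

lemma continuous_on_eval_bcontfun: "continuous_on UNIV (\<lambda>u :: real \<Rightarrow>\<^sub>C complex. apply_bcontfun u t)"
  unfolding continuous_on_iff by (meson dist_bounded le_less_trans)

text \<open>The number \<open>\<kappa>\<close> measures the forcing relative to the radius \<open>\<eta>\<close> of the ball in which a solution is sought:
for small \<open>\<kappa>\<close> the solution operator maps the ball into itself and contracts.\<close>

definition mild_reversible_forcing :: "real \<Rightarrow> real \<Rightarrow> real \<Rightarrow> (real \<Rightarrow> complex \<Rightarrow> complex) \<Rightarrow> bool" where
  "mild_reversible_forcing L \<kappa> \<eta> g \<longleftrightarrow>
     continuous_on (UNIV \<times> cball 0 \<eta>) (\<lambda>(t, z). g t z) \<and>
     (\<forall>t z. norm z \<le> \<eta> \<longrightarrow> g (- t) (cnj z) = cnj (g t z) \<and> g (t + 2*L) z = g t z \<and>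
        norm (g t z) \<le> \<kappa> * \<eta>) \<and>
     (\<forall>t z z'. norm z \<le> \<eta> \<longrightarrow> norm z' \<le> \<eta> \<longrightarrow> norm (g t z - g t z') \<le> \<kappa> * norm (z - z'))"

text \<open>Existence and uniqueness for the linear problem define a solution operator, whose norm \<open>K\<close> bounds both \<open>w\<close> and
\<open>w'\<close>. Composed with the forcing it is a contraction of the closed set of reversible functions with
values in the ball of radius \<open>\<eta>\<close>. The bound on \<open>w'\<close> is carried along because the geometry of the orbit
depends on it.\<close>

lemma rotating_nonlinear_problem:
  fixes \<omega> L b :: real
  assumes "\<omega> > 0" "L > 0" "sin (\<omega> * L) \<noteq> 0" "b > 0" "\<omega>\<^sup>2 = 4 - b"
  obtains \<kappa> where "\<kappa> > 0"
    "\<And>\<eta> g. \<lbrakk>\<eta> > 0; mild_reversible_forcing L \<kappa> \<eta> g\<rbrakk> \<Longrightarrow>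
     \<exists>w w'. (\<forall>t. (w has_vector_derivative w' t) (at t)) \<and>
        (\<forall>t. (w' has_vector_derivative g t (w t) + of_real (b * Re (w t)) - 2 * \<i> * w' t) (at t)) \<and>
        reversible L w \<and> (\<forall>t. norm (w t) \<le> \<eta>) \<and> (\<forall>t. norm (w' t) \<le> \<eta>)"
proof -
  define solves where "solves N w w' \<longleftrightarrow> (\<forall>t. (w has_vector_derivative w' t) (at t)) \<and>
        (\<forall>t. (w' has_vector_derivative N t + of_real (b * Re (w t)) - 2 * \<i> * w' t) (at t)) \<and>
        reversible L w" for N w w'
  obtain K where K: "K \<ge> 0" and lin:
    "\<And>N B. \<lbrakk>continuous_on UNIV N; reversible L N; \<And>t. norm (N t) \<le> B\<rbrakk> \<Longrightarrow>
      \<exists>w w'. (\<forall>t. (w has_vector_derivative w' t) (at t)) \<and>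
        (\<forall>t. (w' has_vector_derivative N t + of_real (b * Re (w t)) - 2 * \<i> * w' t) (at t)) \<and>
        reversible L w \<and> (\<forall>t. norm (w t) \<le> K * B) \<and> (\<forall>t. norm (w' t) \<le> K * B)"
    by (rule rotating_linear_problem_exists[OF assms], rule that, assumption, blast)
  have exist: "\<exists>w w'. solves N w w' \<and> (\<forall>t. norm (w t) \<le> K * B) \<and> (\<forall>t. norm (w' t) \<le> K * B)"
    if "continuous_on UNIV N" "reversible L N" "\<And>t. norm (N t) \<le> B" for N B
    using lin[OF that] unfolding solves_def by blast
  have diff: "solves (\<lambda>t. N t - N' t) (\<lambda>t. w t - v t) (\<lambda>t. w' t - v' t)"
    if "solves N w w'" "solves N' v v'" for N N' w w' v v'
  proof -
    have "((\<lambda>t. w' t - v' t) has_vector_derivative (N t + of_real (b * Re (w t)) - 2 * \<i> * w' t) -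
       (N' t + of_real (b * Re (v t)) - 2 * \<i> * v' t)) (at t)" for t
      using that unfolding solves_def by (intro has_vector_derivative_diff) auto
    then have "((\<lambda>t. w' t - v' t) has_vector_derivative (N t - N' t) + of_real (b * Re (w t - v t)) - 2 * \<i> * (w' t - v' t)) (at t)" for t
      by (simp add: algebra_simps)
    then show ?thesis using that
      by (auto simp: solves_def reversible_def intro!: has_vector_derivative_diff)
  qed
  have zero: "w t = 0" if "solves (\<lambda>t. 0) w w'" for w w' t
    using rotating_linear_problem_unique[OF assms, of w w' t] that unfolding solves_def by simp
  have unique: "w t = v t" if "solves N w w'" "solves N v v'" for N w w' v v' t
    using zero[of "\<lambda>t. w t - v t" _ t] diff[OF that] by simp
  \<comment> \<open>Adding \<open>1\<close> covers \<open>K = 0\<close>; what counts is \<open>K * \<kappa> \<le> 1/2\<close>.\<close>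
  define \<kappa> where "\<kappa> = 1 / (2 * (K + 1))"
  have \<kappa>: "\<kappa> > 0" "K * \<kappa> \<le> 1/2" using K by (auto simp: \<kappa>_def field_simps)
  have main: "\<exists>w w'. (\<forall>t. (w has_vector_derivative w' t) (at t)) \<and>
        (\<forall>t. (w' has_vector_derivative g t (w t) + of_real (b * Re (w t)) - 2 * \<i> * w' t) (at t)) \<and>
        reversible L w \<and> (\<forall>t. norm (w t) \<le> \<eta>) \<and> (\<forall>t. norm (w' t) \<le> \<eta>)"
    if \<eta>: "\<eta> > 0" and g: "mild_reversible_forcing L \<kappa> \<eta> g" for \<eta> g
  proof -
    have cg: "continuous_on (UNIV \<times> cball 0 \<eta>) (\<lambda>(t, z). g t z)"
      and g1: "\<And>t z. norm z \<le> \<eta> \<Longrightarrow> g (- t) (cnj z) = cnj (g t z)"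
      and g2: "\<And>t z. norm z \<le> \<eta> \<Longrightarrow> g (t + 2*L) z = g t z"
      and gb: "\<And>t z. norm z \<le> \<eta> \<Longrightarrow> norm (g t z) \<le> \<kappa> * \<eta>"
      and gl: "\<And>t z z'. \<lbrakk>norm z \<le> \<eta>; norm z' \<le> \<eta>\<rbrakk> \<Longrightarrow> norm (g t z - g t z') \<le> \<kappa> * norm (z - z')"
      using g unfolding mild_reversible_forcing_def by auto
    define X where "X = {u :: real \<Rightarrow>\<^sub>C complex. reversible L u \<and> (\<forall>t. norm (u t) \<le> \<eta>)}"
    define N where "N u t = g t (apply_bcontfun u t)" for u :: "real \<Rightarrow>\<^sub>C complex" and t
    have cN: "continuous_on UNIV (N u)" if "u \<in> X" for u
    proof -
      have "continuous_on UNIV (\<lambda>t. (t, apply_bcontfun u t))"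
        by (intro continuous_intros) simp
      moreover have "range (\<lambda>t. (t, apply_bcontfun u t)) \<subseteq> UNIV \<times> cball 0 \<eta>"
        using that by (auto simp: X_def)
      ultimately have "continuous_on UNIV (\<lambda>t. g t (u t))"
        using continuous_on_compose2[OF cg] by fastforce
      then show ?thesis by (simp add: N_def[abs_def])
    qed
    have rN: "reversible L (N u)" if "u \<in> X" for u
      using that g1 g2 by (auto simp: X_def N_def reversible_def)
    have ex: "\<exists>v\<in>X. \<exists>v'. solves (N u) v v' \<and> (\<forall>t. norm (v' t) \<le> \<eta>)" if uX: "u \<in> X" for u
    proof -
      have "\<And>t. norm (N u t) \<le> \<kappa> * \<eta>" using uX gb by (auto simp: X_def N_def)
      then obtain w w' where w: "solves (N u) w w'" and bd: "\<And>t. norm (w t) \<le> K * (\<kappa> * \<eta>)"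
          "\<And>t. norm (w' t) \<le> K * (\<kappa> * \<eta>)"
        using exist[OF cN[OF uX] rN[OF uX], of "\<kappa> * \<eta>"] by blast
      have le: "K * (\<kappa> * \<eta>) \<le> \<eta>" 
        using mult_right_mono[OF \<kappa>(2), of \<eta>] \<eta> by (simp add: mult.assoc)
      have "continuous_on UNIV w" using w unfolding solves_def
        by (meson continuous_at_imp_continuous_on has_vector_derivative_continuous)
      then have "w \<in> bcontfun" using bd(1) unfolding bcontfun_def bounded_iff by auto
      then obtain v where v: "w = apply_bcontfun v" by (rule bcontfunE)
      have "v \<in> X" using w bd le by (auto simp: X_def v[symmetric] solves_def intro: order_trans)
      then show ?thesis using w v bd le order_trans by blast
    qed
    define \<Phi> where "\<Phi> u = (SOME v. v \<in> X \<and> (\<exists>v'. solves (N u) v v' \<and> (\<forall>t. norm (v' t) \<le> \<eta>)))" for u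
    have \<Phi>: "\<Phi> u \<in> X" "\<exists>v'. solves (N u) (\<Phi> u) v' \<and> (\<forall>t. norm (v' t) \<le> \<eta>)" if "u \<in> X" for u
      using someI_ex[of "\<lambda>v. v \<in> X \<and> (\<exists>v'. solves (N u) v v' \<and> (\<forall>t. norm (v' t) \<le> \<eta>))"] ex[OF that]
      unfolding \<Phi>_def by blast+
    have "\<exists>!u\<in>X. \<Phi> u = u"
    proof (rule Banach_fix[where c = "1/2"])
      have "closed {u :: real \<Rightarrow>\<^sub>C complex. (\<forall>t. u (- t) = cnj (u t)) \<and> (\<forall>t. u (t + 2*L) = u t) \<and> (\<forall>t. norm (u t) \<le> \<eta>)}"
        by (intro closed_Collect_conj closed_Collect_all closed_Collect_eq closed_Collect_le
              continuous_intros continuous_on_eval_bcontfun)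
      then show "complete X" by (simp add: complete_eq_closed X_def reversible_def conj_assoc)
      have "const_bcontfun 0 \<in> X" using \<eta> by (simp add: X_def reversible_def const_bcontfun.rep_eq)
      then show "X \<noteq> {}" by blast
      show "\<Phi> ` X \<subseteq> X" using \<Phi> by blast
      show "dist (\<Phi> u) (\<Phi> v) \<le> 1/2 * dist u v" if uv: "u \<in> X" "v \<in> X" for u v
      proof (rule dist_bound)
        fix t
        obtain u' v' where s: "solves (N u) (\<Phi> u) u'" "solves (N v) (\<Phi> v) v'"
          using \<Phi>(2) uv by metis
        have "norm (N u t - N v t) \<le> \<kappa> * dist u v" for t
        proof -
          have "norm (N u t - N v t) \<le> \<kappa> * norm (u t - v t)"
            using gl uv by (simp add: N_def X_def)
          also have "\<dots> \<le> \<kappa> * dist u v"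
            using \<kappa>(1) dist_bounded[of u t v] by (simp add: dist_norm)
          finally show ?thesis .
        qed
        moreover have "continuous_on UNIV (\<lambda>t. N u t - N v t)" "reversible L (\<lambda>t. N u t - N v t)"
          using cN rN uv by (auto intro!: continuous_intros simp: reversible_def)
        ultimately obtain w w' where w: "solves (\<lambda>t. N u t - N v t) w w'"
            "\<And>t. norm (w t) \<le> K * (\<kappa> * dist u v)"
          using exist[of "\<lambda>t. N u t - N v t" "\<kappa> * dist u v"] by blast
        have "norm (\<Phi> u t - \<Phi> v t) \<le> K * (\<kappa> * dist u v)"
          using w(2)[of t] unique[OF diff[OF s] w(1), of t] by simp
        also have "\<dots> \<le> 1/2 * dist u v"
          using mult_right_mono[OF \<kappa>(2), of "dist u v"] by (simp add: mult.assoc)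
        finally show "dist (\<Phi> u t) (\<Phi> v t) \<le> 1/2 * dist u v" by (simp add: dist_norm)
      qed
    qed auto
    then obtain u where u: "u \<in> X" "\<Phi> u = u" by blast
    with \<Phi>(2)[OF u(1)] obtain u' where "solves (N u) u u'" "\<forall>t. norm (u' t) \<le> \<eta>" by auto
    then show ?thesis using u(1) unfolding solves_def N_def X_def by blast
  qed
  show thesis by (rule that[OF \<kappa>(1) main])
qed

lemma power_law_derivative:
  fixes q :: "'a::real_inner"
  assumes "q \<noteq> 0"
  shows "((\<lambda>q. q /\<^sub>R norm q ^ n) has_derivative
    (\<lambda>h. h /\<^sub>R norm q ^ n - (real n * inner q h / norm q ^ (n+2)) *\<^sub>R q)) (at q within S)"
proof -
  have "((\<lambda>q. q /\<^sub>R norm q ^ n) has_derivative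
    (\<lambda>h. h /\<^sub>R norm q ^ n - (real n * inner q h / norm q ^ (n+2)) *\<^sub>R q)) (at q)"
  proof -
    have dn: "(norm has_derivative (\<lambda>h. inner h (sgn q))) (at q)"
      using has_derivative_norm[OF assms] .
    have p: "((\<lambda>q. norm q ^ n) has_derivative (\<lambda>h. real n * norm q ^ (n-1) * inner h (sgn q))) (at q)"
      by (rule derivative_eq_intros dn refl)+ (simp add: ac_simps)
    have nz: "norm q ^ n \<noteq> 0" using assms by simp
    have c: "real n * norm q ^ (n-1) * inner h (sgn q) / (norm q ^ n)\<^sup>2 = real n * inner q h / norm q ^ (n+2) " for h
    proof (cases n)
      case (Suc m)
      have "norm q ^ Suc m * norm q ^ Suc m = norm q ^ m * (norm q ^ (m + 2))"
        by (simp add: power_add[symmetric] power_Suc[symmetric] del: power_Suc)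
      show ?thesis using assms
        by (simp add: Suc sgn_div_norm inner_commute field_simps power2_eq_square)
    qed simp
    have "((\<lambda>q. inverse (norm q ^ n) *\<^sub>R q) has_derivative
        (\<lambda>h. inverse (norm q ^ n) *\<^sub>R h + (- (inverse (norm q ^ n) *
            (real n * norm q ^ (n-1) * inner h (sgn q)) * inverse (norm q ^ n))) *\<^sub>R q)) (at q)"
      by (rule has_derivative_scaleR[OF Deriv.has_derivative_inverse[OF nz p] has_derivative_ident])
    moreover have "inverse (norm q ^ n) * (real n * norm q ^ (n-1) * inner h (sgn q)) * inverse (norm q ^ n)
        = real n * inner q h / norm q ^ (n+2)" for h
      unfolding c[symmetric] by (simp add: power2_eq_square divide_inverse)
    ultimately show ?thesis by simp
  qed
  then show ?thesis by (rule has_derivative_at_withinI)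
qed

lemma one_plus_small_nonzero:
  fixes z :: complex
  assumes "norm z < 1"
  shows "1 + z \<noteq> 0"
proof
  assume "1 + z = 0"
  then have "z = - 1" by (simp add: add_eq_0_iff)
  then show False using assms by simp
qed

text \<open>What is left of centripetal acceleration and power law force at \<open>1 + z\<close> after their linear part
\<open>n Re z\<close> is removed.\<close>

definition circular_remainder :: "nat \<Rightarrow> complex \<Rightarrow> complex" where
  "circular_remainder n z = 1 + z - (1 + z) /\<^sub>R norm (1 + z) ^ n - of_real (real n * Re z)"

text \<open>The derivative vanishes at \<open>0\<close> and is continuous there, with \<open>k\<close> in the proof as an explicit modulus.\<close>

lemma circular_remainder_lipschitz:
  assumes "\<kappa> > 0"
  shows "\<exists>\<eta>>0. \<eta> \<le> 1/4 \<and> (\<forall>z z'. norm z \<le> \<eta> \<longrightarrow> norm z' \<le> \<eta> \<longrightarrow>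
      norm (circular_remainder n z - circular_remainder n z') \<le> \<kappa> * norm (z - z'))"
proof -
  define k where "k q = \<bar>1 - 1 / norm q ^ n\<bar> +
    real n * (norm (q - 1) * norm q / norm q ^ (n+2) + norm (q /\<^sub>R norm q ^ (n+2) - 1))" for q :: complex
  have "isCont k 1" unfolding k_def by (intro continuous_intros) auto
  moreover have "k 1 = 0" by (simp add: k_def)
  ultimately obtain d where d: "d > 0" "\<And>q. norm (q - 1) < d \<Longrightarrow> \<bar>k q\<bar> < \<kappa>"
    using assms unfolding continuous_at_eps_delta dist_norm real_norm_def by (metis diff_zero)
  define \<eta> where "\<eta> = min (1/4) (d/2)"
  have \<eta>: "\<eta> > 0" "\<eta> \<le> 1/4" "\<eta> < d" using d by (auto simp: \<eta>_def)
  define f where "f = circular_remainder n"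
  define f' where "f' z h = h - (h /\<^sub>R norm (1+z) ^ n - (real n * inner (1+z) h / norm (1+z) ^ (n+2)) *\<^sub>R (1+z))
      - of_real (real n * Re h)" for z h :: complex
  have der: "(f has_derivative f' z) (at z within cball 0 \<eta>)" if "z \<in> cball 0 \<eta>" for z
  proof -
    have "norm z < 1" using that \<eta> by simp
    then have "1 + z \<noteq> 0" by (rule one_plus_small_nonzero)
    have 1: "((\<lambda>z. 1 + z) has_derivative (\<lambda>h. h)) (at z within cball 0 \<eta>)"
      by (auto intro!: derivative_eq_intros)
    have 2: "((\<lambda>z. (1 + z) /\<^sub>R norm (1 + z) ^ n) has_derivative
      (\<lambda>h. h /\<^sub>R norm (1+z) ^ n - (real n * inner (1+z) h / norm (1+z) ^ (n+2)) *\<^sub>R (1+z)))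
        (at z within cball 0 \<eta>)"
      by (rule has_derivative_in_compose[OF 1 power_law_derivative[OF \<open>1 + z \<noteq> 0\<close>]])
    have 3: "((\<lambda>z. complex_of_real (real n * Re z)) has_derivative (\<lambda>h. of_real (real n * Re h)))
        (at z within cball 0 \<eta>)"
      by (auto intro!: derivative_eq_intros)
    show ?thesis unfolding f_def f'_def circular_remainder_def[abs_def]
      by (rule has_derivative_diff[OF has_derivative_diff[OF 1 2] 3])
  qed
  have on: "onorm (f' z) \<le> \<kappa>" if "z \<in> cball 0 \<eta>" for z
  proof (rule onorm_le)
    fix h :: complex
    define q where "q = 1 + z"
    define N where "N = norm q ^ (n+2)"
    have N0: "0 \<le> N" by (simp add: N_def)
    have eq: "f' z h = (1 - 1 / norm q ^ n) *\<^sub>R h + real n *\<^sub>R ((inner (q - 1) h) *\<^sub>R (q /\<^sub>R N) + Re h *\<^sub>R (q /\<^sub>R N - 1))"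
    proof -
      have "inner q h = inner (q - 1) h + Re h" by (simp add: inner_complex_def algebra_simps)
      then show ?thesis
        unfolding f'_def q_def[symmetric] N_def[symmetric]
        by (simp add: scaleR_conv_of_real algebra_simps divide_inverse)
    qed
    have "norm (f' z h) \<le> norm ((1 - 1 / norm q ^ n) *\<^sub>R h) +
        norm (real n *\<^sub>R ((inner (q - 1) h) *\<^sub>R (q /\<^sub>R N) + Re h *\<^sub>R (q /\<^sub>R N - 1)))"
      unfolding eq by (rule norm_triangle_ineq)
    also have "\<dots> = \<bar>1 - 1 / norm q ^ n\<bar> * norm h +
        real n * norm ((inner (q - 1) h) *\<^sub>R (q /\<^sub>R N) + Re h *\<^sub>R (q /\<^sub>R N - 1))"
      by simp
    also have "\<dots> \<le> \<bar>1 - 1 / norm q ^ n\<bar> * norm h +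
        real n * (norm ((inner (q - 1) h) *\<^sub>R (q /\<^sub>R N)) + norm (Re h *\<^sub>R (q /\<^sub>R N - 1)))"
      by (intro add_left_mono mult_left_mono norm_triangle_ineq) simp
    also have "\<dots> \<le> \<bar>1 - 1 / norm q ^ n\<bar> * norm h +
        real n * ((norm (q - 1) * norm h) * (norm q / N) + norm h * norm (q /\<^sub>R N - 1))"
    proof (intro add_mono mult_left_mono order_refl)
      have "norm ((inner (q - 1) h) *\<^sub>R (q /\<^sub>R N)) = \<bar>inner (q - 1) h\<bar> * (norm q / N)"
        using N0 by (simp add: divide_inverse abs_mult)
      also have "\<dots> \<le> (norm (q - 1) * norm h) * (norm q / N)"
        by (intro mult_right_mono Cauchy_Schwarz_ineq2) (simp add: N_def)
      finally show "norm ((inner (q - 1) h) *\<^sub>R (q /\<^sub>R N)) \<le> (norm (q - 1) * norm h) * (norm q / N)" .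
      show "norm (Re h *\<^sub>R (q /\<^sub>R N - 1)) \<le> norm h * norm (q /\<^sub>R N - 1)"
        using abs_Re_le_cmod[of h] by (simp add: mult_right_mono)
    qed simp_all
    also have "\<dots> = k q * norm h" by (simp add: k_def N_def algebra_simps)
    also have "\<dots> \<le> \<kappa> * norm h"
      using d(2)[of q] that \<eta> by (intro mult_right_mono) (auto simp: q_def)
    finally show "norm (f' z h) \<le> \<kappa> * norm h" .
  qed
  have "norm (f z - f z') \<le> \<kappa> * norm (z - z')" if "norm z \<le> \<eta>" "norm z' \<le> \<eta>" for z z'
    by (rule differentiable_bound[OF _ der on]) (use that in auto)
  then show ?thesis using \<eta> unfolding f_def by blast
qed

text \<open>The Lipschitz condition is asked for on discs about points of the unit circle, which are convex while the annulus that
they cover is not. That is enough, as the contraction argument only compares two positions at the same time.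
For \<open>L = pi\<close> the second symmetry is void, and for \<open>L = pi/2\<close> it says that \<open>P\<close> is odd.\<close>

definition mild_symmetric_perturbation :: "real \<Rightarrow> real \<Rightarrow> (complex \<Rightarrow> complex) \<Rightarrow> bool" where
  "mild_symmetric_perturbation L \<mu> P \<longleftrightarrow>
     (\<forall>z. 1/2 < norm z \<longrightarrow> norm z < 3/2 \<longrightarrow>
        P (cnj z) = cnj (P z) \<and> P (cis (2*L) * z) = cis (2*L) * P z) \<and>
     (\<forall>u. norm u = 1 \<longrightarrow> norm (P u) \<le> \<mu>) \<and>
     (\<forall>u. norm u = 1 \<longrightarrow> (\<forall>z\<in>cball u (1/2). \<forall>z'\<in>cball u (1/2). norm (P z - P z') \<le> \<mu> * norm (z - z')))"

text \<open>The last condition keeps the velocity close to that of a uniform rotation through the current position.\<close>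

definition near_circular_motion :: "real \<Rightarrow> real \<Rightarrow> (complex \<Rightarrow> complex) \<Rightarrow> (real \<Rightarrow> complex) \<Rightarrow> (real \<Rightarrow> complex) \<Rightarrow> bool" where
  "near_circular_motion L \<epsilon> F Q Q' \<longleftrightarrow>
     (\<forall>t. (Q has_vector_derivative Q' t) (at t)) \<and>
     (\<forall>t. (Q' has_vector_derivative F (Q t)) (at t)) \<and>
     (\<forall>t. Q (- t) = cnj (Q t)) \<and> (\<forall>t. Q (t + 2*L) = cis (2*L) * Q t) \<and>
     (\<forall>t. norm (Q t - cis t) \<le> \<epsilon>) \<and> (\<forall>t. norm (Q' t - \<i> * Q t) \<le> \<epsilon>)"

text \<open>In the rotating frame the equation for \<open>w\<close>, where \<open>Q t = cis t * (1 + w t)\<close>, is the linear one with forcing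
\<open>circular_remainder n w + cis (-t) * P (cis t * (1 + w))\<close>. The radius \<open>\<eta>\<close> is chosen first, so small that the
remainder uses up only half of the admissible Lipschitz constant, and the perturbation afterwards.\<close>

lemma perturbed_circular_orbit:
  fixes n :: nat
  assumes "0 < n" "n < 4" "L > 0" "sin (sqrt (4 - real n) * L) \<noteq> 0" "\<epsilon> > 0"
  obtains \<mu> where "\<mu> > 0"
    "\<And>P. mild_symmetric_perturbation L \<mu> P \<Longrightarrow>
     \<exists>Q Q'. near_circular_motion L \<epsilon> (\<lambda>z. P z - z /\<^sub>R norm z ^ n) Q Q'"
proof -
  have om: "sqrt (4 - real n) > 0" "real n > 0" "(sqrt (4 - real n))\<^sup>2 = 4 - real n"
    using assms by auto
  obtain \<kappa> where \<kappa>: "\<kappa> > 0" and solve: "\<And>\<eta> g. \<lbrakk>\<eta> > 0; mild_reversible_forcing L \<kappa> \<eta> g\<rbrakk> \<Longrightarrow>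
     \<exists>w w'. (\<forall>t. (w has_vector_derivative w' t) (at t)) \<and>
        (\<forall>t. (w' has_vector_derivative g t (w t) + of_real (real n * Re (w t)) - 2 * \<i> * w' t) (at t)) \<and>
        reversible L w \<and> (\<forall>t. norm (w t) \<le> \<eta>) \<and> (\<forall>t. norm (w' t) \<le> \<eta>)"
    by (rule rotating_nonlinear_problem[OF om(1) assms(3,4) om(2,3)], rule that, assumption, blast)
  define f where f_eq: "f = circular_remainder n"
  have f_def: "f z = 1 + z - (1 + z) /\<^sub>R norm (1 + z) ^ n - of_real (real n * Re z)" for z
    by (simp add: f_eq circular_remainder_def)
  have "\<kappa>/2 > 0" using \<kappa> by simp
  from circular_remainder_lipschitz[OF this, of n] obtain \<eta>0 where \<eta>0: "\<eta>0 > 0" "\<eta>0 \<le> 1/4"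
    and f0: "\<And>z z'. \<lbrakk>norm z \<le> \<eta>0; norm z' \<le> \<eta>0\<rbrakk> \<Longrightarrow> norm (f z - f z') \<le> \<kappa>/2 * norm (z - z')"
    unfolding f_eq by blast
  define \<eta> where "\<eta> = min \<eta>0 \<epsilon>"
  have \<eta>: "\<eta> > 0" "\<eta> \<le> 1/4" "\<eta> \<le> \<eta>0" "\<eta> \<le> \<epsilon>" using \<eta>0 assms by (auto simp: \<eta>_def)
  define \<mu> where "\<mu> = \<kappa> * \<eta> / 4"
  have \<mu>: "\<mu> > 0" "\<mu> \<le> \<kappa>/2"
    using \<eta> \<kappa> mult_left_mono[of \<eta> 1 \<kappa>] by (auto simp: \<mu>_def)
  have main: "\<exists>Q Q'. near_circular_motion L \<epsilon> (\<lambda>z. P z - z /\<^sub>R norm z ^ n) Q Q'"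
    if P: "mild_symmetric_perturbation L \<mu> P" for P
  proof -
    have P1: "\<And>z. \<lbrakk>1/2 < norm z; norm z < 3/2\<rbrakk> \<Longrightarrow> P (cnj z) = cnj (P z)"
      and P2: "\<And>z. \<lbrakk>1/2 < norm z; norm z < 3/2\<rbrakk> \<Longrightarrow> P (cis (2*L) * z) = cis (2*L) * P z"
      and Pb: "\<And>u. norm u = 1 \<Longrightarrow> norm (P u) \<le> \<mu>"
      and Pl: "\<And>u z z'. \<lbrakk>norm u = 1; z \<in> cball u (1/2); z' \<in> cball u (1/2)\<rbrakk> \<Longrightarrow>
         norm (P z - P z') \<le> \<mu> * norm (z - z')"
      using P unfolding mild_symmetric_perturbation_def by blast+
    define g where "g t z = f z + cis (- t) * P (cis t * (1 + z))" for t z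
    have near: "cis t * (1 + z) \<in> ball (cis t) (1/2)" if "norm z \<le> \<eta>" for t and z :: complex
      using that \<eta> by (simp add: dist_norm algebra_simps norm_mult)
    have near': "cis t * (1 + z) \<in> cball (cis t) (1/2)" if "norm z \<le> \<eta>" for t and z :: complex
      using near[OF that, of t] ball_subset_cball by blast
    have "continuous_on (ball u (1/2)) P" if "norm u = 1" for u
    proof (rule lipschitz_on_continuous_on[of \<mu>], rule lipschitz_onI)
      show "dist (P z) (P z') \<le> \<mu> * dist z z'" if "z \<in> ball u (1/2)" "z' \<in> ball u (1/2)" for z z'
        using Pl[OF \<open>norm u = 1\<close>, of z z'] that by (simp add: dist_norm)
    qed (use \<mu> in simp)
    then have cP: "continuous_on (\<Union>u\<in>sphere 0 1. ball u (1/2)) P"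
      by (intro continuous_on_open_UN) auto
    have nz: "norm (1 + z) \<noteq> 0" if "norm z \<le> \<eta>" for z :: complex
    proof -
      have "norm z < 1" using that \<eta> by simp
      then have "1 + z \<noteq> 0" by (rule one_plus_small_nonzero)
      then show ?thesis by simp
    qed
    have "mild_reversible_forcing L \<kappa> \<eta> g"
      unfolding mild_reversible_forcing_def
    proof (intro conjI allI impI)
      have "continuous_on (UNIV \<times> cball 0 \<eta>) (\<lambda>p. P (cis (fst p) * (1 + snd p)))"
        by (rule continuous_on_compose2[OF cP]) (use near in \<open>force intro!: continuous_intros\<close>)+
      moreover have "continuous_on (UNIV \<times> cball 0 \<eta>) (\<lambda>p::real \<times> complex. f (snd p))"
        unfolding f_def by (intro continuous_intros) (use nz in auto)
      ultimately show "continuous_on (UNIV \<times> cball 0 \<eta>) (\<lambda>(t, z). g t z)"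
        unfolding g_def case_prod_beta by (intro continuous_intros)
    next
      fix t :: real and z :: complex assume z: "norm z \<le> \<eta>"
      have ann: "1/2 < norm (cis t * (1 + z))" "norm (cis t * (1 + z)) < 3/2"
        using norm_triangle_ineq[of 1 z] norm_diff_ineq[of 1 z] z \<eta> by (auto simp: norm_mult)
      have "f (cnj z) = cnj (f z)"
      proof -
        have "norm (1 + cnj z) = norm (1 + z)"
          by (metis complex_cnj_add complex_cnj_one complex_mod_cnj)
        then show ?thesis unfolding f_def by simp
      qed
      moreover have "cis (- t) * (1 + cnj z) = cnj (cis t * (1 + z))" by (simp add: cis_cnj)
      then have "P (cis (- t) * (1 + cnj z)) = cnj (P (cis t * (1 + z)))" by (simp only: P1[OF ann])
      ultimately show "g (- t) (cnj z) = cnj (g t z)"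
        unfolding g_def by (simp add: cis_cnj)
      have "cis (t + 2*L) * (1 + z) = cis (2*L) * (cis t * (1 + z))"
        by (simp add: cis_mult[symmetric] ac_simps)
      moreover have "cis (- (t + 2*L)) * (cis (2*L) * X) = cis (- t) * X" for X
        by (simp add: cis_mult flip: mult.assoc)
      ultimately show "g (t + 2*L) z = g t z" unfolding g_def by (simp only: P2[OF ann])
      have "norm (g t z) \<le> norm (f z) + norm (P (cis t * (1 + z)))"
        unfolding g_def by (metis norm_triangle_ineq norm_mult norm_cis mult_1)
      also have "norm (f z) \<le> \<kappa>/2 * norm z"
        using f0[of z 0] z \<eta> \<eta>0 by (simp add: f_def)
      also have "\<kappa>/2 * norm z \<le> \<kappa>/2 * \<eta>" using z \<kappa> by simp
      also have "norm (P (cis t * (1 + z))) \<le> norm (P (cis t)) + norm (P (cis t * (1 + z)) - P (cis t))"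
        by (metis add.commute diff_add_cancel norm_triangle_ineq)
      also have "\<dots> \<le> \<mu> + \<mu> * norm (cis t * (1+z) - cis t)"
        using Pb[of "cis t"] Pl[of "cis t" "cis t * (1 + z)" "cis t"] near'[OF z, of t] by simp
      also have "cis t * (1+z) - cis t = cis t * z" by (simp add: algebra_simps)
      also have "\<mu> * norm (cis t * z) \<le> \<mu>"
        using z \<eta> \<mu> mult_left_mono[of "norm z" 1 \<mu>] by (simp add: norm_mult)
      finally show "norm (g t z) \<le> \<kappa> * \<eta>" by (simp add: \<mu>_def mult.commute)
    next
      fix t :: real and z z' :: complex assume z: "norm z \<le> \<eta>" and z': "norm z' \<le> \<eta>"
      have "norm (g t z - g t z') \<le> norm (f z - f z') + norm (P (cis t * (1 + z)) - P (cis t * (1 + z')))"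
      proof -
        have "g t z - g t z' = (f z - f z') + cis (-t) * (P (cis t * (1 + z)) - P (cis t * (1 + z')))"
          unfolding g_def by (simp add: algebra_simps)
        then show ?thesis by (metis norm_triangle_ineq norm_mult norm_cis mult_1)
      qed
      also have "\<dots> \<le> \<kappa>/2 * norm (z - z') + \<mu> * norm (cis t * (1+z) - cis t * (1+z'))"
        using f0[of z z'] Pl[of "cis t" "cis t * (1 + z)" "cis t * (1 + z')"] near'[OF z] near'[OF z'] z z' \<eta>
        by (intro add_mono) auto
      also have "cis t * (1+z) - cis t * (1+z') = cis t * (z - z')" by (simp add: algebra_simps)
      also have "\<kappa>/2 * norm (z - z') + \<mu> * norm (cis t * (z - z')) \<le> \<kappa> * norm (z - z')"
        using mult_right_mono[OF \<mu>(2), of "norm (z - z')"] by (simp add: norm_mult)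
      finally show "norm (g t z - g t z') \<le> \<kappa> * norm (z - z')" .
    qed
    from solve[OF \<eta>(1) this] obtain w w' where w: "\<And>t. (w has_vector_derivative w' t) (at t)"
      and w': "\<And>t. (w' has_vector_derivative g t (w t) + of_real (real n * Re (w t)) - 2 * \<i> * w' t) (at t)"
      and rev: "reversible L w" and bd: "\<And>t. norm (w t) \<le> \<eta>" "\<And>t. norm (w' t) \<le> \<eta>" by blast
    define Q where "Q t = cis t * (1 + w t)" for t
    define Q' where "Q' t = cis t * (w' t + \<i> * (1 + w t))" for t
    have dcis: "(cis has_vector_derivative \<i> * cis t) (at t)" for t
      by (auto simp: has_vector_derivative_complex_iff intro!: derivative_eq_intros)
    have dQ: "(Q has_vector_derivative Q' t) (at t)" for t
    proof -
      have "(Q has_vector_derivative cis t * (0 + w' t) + \<i> * cis t * (1 + w t)) (at t)"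
        unfolding Q_def by (intro has_vector_derivative_mult dcis has_vector_derivative_add w has_vector_derivative_const)
      then show ?thesis by (simp add: Q'_def algebra_simps)
    qed
    have dQ': "(Q' has_vector_derivative P (Q t) - Q t /\<^sub>R norm (Q t) ^ n) (at t)" for t
    proof -
      have "(Q' has_vector_derivative cis t * ((g t (w t) + of_real (real n * Re (w t)) - 2 * \<i> * w' t) + \<i> * (0 + w' t))
          + \<i> * cis t * (w' t + \<i> * (1 + w t))) (at t)"
        unfolding Q'_def by (intro has_vector_derivative_mult dcis has_vector_derivative_add w w'
          has_vector_derivative_const has_vector_derivative_mult_right)
      moreover have "cis t * ((g t (w t) + of_real (real n * Re (w t)) - 2 * \<i> * w' t) + \<i> * (0 + w' t))
          + \<i> * cis t * (w' t + \<i> * (1 + w t)) = cis t * (g t (w t) + of_real (real n * Re (w t)) - (1 + w t))"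
        by (simp add: algebra_simps)
      moreover have "\<dots> = cis t * (cis (-t) * P (Q t)) - cis t * ((1 + w t) /\<^sub>R norm (1 + w t) ^ n)"
        unfolding g_def f_def Q_def by (simp add: algebra_simps)
      moreover have "\<dots> = P (Q t) - Q t /\<^sub>R norm (Q t) ^ n"
        by (simp add: Q_def norm_mult cis_mult flip: mult.assoc)
      ultimately show ?thesis by simp
    qed
    have "Q (- t) = cnj (Q t)" for t
      using rev by (simp add: reversible_def Q_def cis_cnj)
    moreover have "Q (t + 2*L) = cis (2*L) * Q t" for t
      using rev by (simp add: reversible_def Q_def cis_mult[symmetric] ac_simps)
    moreover have "norm (Q t - cis t) \<le> \<epsilon>" for t
    proof -
      have "Q t - cis t = cis t * w t" by (simp add: Q_def algebra_simps)
      then show ?thesis using bd(1)[of t] \<eta> by (simp add: norm_mult)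
    qed
    moreover have "norm (Q' t - \<i> * Q t) \<le> \<epsilon>" for t
    proof -
      have "Q' t - \<i> * Q t = cis t * w' t" by (simp add: Q_def Q'_def algebra_simps)
      then show ?thesis using bd(2)[of t] \<eta> by (simp add: norm_mult)
    qed
    ultimately show ?thesis using dQ dQ' unfolding near_circular_motion_def by blast
  qed
  show thesis by (rule that[OF \<mu>(1) main])
qed

section \<open>The trace of a nearly circular motion\<close>

lemma sin_ge_half: "x / 2 \<le> sin x" if "0 \<le> x" "x \<le> pi/2" for x :: real
proof (cases "x \<le> pi/3")
  case True
  show ?thesis
  proof (cases "x = 0")
    case False
    then have "x > 0" using that by simp
    have "\<exists>z. 0 < z \<and> z < x \<and> sin x - sin 0 = (x - 0) * cos z"
      by (rule MVT2[OF \<open>x > 0\<close>]) (auto intro!: derivative_eq_intros)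
    then obtain z where z: "0 < z" "z < x" "sin x = x * cos z" by auto
    have "cos (pi/3) \<le> cos z" using z True by (intro cos_monotone_0_pi_le) auto
    then have "x * (1/2) \<le> x * cos z" using \<open>x > 0\<close> by (intro mult_left_mono) (auto simp: cos_60)
    then show ?thesis using z by simp
  qed simp
next
  case False
  have "sin (pi/3) \<le> sin x" using False that by (intro sin_monotone_2pi_le) auto
  moreover have "sqrt 3 \<ge> 17/10" by (rule real_le_rsqrt) (simp add: power2_eq_square)
  ultimately show ?thesis using that pi_less_4 pi_approx by (simp add: sin_60)
qed

lemma cis_chord:
  assumes "\<bar>s - t\<bar> \<le> pi"
  shows "\<bar>s - t\<bar> / 2 \<le> norm (cis s - cis t)"
proof -
  have "(norm (cis s - cis t))\<^sup>2 = (cos s - cos t)\<^sup>2 + (sin s - sin t)\<^sup>2"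
    by (simp add: cmod_power2)
  also have "\<dots> = 2 - 2 * cos (s - t)"
    using sin_cos_squared_add[of s] sin_cos_squared_add[of t] by (simp add: cos_diff power2_eq_square algebra_simps)
  also have "\<dots> = (2 * sin ((s - t)/2))\<^sup>2"
  proof -
    have "2 * ((s - t)/2) = s - t" by simp
    then have "cos (s - t) = 1 - 2 * (sin ((s - t)/2))\<^sup>2" using cos_double_sin by metis
    then show ?thesis by (simp add: power2_eq_square)
  qed
  finally have "norm (cis s - cis t) = \<bar>2 * sin ((s - t)/2)\<bar>"
    by (metis abs_norm_cancel power2_eq_iff_nonneg abs_ge_zero norm_ge_zero power2_abs)
  moreover have "\<bar>sin u\<bar> = \<bar>sin \<bar>u\<bar>\<bar>" for u :: real by (simp add: abs_if)
  from this[of "(s - t)/2"] have "\<bar>sin ((s - t)/2)\<bar> = \<bar>sin (\<bar>s - t\<bar>/2)\<bar>" by simp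
  moreover have "\<bar>s - t\<bar>/2/2 \<le> sin (\<bar>s - t\<bar>/2)"
    by (rule sin_ge_half) (use assms in auto)
  ultimately show ?thesis by simp
qed

text \<open>Equal positions at times \<open>s\<close> and \<open>t\<close> would make the chord from \<open>cis t\<close> to \<open>cis s\<close> comparable to
\<open>\<epsilon> * |s - t|\<close>, since \<open>w\<close> is small and varies slowly. For \<open>|s - t| \<le> pi\<close> the chord is at least half
of \<open>|s - t|\<close>.\<close>

lemma near_circular_motion_injective:
  assumes Q: "near_circular_motion L \<epsilon> F Q Q'" and "\<epsilon> \<le> 1/8" and st: "\<bar>s - t\<bar> \<le> pi" "Q s = Q t"
  shows "s = t"
proof -
  have dQ: "\<And>t. (Q has_vector_derivative Q' t) (at t)" and Qc: "\<And>t. norm (Q t - cis t) \<le> \<epsilon>"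
    and Q': "\<And>t. norm (Q' t - \<i> * Q t) \<le> \<epsilon>"
    using Q unfolding near_circular_motion_def by auto
  have \<epsilon>0: "\<epsilon> \<ge> 0" using Qc[of 0] norm_ge_zero order_trans by blast
  define w where "w t = cis (-t) * Q t - 1" for t
  have dcis: "((\<lambda>t. cis (-t)) has_vector_derivative - \<i> * cis (-t)) (at t)" for t
    by (auto simp: has_vector_derivative_complex_iff intro!: derivative_eq_intros)
  have dw: "(w has_vector_derivative cis (-t) * (Q' t - \<i> * Q t)) (at t)" for t
  proof -
    have "(w has_vector_derivative (cis (-t) * Q' t + - \<i> * cis (-t) * Q t) - 0) (at t)"
      unfolding w_def by (intro has_vector_derivative_diff has_vector_derivative_mult dcis dQ has_vector_derivative_const)
    then show ?thesis by (simp add: algebra_simps)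
  qed
  have "norm (w s - w t) \<le> \<epsilon> * norm (s - t)"
  proof (rule differentiable_bound[of UNIV])
    show "(w has_derivative (\<lambda>h. h *\<^sub>R (cis (-t) * (Q' t - \<i> * Q t)))) (at t within UNIV)" for t
      using dw by (simp add: has_vector_derivative_def)
    show "onorm (\<lambda>h. h *\<^sub>R (cis (-t) * (Q' t - \<i> * Q t))) \<le> \<epsilon>" for t
    proof (rule onorm_le)
      fix h :: real
      show "norm (h *\<^sub>R (cis (-t) * (Q' t - \<i> * Q t))) \<le> \<epsilon> * norm h"
        using mult_right_mono[OF Q'[of t], of "\<bar>h\<bar>"] by (simp add: norm_mult mult.commute)
    qed
  qed auto
  moreover have Qw: "Q t = cis t * (1 + w t)" for t
    by (simp add: w_def cis_mult flip: mult.assoc)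
  have wb: "norm (w t) \<le> \<epsilon>" for t
  proof -
    have "Q t - cis t = cis t * w t" by (subst Qw) (simp add: algebra_simps)
    then show ?thesis using Qc[of t] by (simp add: norm_mult)
  qed
  have "cis s - cis t = cis s * (w t - w s) + (cis t - cis s) * w t"
    using st(2) Qw[of s] Qw[of t] by (simp add: algebra_simps)
  then have "norm (cis s - cis t) \<le> norm (w s - w t) + norm (cis s - cis t) * norm (w t)"
    by (metis norm_triangle_ineq norm_mult norm_cis mult_1 norm_minus_commute)
  moreover have "norm (cis s - cis t) * norm (w t) \<le> norm (cis s - cis t) * (1/8)"
    using wb[of t] assms(2) by (intro mult_left_mono) auto
  moreover have "\<epsilon> * norm (s - t) \<le> 1/8 * \<bar>s - t\<bar>" using mult_right_mono[OF assms(2), of "\<bar>s - t\<bar>"] by simp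
  ultimately have "\<bar>s - t\<bar> \<le> 0" using cis_chord[OF st(1)] by simp
  then show ?thesis by simp
qed

text \<open>The curve is closer to the unit circle than the origin is, so it is homotopic to the circle in the punctured plane and
has winding number \<open>1\<close>. Points of the unbounded component have winding number \<open>0\<close>.\<close>

lemma near_circular_trace:
  assumes Q: "near_circular_motion L \<epsilon> F Q Q'" and e: "\<epsilon> \<le> 1/8" and per: "\<And>t. Q (t + 2*pi) = Q t"
  defines "\<gamma> \<equiv> \<lambda>\<tau>. Q (2 * pi * \<tau>)"
  shows "simple_path \<gamma>" "pathfinish \<gamma> = pathstart \<gamma>" "path_image \<gamma> = range Q" "0 \<in> inside (range Q)"
proof -
  have dQ: "\<And>t. (Q has_vector_derivative Q' t) (at t)" and Qc: "\<And>t. norm (Q t - cis t) \<le> \<epsilon>"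
    using Q unfolding near_circular_motion_def by auto
  have cQ: "continuous_on UNIV Q"
    using dQ by (meson continuous_at_imp_continuous_on has_vector_derivative_continuous)
  have path: "path \<gamma>" unfolding path_def \<gamma>_def
    by (rule continuous_on_compose2[OF cQ]) (auto intro!: continuous_intros)
  show loop: "pathfinish \<gamma> = pathstart \<gamma>"
    using per[of 0] by (simp add: \<gamma>_def pathfinish_def pathstart_def)
  interpret periodic_fun_simple Q "2*pi" by standard (rule per)
  show im: "path_image \<gamma> = range Q"
  proof
    show "path_image \<gamma> \<subseteq> range Q" by (auto simp: path_image_def \<gamma>_def)
    show "range Q \<subseteq> path_image \<gamma>"
    proof
      fix z assume "z \<in> range Q"
      then obtain t where t: "z = Q t" by blast
      define \<tau> where "\<tau> = t / (2*pi) - of_int \<lfloor>t / (2*pi)\<rfloor>"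
      have "0 \<le> \<tau>" "\<tau> \<le> 1" unfolding \<tau>_def by linarith+
      moreover have "2*pi*\<tau> = t - of_int \<lfloor>t / (2*pi)\<rfloor> * (2*pi)"
        by (simp add: \<tau>_def field_simps)
      then have "\<gamma> \<tau> = z" using minus_of_int[of t] t by (simp add: \<gamma>_def)
      ultimately show "z \<in> path_image \<gamma>" unfolding path_image_def by force
    qed
  qed
  show "simple_path \<gamma>"
  proof (rule simple_pathI[OF path])
    fix x y :: real assume xy: "0 \<le> x" "x < y" "y \<le> 1" "\<gamma> x = \<gamma> y"
    show "x = 0 \<and> y = 1"
    proof (cases "y - x \<le> 1/2")
      case True
      have "2*pi*(y - x) \<le> 2*pi*(1/2)" using True by (intro mult_left_mono) auto
      then have "2*pi*y = 2*pi*x"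
        by (intro near_circular_motion_injective[OF Q e]) (use xy in \<open>auto simp: \<gamma>_def algebra_simps\<close>)
      then show ?thesis using xy by simp
    next
      case False
      have "2*pi*(1 - (y - x)) \<le> 2*pi*(1/2)" using False by (intro mult_left_mono) auto
      moreover have "2*pi*(1 - (y - x)) \<ge> 0" using xy by simp
      moreover have "Q (2*pi*y - 2*pi) = Q (2*pi*y)" using per[of "2*pi*y - 2*pi"] by simp
      ultimately have "2*pi*y - 2*pi = 2*pi*x"
        by (intro near_circular_motion_injective[OF Q e]) (use xy in \<open>auto simp: \<gamma>_def algebra_simps abs_le_iff\<close>)
      then have "2*pi*(y - 1) = 2*pi*x" by (simp add: algebra_simps)
      then have "y - 1 = x" by simp
      then show ?thesis using xy by simp
    qed
  qed
  have "winding_number \<gamma> 0 = winding_number (circlepath 0 1) 0"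
  proof (rule winding_number_nearby_loops_eq[OF _ path _ loop])
    fix \<tau> :: real
    have "circlepath 0 1 \<tau> = cis (2*pi*\<tau>)" by (simp add: circlepath cis_conv_exp ac_simps)
    then show "norm (\<gamma> \<tau> - circlepath 0 1 \<tau>) < norm (circlepath 0 1 \<tau> - 0)"
      using Qc[of "2*pi*\<tau>"] e by (simp add: \<gamma>_def)
  qed auto
  then have "0 \<notin> outside (path_image \<gamma>)"
    using winding_number_zero_in_outside[OF path loop] by (auto simp: winding_number_circlepath_centre)
  moreover have "0 \<notin> range Q"
  proof
    assume "0 \<in> range Q"
    then obtain t where "Q t = 0" by force
    then show False using Qc[of t] e by simp
  qed
  ultimately show "0 \<in> inside (range Q)" by (auto simp: outside_inside im)
qed

text \<open>The left inverse carries the component of \<open>A z\<close> to a connected set that contains \<open>z\<close> and avoids \<open>C\<close>, hence to a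
bounded set; \<open>A\<close> carries its compact closure back.\<close>

lemma encloses_affine_image:
  fixes A :: "complex \<Rightarrow> real^3"
  assumes A: "continuous_on UNIV A" "range A = \<Lambda>" and B: "continuous_on UNIV B" "\<And>z. B (A z) = z"
    and z: "z \<in> inside C"
  shows "encloses_in \<Lambda> (A ` C) (A z)"
proof -
  define K where "K = connected_component_set (\<Lambda> - A ` C) (A z)"
  have "z \<notin> C" and bd: "bounded (connected_component_set (- C) z)" using z by (auto simp: inside_def)
  have inj: "A x = A y \<longleftrightarrow> x = y" for x y using B(2) by metis
  have in_dom: "A z \<in> \<Lambda> - A ` C" using \<open>z \<notin> C\<close> A(2) inj by auto
  then have zK: "A z \<in> K" by (simp add: K_def connected_component_refl)
  have KL: "K \<subseteq> \<Lambda> - A ` C" unfolding K_def by (rule connected_component_subset)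
  have "B ` K \<subseteq> connected_component_set (- C) z"
  proof (rule connected_component_maximal)
    show "z \<in> B ` K" using imageI[OF zK, of B] B(2) by simp
    show "connected (B ` K)"
      by (rule connected_continuous_image) (auto simp: K_def intro: continuous_on_subset[OF B(1)])
    show "B ` K \<subseteq> - C" using KL A(2) B(2) by force
  qed
  then have "bounded (B ` K)" using bd bounded_subset by blast
  then have "compact (closure (B ` K))" by simp
  then have "bounded (A ` closure (B ` K))"
    by (intro compact_imp_bounded compact_continuous_image) (auto intro: continuous_on_subset[OF A(1)])
  moreover have "K \<subseteq> A ` closure (B ` K)"
  proof
    fix x assume "x \<in> K"
    then obtain y where "x = A y" using KL A(2) by blast
    moreover have "y \<in> closure (B ` K)" using imageI[OF \<open>x \<in> K\<close>, of B] B(2) closure_subset[of "B ` K"] \<open>x = A y\<close> by auto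
    ultimately show "x \<in> A ` closure (B ` K)" by blast
  qed
  ultimately have "bounded K" using bounded_subset by blast
  moreover have "K \<in> components (\<Lambda> - A ` C)" unfolding K_def by (rule componentsI[OF in_dom])
  ultimately show ?thesis unfolding encloses_in_def using zK by blast
qed

section \<open>The attraction of the ring in a vertical plane\<close>

text \<open>All three identities hold because \<open>F (x + 2*pi) - F x\<close> does not depend on \<open>x\<close> for a primitive \<open>F\<close>.\<close>

lemma integral_over_period:
  fixes f :: "real \<Rightarrow> 'a::euclidean_space"
  assumes cont: "continuous_on UNIV f" and per: "\<And>t. f (t + 2*pi) = f t"
  shows "integral {a..a + 2*pi} f = integral {0..2*pi} f"
    and "integral {0..2*pi} (\<lambda>t. f (t + a)) = integral {0..2*pi} f"
    and "integral {0..2*pi} (\<lambda>t. f (- t)) = integral {0..2*pi} f"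
proof -
  obtain F where F: "\<And>x. (F has_vector_derivative f x) (at x)"
    using antiderivative_on_line[OF cont] by blast
  have shift: "((\<lambda>t. F (t + c)) has_vector_derivative f (t + c)) (at t)" for c t
  proof -
    have "((\<lambda>t::real. t + c) has_vector_derivative 1) (at t)"
      by (auto intro!: derivative_eq_intros)
    from vector_diff_chain_at[OF this F] show ?thesis by (simp add: o_def)
  qed
  have flip: "((\<lambda>t. - F (- t)) has_vector_derivative f (- t)) (at t)" for t
  proof -
    have "((\<lambda>t::real. - t) has_vector_derivative -1) (at t)"
      by (auto intro!: derivative_eq_intros)
    from has_vector_derivative_minus[OF vector_diff_chain_at[OF this F]] show ?thesis by (simp add: o_def)
  qed
  have const: "F (x + 2*pi) - F x = F (0 + 2*pi) - F 0" for x
  proof -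
    have "((\<lambda>t. F (t + 2*pi) - F t) has_vector_derivative 0) (at t)" for t
      using has_vector_derivative_diff[OF shift[of "2*pi" t] F[of t]] per by simp
    then have "((\<lambda>t. F (t + 2*pi) - F t) has_derivative (\<lambda>h. 0)) (at t)" for t
      by (simp add: has_vector_derivative_def)
    then show ?thesis
      using has_derivative_zero_unique[of UNIV "\<lambda>t. F (t + 2*pi) - F t" x 0] by auto
  qed
  have ftc: "integral {x..y} g = G y - G x" if "x \<le> y" "\<And>t. (G has_vector_derivative g t) (at t)" for x y :: real and G g :: "real \<Rightarrow> 'a"
    by (rule integral_unique[OF fundamental_theorem_of_calculus[OF that(1)]])
      (use that(2) has_vector_derivative_at_within in blast)
  have base: "integral {0..2*pi} f = F (0 + 2*pi) - F 0" using ftc[OF _ F, of 0 "2*pi"] by simp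
  show "integral {a..a + 2*pi} f = integral {0..2*pi} f"
    using ftc[OF _ F, of a "a + 2*pi"] const[of a] base by simp
  show "integral {0..2*pi} (\<lambda>t. f (t + a)) = integral {0..2*pi} f"
    using ftc[OF _ shift, of 0 "2*pi" a] const[of a] base by (simp add: add.commute)
  show "integral {0..2*pi} (\<lambda>t. f (- t)) = integral {0..2*pi} f"
    using ftc[OF _ flip, of 0 "2*pi"] const[of "-2*pi"] base by simp
qed

definition ring_point :: "real \<Rightarrow> real^3" where
  "ring_point \<theta> = vector [cos \<theta>, sin \<theta>, 0]"

lemma ring_point_axes: "ring_point \<theta> = cos \<theta> *\<^sub>R axis 1 1 + sin \<theta> *\<^sub>R axis 2 1"
  by (simp add: ring_point_def vec_eq_iff forall_3 vector_3 axis_def)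

lemma ring_point_in_unit_circle: "ring_point \<theta> \<in> unit_circle"
  by (simp add: ring_point_def unit_circle_def vector_3)

lemma continuous_on_ring_point [continuous_intros]:
  fixes f :: "'a::t2_space \<Rightarrow> real"
  shows "continuous_on S f \<Longrightarrow> continuous_on S (\<lambda>x. ring_point (f x))"
  unfolding ring_point_axes by (intro continuous_intros)

lemma closed_unit_circle: "closed unit_circle"
  unfolding unit_circle_def
  by (intro closed_Collect_conj closed_Collect_eq continuous_intros)

text \<open>Differentiation under the integral sign in a ball that avoids the ring.\<close>

lemma circle_potential_gradient:
  assumes x: "x \<notin> unit_circle"
  shows "GDERIV (circle_potential dens) x :>
    dens *\<^sub>R integral {0..2*pi} (\<lambda>\<theta>. (x - ring_point \<theta>) /\<^sub>R norm (x - ring_point \<theta>) ^ 3)"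
proof -
  obtain r where r: "r > 0" "ball x r \<subseteq> - unit_circle"
    using x closed_unit_circle open_contains_ball[of "- unit_circle"] by (auto simp: open_Compl)
  have nz: "y - ring_point \<theta> \<noteq> 0" if "y \<in> ball x r" for y \<theta>
    using r that ring_point_in_unit_circle[of \<theta>] by auto
  define G where "G y \<theta> = - (y - ring_point \<theta>) /\<^sub>R norm (y - ring_point \<theta>) ^ 3" for y \<theta>
  have cG: "continuous_on (ball x r \<times> cbox 0 (2*pi)) (\<lambda>p. G (fst p) (snd p))"
    unfolding G_def by (intro continuous_intros) (use nz in auto)
  have "((\<lambda>y. integral (cbox 0 (2*pi)) (\<lambda>\<theta>. 1 / norm (y - ring_point \<theta>))) has_derivative
     blinfun_apply (integral (cbox 0 (2*pi)) (\<lambda>\<theta>. blinfun_inner_left (G x \<theta>)))) (at x within ball x r)"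
  proof (rule leibniz_rule)
    fix y \<theta> assume y: "y \<in> ball x r"
    define d where "d = y - ring_point \<theta>"
    have dnz: "d \<noteq> 0" using nz[OF y] by (simp add: d_def)
    have "((\<lambda>y. y - ring_point \<theta>) has_derivative (\<lambda>h. h)) (at y)"
      by (auto intro!: derivative_eq_intros)
    from has_derivative_compose[OF this has_derivative_norm] dnz
    have "((\<lambda>y. norm (y - ring_point \<theta>)) has_derivative (\<lambda>h. inner h (sgn d))) (at y)"
      by (simp add: d_def)
    from Deriv.has_derivative_inverse[OF _ this] 
    have "((\<lambda>y. inverse (norm (y - ring_point \<theta>))) has_derivative
       (\<lambda>h. - (inverse (norm d) * inner h (sgn d) * inverse (norm d)))) (at y)"
      using dnz by (simp add: d_def)
    moreover have "- (inverse (norm d) * inner h (sgn d) * inverse (norm d)) = inner h (G y \<theta>)" for h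
      unfolding G_def d_def[symmetric] by (simp add: sgn_div_norm power3_eq_cube divide_inverse)
    ultimately show "((\<lambda>y. 1 / norm (y - ring_point \<theta>)) has_derivative
        blinfun_apply (blinfun_inner_left (G y \<theta>))) (at y within ball x r)"
      by (simp add: divide_inverse has_derivative_at_withinI)
  next
    fix y assume y: "y \<in> ball x r"
    show "(\<lambda>\<theta>. 1 / norm (y - ring_point \<theta>)) integrable_on cbox 0 (2*pi)"
      by (rule integrable_continuous) (intro continuous_intros, use nz[OF y] in auto)
  next
    show "continuous_on (ball x r \<times> cbox 0 (2*pi)) (\<lambda>(y, \<theta>). blinfun_inner_left (G y \<theta>))"
      unfolding case_prod_beta
      by (rule bounded_linear.continuous_on[OF bounded_linear_blinfun_inner_left cG])
  qed (use r in auto)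
  moreover have "integral (cbox 0 (2*pi)) (\<lambda>\<theta>. blinfun_inner_left (G x \<theta>)) = blinfun_inner_left (integral (cbox 0 (2*pi)) (G x))"
  proof -
    have "continuous_on (cbox 0 (2*pi)) (G x)"
      unfolding G_def by (intro continuous_intros) (use nz[of x] r in auto)
    from integral_linear[OF integrable_continuous[OF this] bounded_linear_blinfun_inner_left]
    show ?thesis by (simp add: o_def)
  qed
  ultimately have "((\<lambda>y. integral {0..2*pi} (\<lambda>\<theta>. 1 / norm (y - ring_point \<theta>))) has_derivative
     (\<lambda>h. inner h (integral {0..2*pi} (G x)))) (at x)"
    using at_within_open[of x "ball x r"] r by simp
  from has_derivative_mult_right[OF this, of "- dens"]
  have "((\<lambda>y. - dens * integral {0..2*pi} (\<lambda>\<theta>. 1 / norm (y - ring_point \<theta>))) has_derivative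
     (\<lambda>h. inner h (dens *\<^sub>R - integral {0..2*pi} (G x)))) (at x)" by simp
  moreover have "circle_potential dens = (\<lambda>y. - dens * integral {0..2*pi} (\<lambda>\<theta>. 1 / norm (y - ring_point \<theta>)))"
    unfolding circle_potential_def ring_point_def[symmetric] by (simp flip: integral_mult_right add: fun_eq_iff)
  moreover have "- integral {0..2*pi} (G x) = integral {0..2*pi} (\<lambda>\<theta>. (x - ring_point \<theta>) /\<^sub>R norm (x - ring_point \<theta>) ^ 3)"
    unfolding G_def by (simp only: scaleR_minus_right integral_neg minus_minus)
  ultimately show ?thesis unfolding gderiv_def by simp
qed

text \<open>The gradient of the potential for density \<open>1\<close> in a vertical plane with coordinates \<open>Re q\<close> (horizontal) and
\<open>Im q\<close> (vertical). The root is the distance to the ring point at angle \<open>\<theta>\<close> from the plane.\<close>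

definition ring_pull :: "complex \<Rightarrow> complex" where
  "ring_pull q = integral {0..2*pi}
     (\<lambda>\<theta>. (q - of_real (cos \<theta>)) /\<^sub>R sqrt ((norm q)\<^sup>2 + 1 - 2 * Re q * cos \<theta>) ^ 3)"

definition meridian :: "real \<Rightarrow> complex \<Rightarrow> real^3" where
  "meridian \<alpha> q = Re q *\<^sub>R (cos \<alpha> *\<^sub>R axis 1 1 + sin \<alpha> *\<^sub>R axis 2 1) + Im q *\<^sub>R axis 3 1"

lemma bounded_linear_meridian: "bounded_linear (meridian \<alpha>)"
  unfolding meridian_def
  by (intro bounded_linear_add bounded_linear_scaleR_left[THEN bounded_linear_compose] bounded_linear_Re bounded_linear_Im)

lemma meridian_nth:
  "meridian \<alpha> q $ 1 = Re q * cos \<alpha>" "meridian \<alpha> q $ 2 = Re q * sin \<alpha>" "meridian \<alpha> q $ 3 = Im q"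
  by (simp_all add: meridian_def axis_def)

lemma norm_vec3_sq: "(norm (x::real^3))\<^sup>2 = (x$1)\<^sup>2 + (x$2)\<^sup>2 + (x$3)\<^sup>2"
  unfolding power2_norm_eq_inner inner_vec_def by (simp add: sum_3 power2_eq_square)

lemma norm_meridian: "norm (meridian \<alpha> q) = norm q"
proof -
  have "(Re q * cos \<alpha>)\<^sup>2 + (Re q * sin \<alpha>)\<^sup>2 = (Re q)\<^sup>2"
    by (simp add: power_mult_distrib flip: distrib_left)
  then have "(norm (meridian \<alpha> q))\<^sup>2 = (norm q)\<^sup>2"
    unfolding norm_vec3_sq meridian_nth cmod_power2 by simp
  then show ?thesis by (simp add: power2_eq_iff_nonneg)
qed

lemma meridian_in_unit_circle: "meridian \<alpha> q \<in> unit_circle \<longleftrightarrow> q = 1 \<or> q = -1"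
proof -
  have "(Re q * cos \<alpha>)\<^sup>2 + (Re q * sin \<alpha>)\<^sup>2 = (Re q)\<^sup>2"
    by (simp add: power_mult_distrib flip: distrib_left)
  then show ?thesis
    by (auto simp: unit_circle_def meridian_nth complex_eq_iff power2_eq_1_iff)
qed

lemma ring_distance_sq:
  "(norm (meridian \<alpha> q - ring_point (\<theta> + \<alpha>)))\<^sup>2 = (norm q)\<^sup>2 + 1 - 2 * Re q * cos \<theta>"
proof -
  have "(Re q * cos \<alpha> - cos (\<theta> + \<alpha>))\<^sup>2 + (Re q * sin \<alpha> - sin (\<theta> + \<alpha>))\<^sup>2
     = (Re q)\<^sup>2 * (cos \<alpha>)\<^sup>2 + (Re q)\<^sup>2 * (sin \<alpha>)\<^sup>2 + (cos (\<theta> + \<alpha>))\<^sup>2 + (sin (\<theta> + \<alpha>))\<^sup>2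
       - 2 * Re q * cos ((\<theta> + \<alpha>) - \<alpha>)"
    unfolding cos_diff[of "\<theta> + \<alpha>" \<alpha>] by (simp add: power2_eq_square algebra_simps)
  moreover have "(Re q)\<^sup>2 * (cos \<alpha>)\<^sup>2 + (Re q)\<^sup>2 * (sin \<alpha>)\<^sup>2 = (Re q)\<^sup>2"
    by (simp flip: distrib_left)
  moreover have "(cos (\<theta> + \<alpha>))\<^sup>2 + (sin (\<theta> + \<alpha>))\<^sup>2 = 1" by simp
  ultimately have "(Re q * cos \<alpha> - cos (\<theta> + \<alpha>))\<^sup>2 + (Re q * sin \<alpha> - sin (\<theta> + \<alpha>))\<^sup>2
     = (Re q)\<^sup>2 + 1 - 2 * Re q * cos \<theta>" by simp
  then show ?thesis
    unfolding norm_vec3_sq cmod_power2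
    by (simp add: meridian_nth ring_point_def vector_3)
qed

text \<open>Measuring angles from the plane splits the attraction of a ring point into a part in the plane and a multiple of the
normal \<open>e\<close>. The latter is odd in the angle and integrates to \<open>0\<close>.\<close>

lemma meridian_gradient:
  assumes q: "q \<noteq> 1" "q \<noteq> -1"
  shows "GDERIV (circle_potential dens) (meridian \<alpha> q) :> dens *\<^sub>R meridian \<alpha> (ring_pull q)"
proof -
  have x: "meridian \<alpha> q \<notin> unit_circle" using q by (simp add: meridian_in_unit_circle)
  define D where "D \<theta> = sqrt ((norm q)\<^sup>2 + 1 - 2 * Re q * cos \<theta>) ^ 3" for \<theta>
  define V where "V \<theta> = (meridian \<alpha> q - ring_point \<theta>) /\<^sub>R norm (meridian \<alpha> q - ring_point \<theta>) ^ 3" for \<theta>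
  define e where "e = (sin \<alpha> *\<^sub>R axis 1 1 - cos \<alpha> *\<^sub>R axis 2 1 :: real^3)"
  have dist: "norm (meridian \<alpha> q - ring_point (\<theta> + \<alpha>)) ^ 3 = D \<theta>" for \<theta>
    unfolding D_def ring_distance_sq[of \<alpha> q \<theta>, symmetric] by simp
  have nz: "norm (meridian \<alpha> q - ring_point \<theta>) \<noteq> 0" for \<theta>
    using x ring_point_in_unit_circle[of \<theta>] by auto
  have Dnz: "D \<theta> \<noteq> 0" for \<theta> using nz[of "\<theta> + \<alpha>"] dist[of \<theta>] by (metis power_not_zero)
  have cD: "continuous_on S D" for S unfolding D_def by (intro continuous_intros)
  have cV: "continuous_on UNIV V" unfolding V_def by (intro continuous_intros) (use nz in auto)
  have V: "V (\<theta> + \<alpha>) = meridian \<alpha> ((q - of_real (cos \<theta>)) /\<^sub>R D \<theta>) + (sin \<theta> / D \<theta>) *\<^sub>R e" for \<theta>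
  proof -
    have "meridian \<alpha> q - ring_point (\<theta> + \<alpha>) = meridian \<alpha> (q - of_real (cos \<theta>)) + sin \<theta> *\<^sub>R e"
      by (simp add: vec_eq_iff forall_3 meridian_nth ring_point_def vector_3 e_def axis_def
          cos_add sin_add left_diff_distrib)
    then show ?thesis unfolding V_def dist
      by (simp add: scaleR_add_right linear_scale[OF bounded_linear.linear[OF bounded_linear_meridian]] divide_inverse mult.commute)
  qed
  have "integral {0..2*pi} V = integral {0..2*pi} (\<lambda>\<theta>. V (\<theta> + \<alpha>))"
    by (rule integral_over_period(2)[OF cV, symmetric]) (simp add: V_def ring_point_def)
  also have "\<dots> = integral {0..2*pi} (\<lambda>\<theta>. meridian \<alpha> ((q - of_real (cos \<theta>)) /\<^sub>R D \<theta>))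
      + integral {0..2*pi} (\<lambda>\<theta>. (sin \<theta> / D \<theta>) *\<^sub>R e)"
    unfolding V
    by (intro integral_add integrable_continuous_real bounded_linear.continuous_on[OF bounded_linear_meridian]
        continuous_intros cD) (use Dnz in auto)
  also have "integral {0..2*pi} (\<lambda>\<theta>. (sin \<theta> / D \<theta>) *\<^sub>R e) = 0"
  proof -
    have "continuous_on UNIV (\<lambda>\<theta>. (sin \<theta> / D \<theta>) *\<^sub>R e)" by (intro continuous_intros cD) (use Dnz in auto)
    from integral_over_period(3)[OF this]
    have eq: "- X = X" if "X = integral {0..2*pi} (\<lambda>\<theta>. (sin \<theta> / D \<theta>) *\<^sub>R e)" for X
      unfolding that integral_neg[symmetric] by (simp add: D_def)
    have zero: "X = 0" if "- X = X" for X :: "real^3"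
    proof -
      have "2 *\<^sub>R X = X + - X" unfolding that by (rule scaleR_2)
      then show ?thesis by simp
    qed
    show ?thesis by (rule zero[OF eq[OF refl]])
  qed
  also have "integral {0..2*pi} (\<lambda>\<theta>. meridian \<alpha> ((q - of_real (cos \<theta>)) /\<^sub>R D \<theta>)) = meridian \<alpha> (ring_pull q)"
  proof -
    have "continuous_on {0..2*pi} (\<lambda>\<theta>. (q - of_real (cos \<theta>)) /\<^sub>R D \<theta>)"
      by (intro continuous_intros cD) (use Dnz in auto)
    from integral_linear[OF integrable_continuous_real[OF this] bounded_linear_meridian]
    show ?thesis by (simp add: o_def ring_pull_def D_def)
  qed
  finally show ?thesis using circle_potential_gradient[OF x, of dens] by (simp add: V_def)
qed

lemma ring_pull_cnj: "ring_pull (cnj q) = cnj (ring_pull q)"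
  unfolding ring_pull_def by (simp add: integral_cnj)

lemma ring_integrand_continuous:
  assumes "q \<noteq> 1" "q \<noteq> -1"
  shows "continuous_on S (\<lambda>\<theta>. (q - of_real (cos \<theta>)) /\<^sub>R sqrt ((norm q)\<^sup>2 + 1 - 2 * Re q * cos \<theta>) ^ 3)"
proof -
  have "sqrt ((norm q)\<^sup>2 + 1 - 2 * Re q * cos \<theta>) \<noteq> 0" for \<theta>
  proof -
    have "meridian 0 q \<noteq> ring_point (\<theta> + 0)"
      using assms ring_point_in_unit_circle meridian_in_unit_circle by metis
    then show ?thesis unfolding ring_distance_sq[of 0 q \<theta>, symmetric] by simp
  qed
  then show ?thesis by (intro continuous_intros) auto
qed

text \<open>Invariance of the ring under a half turn, as a shift of the angle by \<open>pi\<close>.\<close>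

lemma ring_pull_uminus:
  assumes "q \<noteq> 1" "q \<noteq> -1"
  shows "ring_pull (- q) = - ring_pull q"
proof -
  define f where "f q \<theta> = (q - of_real (cos \<theta>)) /\<^sub>R sqrt ((norm q)\<^sup>2 + 1 - 2 * Re q * cos \<theta>) ^ 3" for q :: complex and \<theta>
  have eq: "- q \<noteq> 1" "- q \<noteq> -1" using assms by (metis minus_minus)+
  have c: "continuous_on UNIV (f (-q))" unfolding f_def by (rule ring_integrand_continuous[OF eq])
  have "ring_pull (- q) = integral {0..2*pi} (f (-q))" by (simp add: ring_pull_def f_def[abs_def])
  also have "\<dots> = integral {0..2*pi} (\<lambda>\<theta>. f (-q) (\<theta> + pi))"
    by (rule integral_over_period(2)[OF c, symmetric]) (simp add: f_def)
  also have "\<dots> = integral {0..2*pi} (\<lambda>\<theta>. - f q \<theta>)"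
  proof -
    have "f (-q) (\<theta> + pi) = (- (q - of_real (cos \<theta>))) /\<^sub>R sqrt ((norm q)\<^sup>2 + 1 - 2 * Re q * cos \<theta>) ^ 3" for \<theta>
      by (simp add: f_def)
    then show ?thesis unfolding f_def by (simp only: scaleR_minus_right)
  qed
  also have "\<dots> = - ring_pull q" by (simp add: ring_pull_def f_def[abs_def])
  finally show ?thesis .
qed

section \<open>The ring seen from far away\<close>

lemma norm_fst_le_norm: "norm (fst p) \<le> norm p" for p :: "'a::real_normed_vector \<times> 'b::real_normed_vector"
  by (simp add: norm_prod_def real_le_rsqrt)

text \<open>The field \<open>X \<mapsto> X / |X|^3\<close> is smooth away from \<open>0\<close>, so on a compact shell it is uniformly close,
together with its derivative, to its translate by a short vector \<open>U\<close>. The constants below are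
rough bounds for the derivative \<open>h \<mapsto> a X h - 3 (X \<bullet> h) b X\<close> on the shell of radii \<open>1/4\<close> and \<open>2\<close>.\<close>

lemma inverse_square_translation_small:
  fixes \<mu> :: real
  assumes "\<mu> > 0"
  shows "\<exists>\<sigma>>0. \<sigma> \<le> 1/4 \<and> (\<forall>U u :: 'a::euclidean_space. norm U \<le> \<sigma> \<longrightarrow> norm u = 1 \<longrightarrow>
     norm (u /\<^sub>R norm u ^ 3 - (u - U) /\<^sub>R norm (u - U) ^ 3) \<le> \<mu> \<and>
     (\<forall>X\<in>cball u (1/2). \<forall>Y\<in>cball u (1/2).
       norm ((X /\<^sub>R norm X ^ 3 - (X - U) /\<^sub>R norm (X - U) ^ 3) - (Y /\<^sub>R norm Y ^ 3 - (Y - U) /\<^sub>R norm (Y - U) ^ 3))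
         \<le> \<mu> * norm (X - Y)))"
proof -
  define A where "A = cball (0::'a) 2 - ball 0 (1/4)"
  have cA: "compact A" unfolding A_def by (intro compact_diff) auto
  have A: "X \<in> A \<longleftrightarrow> 1/4 \<le> norm X \<and> norm X \<le> 2" for X by (auto simp: A_def)
  define e where "e = \<mu> / 14"
  have e: "e > 0" using assms by (simp add: e_def)
  have uc: "\<exists>d>0. \<forall>X\<in>A. \<forall>Y\<in>A. norm (X - Y) < d \<longrightarrow> norm (f X - f Y) < e"
    if "continuous_on A f" for f :: "'a \<Rightarrow> 'b::real_normed_vector"
    using compact_uniformly_continuous[OF that cA] e unfolding uniformly_continuous_on_def dist_norm
    by (metis norm_minus_commute)
  define a where "a X = 1 / norm X ^ 3" for X :: 'a
  define b where "b X = X /\<^sub>R norm X ^ 5" for X :: 'a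
  define k where "k X = X /\<^sub>R norm X ^ 3" for X :: 'a
  have "continuous_on A a" "continuous_on A b" "continuous_on A k"
    unfolding a_def b_def k_def by (intro continuous_intros; force simp: A)+
  note uniform = uc[OF this(1)] uc[OF this(2)] uc[OF this(3)]
  obtain d1 where d1: "d1 > 0" and a: "\<And>X Y. X \<in> A \<Longrightarrow> Y \<in> A \<Longrightarrow> norm (X - Y) < d1 \<Longrightarrow> norm (a X - a Y) < e"
    using uniform(1) by blast
  obtain d2 where d2: "d2 > 0" and b: "\<And>X Y. X \<in> A \<Longrightarrow> Y \<in> A \<Longrightarrow> norm (X - Y) < d2 \<Longrightarrow> norm (b X - b Y) < e"
    using uniform(2) by blast
  obtain d3 where d3: "d3 > 0" and k: "\<And>X Y. X \<in> A \<Longrightarrow> Y \<in> A \<Longrightarrow> norm (X - Y) < d3 \<Longrightarrow> norm (k X - k Y) < e"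
    using uniform(3) by blast
  define \<sigma> where "\<sigma> = min (min (d1/2) (d2/2)) (min (d3/2) (min (1/4) (\<mu>/1536)))"
  have \<sigma>: "\<sigma> > 0" "\<sigma> < d1" "\<sigma> < d2" "\<sigma> < d3" "\<sigma> \<le> 1/4" "\<sigma> \<le> \<mu>/1536"
    using d1 d2 d3 assms by (auto simp: \<sigma>_def)
  have main: "norm (k u - k (u - U)) \<le> \<mu> \<and> (\<forall>X\<in>cball u (1/2). \<forall>Y\<in>cball u (1/2).
       norm ((k X - k (X - U)) - (k Y - k (Y - U))) \<le> \<mu> * norm (X - Y))"
    if U: "norm U \<le> \<sigma>" and u: "norm u = 1" for U u
  proof -
    have ann: "X \<in> A" "X - U \<in> A" if X: "X \<in> cball u (1/2)" for X
    proof -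
      have "norm X \<ge> 1/2" "norm X \<le> 3/2"
        using X u norm_triangle_ineq2[of u X] norm_triangle_ineq2[of X u] by (auto simp: dist_norm norm_minus_commute)
      moreover have "norm (X - U) \<ge> norm X - 1/4" "norm (X - U) \<le> norm X + 1/4"
        using U \<sigma>(5) norm_triangle_ineq2[of X U] norm_triangle_ineq4[of X U] by auto
      ultimately show "X \<in> A" "X - U \<in> A" by (auto simp: A)
    qed
    define D where "D X h = (h /\<^sub>R norm X ^ 3 - (real 3 * inner X h / norm X ^ (3+2)) *\<^sub>R X)" for X h :: 'a
    have kd: "(k has_derivative D X) (at X within S)" if "X \<in> A" for X S
      unfolding k_def[abs_def] D_def[abs_def] by (rule power_law_derivative) (use that A in auto)
    have der: "((\<lambda>X. k X - k (X - U)) has_derivative (\<lambda>h. D X h - D (X - U) h)) (at X within cball u (1/2))"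
      if X: "X \<in> cball u (1/2)" for X
    proof -
      have "((\<lambda>X. X - U) has_derivative (\<lambda>h. h)) (at X within cball u (1/2))"
        by (auto intro!: derivative_eq_intros)
      from has_derivative_diff[OF kd[OF ann(1)[OF X]] has_derivative_in_compose[OF this kd[OF ann(2)[OF X]]]]
      show ?thesis .
    qed
    have on: "onorm (\<lambda>h. D X h - D (X - U) h) \<le> \<mu>" if X: "X \<in> cball u (1/2)" for X
    proof (rule onorm_le)
      fix h
      define Z where "Z = X - U"
      note XA = ann[OF X, folded Z_def]
      have XZ: "norm (X - Z) \<le> \<sigma>" using U by (simp add: Z_def)
      have eq: "D X h - D Z h = (a X - a Z) *\<^sub>R h - (3 * inner U h) *\<^sub>R b X - (3 * inner Z h) *\<^sub>R (b X - b Z)"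
      proof -
        have "inner X h = inner U h + inner Z h" by (simp add: Z_def inner_diff_left)
        then show ?thesis unfolding D_def a_def b_def by (simp add: divide_inverse algebra_simps)
      qed
      have t3: "norm (p - q - r) \<le> norm p + norm q + norm r" for p q r :: 'a
        using norm_triangle_ineq4[of "p - q" r] norm_triangle_ineq4[of p q] by linarith
      have "norm (D X h - D Z h) \<le> norm ((a X - a Z) *\<^sub>R h) + norm ((3 * inner U h) *\<^sub>R b X) + norm ((3 * inner Z h) *\<^sub>R (b X - b Z))"
        unfolding eq by (rule t3)
      also have "norm ((a X - a Z) *\<^sub>R h) \<le> e * norm h"
        using a[OF XA] XZ \<sigma> by (simp add: mult_right_mono)
      also have "norm ((3 * inner U h) *\<^sub>R b X) \<le> (3 * (\<sigma> * norm h)) * 256"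
      proof -
        have "norm (b X) = norm X / norm X ^ Suc 4"
          by (simp add: b_def divide_inverse)
        also have "\<dots> = 1 / norm X ^ 4"
        proof -
          have "norm X > 0" using XA A[of X] by linarith
          then show ?thesis unfolding power_Suc by simp
        qed
        also have "\<dots> \<le> 1 / (1/4) ^ 4"
          using XA by (intro divide_left_mono power_mono mult_pos_pos zero_less_power) (auto simp: A)
        finally have "norm (b X) \<le> 256" by (simp add: eval_nat_numeral)
        moreover have "\<bar>inner U h\<bar> \<le> \<sigma> * norm h"
          using Cauchy_Schwarz_ineq2[of U h] mult_right_mono[OF U, of "norm h"] by simp
        ultimately have "\<bar>3 * inner U h\<bar> * norm (b X) \<le> (3 * (\<sigma> * norm h)) * 256"
          by (intro mult_mono) auto
        then show ?thesis by simp
      qed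
      also have "norm ((3 * inner Z h) *\<^sub>R (b X - b Z)) \<le> (3 * (2 * norm h)) * e"
      proof -
        have "\<bar>inner Z h\<bar> \<le> 2 * norm h"
          using Cauchy_Schwarz_ineq2[of Z h] mult_right_mono[of "norm Z" 2 "norm h"] XA by (simp add: A)
        moreover have "norm (b X - b Z) \<le> e" using b[OF XA] XZ \<sigma> by simp
        ultimately have "\<bar>3 * inner Z h\<bar> * norm (b X - b Z) \<le> (3 * (2 * norm h)) * e"
          by (intro mult_mono) auto
        then show ?thesis by simp
      qed
      also have "e * norm h + (3 * (\<sigma> * norm h)) * 256 + (3 * (2 * norm h)) * e = (7 * e + 768 * \<sigma>) * norm h"
        by (simp add: algebra_simps)
      also have "\<dots> \<le> \<mu> * norm h"
        by (intro mult_right_mono) (use \<sigma> in \<open>auto simp: e_def\<close>)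
      finally show "norm (D X h - D (X - U) h) \<le> \<mu> * norm h" by (simp add: Z_def)
    qed
    have "norm (k u - k (u - U)) < e"
      by (rule k) (use ann[of u] U \<sigma> in auto)
    moreover have "e \<le> \<mu>" using assms by (simp add: e_def)
    ultimately show ?thesis
      using differentiable_bound[OF convex_cball der on] by auto
  qed
  show ?thesis
    by (rule exI[of _ \<sigma>]) (use \<sigma> main in \<open>simp add: k_def\<close>)
qed

text \<open>Deviation of the attraction of the ring from that of a point of the same mass \<open>2 * pi\<close>, at distances of order \<open>R\<close>
and rescaled to order \<open>1\<close>.\<close>

definition far_perturbation :: "real \<Rightarrow> complex \<Rightarrow> complex" where
  "far_perturbation R z = z /\<^sub>R norm z ^ 3 - (R\<^sup>2 / (2*pi)) *\<^sub>R ring_pull (R *\<^sub>R z)"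

text \<open>The deviation is the average over the ring of the inverse square field minus its translate by a
ring point, which has length \<open>1/R\<close> after rescaling. Ring points leave the vertical plane, so the inverse square field
is taken on \<open>\<complex> \<times> \<real>\<close>, in which the plane is \<open>E\<close>, and projected back.\<close>

lemma far_perturbation_mild:
  assumes "\<mu> > 0"
  shows "\<exists>R0>0. \<forall>R\<ge>R0. mild_symmetric_perturbation (pi/2) \<mu> (far_perturbation R)"
proof -
  obtain \<sigma>0 where \<sigma>0: "\<sigma>0 > 0" "\<sigma>0 \<le> 1/4" and small: "\<And>U u :: complex \<times> real. norm U \<le> \<sigma>0 \<Longrightarrow> norm u = 1 \<Longrightarrow>
     norm (u /\<^sub>R norm u ^ 3 - (u - U) /\<^sub>R norm (u - U) ^ 3) \<le> \<mu> \<and>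
     (\<forall>X\<in>cball u (1/2). \<forall>Y\<in>cball u (1/2).
       norm ((X /\<^sub>R norm X ^ 3 - (X - U) /\<^sub>R norm (X - U) ^ 3) - (Y /\<^sub>R norm Y ^ 3 - (Y - U) /\<^sub>R norm (Y - U) ^ 3))
         \<le> \<mu> * norm (X - Y))"
    using inverse_square_translation_small[OF assms, where 'a = "complex \<times> real"] by blast
  have main: "mild_symmetric_perturbation (pi/2) \<mu> (far_perturbation R)" if R: "R \<ge> 1/\<sigma>0" for R
  proof -
    define \<sigma> where "\<sigma> = 1 / R"
    have "1/\<sigma>0 \<ge> 4" using \<sigma>0 by (simp add: field_simps)
    then have R4: "R \<ge> 4" using R by simp
    have \<sigma>: "\<sigma> > 0" "\<sigma> \<le> \<sigma>0" "R * \<sigma> = 1" "R > 0"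
      using R R4 \<sigma>0 by (auto simp: \<sigma>_def field_simps)
    define U where "U \<theta> = (of_real (\<sigma> * cos \<theta>) :: complex, \<sigma> * sin \<theta>)" for \<theta>
    define E where "E z = (z, 0::real)" for z :: complex
    define k where "k X = X /\<^sub>R norm X ^ 3" for X :: "complex \<times> real"
    have nU: "norm (U \<theta>) = \<sigma>" for \<theta>
    proof -
      have "(norm (U \<theta>))\<^sup>2 = \<sigma>\<^sup>2 * (cos \<theta>)\<^sup>2 + \<sigma>\<^sup>2 * (sin \<theta>)\<^sup>2"
        by (simp add: U_def norm_Pair power_mult_distrib norm_mult)
      also have "\<dots> = \<sigma>\<^sup>2" by (simp flip: distrib_left)
      finally show ?thesis using \<sigma>(1) by (simp add: power2_eq_iff_nonneg)
    qed
    have nE: "norm (E z) = norm z" for z by (simp add: E_def norm_Pair)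
    have EU: "R * norm (E z - U \<theta>) = sqrt ((norm (R *\<^sub>R z))\<^sup>2 + 1 - 2 * Re (R *\<^sub>R z) * cos \<theta>)" for z \<theta>
    proof -
      have "(R * norm (E z - U \<theta>))\<^sup>2 = R\<^sup>2 * ((Re z - \<sigma> * cos \<theta>)\<^sup>2 + (Im z)\<^sup>2 + (\<sigma> * sin \<theta>)\<^sup>2)"
        by (simp add: power_mult_distrib norm_Pair E_def U_def cmod_power2)
      also have "\<dots> = (R * Re z - (R * \<sigma>) * cos \<theta>)\<^sup>2 + (R * Im z)\<^sup>2 + ((R * \<sigma>) * sin \<theta>)\<^sup>2"
        by (simp add: power2_eq_square algebra_simps)
      also have "\<dots> = (R * Re z)\<^sup>2 + (R * Im z)\<^sup>2 + ((cos \<theta>)\<^sup>2 + (sin \<theta>)\<^sup>2) - 2 * (R * Re z) * cos \<theta>"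
        unfolding \<sigma>(3) by (simp add: power2_eq_square algebra_simps)
      also have "\<dots> = (norm (R *\<^sub>R z))\<^sup>2 + 1 - 2 * Re (R *\<^sub>R z) * cos \<theta>"
        unfolding cmod_power2 by simp
      finally show ?thesis using \<sigma>(4) by (metis mult_nonneg_nonneg norm_ge_zero less_imp_le real_sqrt_unique)
    qed
    have ball: "1/2 \<le> norm z" if "norm u = 1" "z \<in> cball u (1/2)" for u z :: complex
      using that norm_triangle_ineq2[of u z] by (auto simp: dist_norm)
    have cont: "continuous_on S (\<lambda>\<theta>. fst (k (E z) - k (E z - U \<theta>)))" if "1/2 \<le> norm z" for z S
    proof -
      have "E z - U \<theta> \<noteq> 0" for \<theta> using nU[of \<theta>] nE[of z] that \<sigma> \<sigma>0 by auto
      then show ?thesis unfolding k_def U_def by (intro continuous_intros) auto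
    qed
    have rep: "far_perturbation R z = (1 / (2*pi)) *\<^sub>R integral {0..2*pi} (\<lambda>\<theta>. fst (k (E z) - k (E z - U \<theta>)))"
      if z: "1/2 \<le> norm z" for z
    proof -
      have "R\<^sup>2 *\<^sub>R ring_pull (R *\<^sub>R z) = integral {0..2*pi} (\<lambda>\<theta>. R\<^sup>2 *\<^sub>R ((R *\<^sub>R z - of_real (cos \<theta>)) /\<^sub>R sqrt ((norm (R *\<^sub>R z))\<^sup>2 + 1 - 2 * Re (R *\<^sub>R z) * cos \<theta>) ^ 3))"
        unfolding ring_pull_def by (rule integral_cmul[symmetric])
      also have "\<dots> = integral {0..2*pi} (\<lambda>\<theta>. fst (k (E z - U \<theta>)))"
      proof (rule integral_cong)
        fix \<theta>
        have "R *\<^sub>R z - of_real (cos \<theta>) = R *\<^sub>R (z - of_real (\<sigma> * cos \<theta>))"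
        proof -
          have "R *\<^sub>R complex_of_real (\<sigma> * cos \<theta>) = of_real ((R * \<sigma>) * cos \<theta>)"
            by (simp add: scaleR_conv_of_real mult.assoc)
          then show ?thesis unfolding \<sigma>(3) by (simp add: scaleR_diff_right)
        qed
        moreover have "R\<^sup>2 * (inverse ((R * norm (E z - U \<theta>)) ^ 3) * R) = inverse (norm (E z - U \<theta>) ^ 3)"
          using \<sigma>(4) by (simp add: power_mult_distrib power2_eq_square power3_eq_cube) (simp add: field_simps)
        ultimately show "R\<^sup>2 *\<^sub>R ((R *\<^sub>R z - of_real (cos \<theta>)) /\<^sub>R sqrt ((norm (R *\<^sub>R z))\<^sup>2 + 1 - 2 * Re (R *\<^sub>R z) * cos \<theta>) ^ 3)
            = fst (k (E z - U \<theta>))"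
          unfolding EU[symmetric] k_def by (simp add: E_def U_def)
      qed
      finally have 1: "R\<^sup>2 *\<^sub>R ring_pull (R *\<^sub>R z) = integral {0..2*pi} (\<lambda>\<theta>. fst (k (E z - U \<theta>)))" .
      have 2: "(2*pi) *\<^sub>R (z /\<^sub>R norm z ^ 3) = integral {0..2*pi} (\<lambda>\<theta>. fst (k (E z)))"
        by (simp add: k_def nE) (simp add: E_def)
      have int: "(\<lambda>\<theta>. fst (k (E z) - k (E z - U \<theta>))) integrable_on {0..2*pi}"
        by (rule integrable_continuous_real[OF cont[OF z]])
      have "(\<lambda>\<theta>. fst (k (E z - U \<theta>))) integrable_on {0..2*pi}"
        using integrable_diff[OF integrable_const_ivl[of "fst (k (E z))"] int] by simp
      then have "(2*pi) *\<^sub>R (z /\<^sub>R norm z ^ 3) - R\<^sup>2 *\<^sub>R ring_pull (R *\<^sub>R z) = integral {0..2*pi} (\<lambda>\<theta>. fst (k (E z) - k (E z - U \<theta>)))"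
        unfolding 1 2 fst_diff by (intro integral_diff[symmetric]) auto
      moreover have "far_perturbation R z = (1 / (2*pi)) *\<^sub>R ((2*pi) *\<^sub>R (z /\<^sub>R norm z ^ 3) - R\<^sup>2 *\<^sub>R ring_pull (R *\<^sub>R z))"
        by (simp add: far_perturbation_def scaleR_diff_right)
      ultimately show ?thesis by simp
    qed
    have avg: "norm ((1 / (2*pi)) *\<^sub>R integral {0..2*pi} f) \<le> B"
      if "continuous_on {0..2*pi} f" "\<And>\<theta>. norm (f \<theta>) \<le> B" for f :: "real \<Rightarrow> complex" and B
    proof -
      have "norm (integral {0..2*pi} f) \<le> B * (2*pi - 0)"
        by (rule integral_bound) (use that in auto)
      then show ?thesis by (simp add: field_simps)
    qed
    show ?thesis unfolding mild_symmetric_perturbation_def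
    proof (intro conjI allI impI ballI)
      fix z :: complex assume z: "1/2 < norm z" "norm z < 3/2"
      have neq: "R *\<^sub>R z \<noteq> 1" "R *\<^sub>R z \<noteq> -1"
      proof -
        have "norm (R *\<^sub>R z) \<ge> 2" using mult_mono[OF R4, of "1/2" "norm z"] R4 z by simp
        then have "norm (R *\<^sub>R z) \<noteq> 1" by linarith
        then show "R *\<^sub>R z \<noteq> 1" "R *\<^sub>R z \<noteq> -1" by (metis norm_one norm_minus_cancel)+
      qed
      have "R *\<^sub>R cnj z = cnj (R *\<^sub>R z)" by simp
      then show "far_perturbation R (cnj z) = cnj (far_perturbation R z)"
        unfolding far_perturbation_def by (simp only: ring_pull_cnj complex_mod_cnj) simp
      show "far_perturbation R (cis (2 * (pi / 2)) * z) = cis (2 * (pi / 2)) * far_perturbation R z"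
        using ring_pull_uminus[OF neq] by (simp add: far_perturbation_def)
    next
      fix u :: complex assume u: "norm u = 1"
      have "norm (fst (k (E u) - k (E u - U \<theta>))) \<le> \<mu>" for \<theta>
      proof -
        have "norm (k (E u) - k (E u - U \<theta>)) \<le> \<mu>"
          using small[of "U \<theta>" "E u"] nU[of \<theta>] nE[of u] u \<sigma> unfolding k_def by simp
        then show ?thesis by (rule order_trans[OF norm_fst_le_norm])
      qed
      then have "norm ((1 / (2*pi)) *\<^sub>R integral {0..2*pi} (\<lambda>\<theta>. fst (k (E u) - k (E u - U \<theta>)))) \<le> \<mu>"
        by (intro avg cont) (simp_all add: u)
      then show "norm (far_perturbation R u) \<le> \<mu>" using rep[of u] u by simp
    next
      fix u z z' :: complex assume u: "norm u = 1" and z: "z \<in> cball u (1/2)" "z' \<in> cball u (1/2)"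
      have "norm (fst (k (E z) - k (E z - U \<theta>)) - fst (k (E z') - k (E z' - U \<theta>))) \<le> \<mu> * norm (z - z')" for \<theta>
      proof -
        have "E z \<in> cball (E u) (1/2)" "E z' \<in> cball (E u) (1/2)"
          using z by (auto simp: E_def dist_Pair_Pair)
        then have "norm ((k (E z) - k (E z - U \<theta>)) - (k (E z') - k (E z' - U \<theta>))) \<le> \<mu> * norm (E z - E z')"
          using small[of "U \<theta>" "E u"] nU[of \<theta>] nE[of u] u \<sigma> unfolding k_def by simp
        moreover have "norm (E z - E z') = norm (z - z')" by (simp add: E_def norm_Pair)
        ultimately show ?thesis unfolding fst_diff[symmetric] by (simp only: order_trans[OF norm_fst_le_norm])
      qed
      then have "norm ((1 / (2*pi)) *\<^sub>R integral {0..2*pi} (\<lambda>\<theta>. fst (k (E z) - k (E z - U \<theta>)) - fst (k (E z') - k (E z' - U \<theta>)))) \<le> \<mu> * norm (z - z')"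
        by (intro avg continuous_on_diff cont ball[OF u] z)
      also have "integral {0..2*pi} (\<lambda>\<theta>. fst (k (E z) - k (E z - U \<theta>)) - fst (k (E z') - k (E z' - U \<theta>)))
        = integral {0..2*pi} (\<lambda>\<theta>. fst (k (E z) - k (E z - U \<theta>))) - integral {0..2*pi} (\<lambda>\<theta>. fst (k (E z') - k (E z' - U \<theta>)))"
        by (intro integral_diff integrable_continuous_real cont ball[OF u] z)
      finally show "norm (far_perturbation R z - far_perturbation R z') \<le> \<mu> * norm (z - z')"
        unfolding rep[OF ball[OF u z(1)]] rep[OF ball[OF u z(2)]] scaleR_diff_right .
    qed
  qed
  show ?thesis by (rule exI[of _ "1/\<sigma>0"]) (use main \<sigma>0 in auto)
qed

section \<open>The ring seen from close by\<close>

text \<open>Up to a constant, this dominates the part of the deviation of the ring from a straight wire that is not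
elementary, angle by angle, at distance of order \<open>\<delta>\<close> from the ring.\<close>

definition near_weight :: "real \<Rightarrow> real \<Rightarrow> real" where
  "near_weight \<delta> \<theta> = \<delta> * (sin (\<theta>/2))\<^sup>2 / sqrt (\<delta>\<^sup>2 + (sin (\<theta>/2))\<^sup>2) ^ 3"

lemma continuous_on_near_weight: "\<delta> > 0 \<Longrightarrow> continuous_on S (near_weight \<delta>)"
proof -
  assume "\<delta> > 0"
  then have "\<delta>\<^sup>2 + x\<^sup>2 > 0" for x :: real by (simp add: add_pos_nonneg)
  then have "\<delta>\<^sup>2 + x\<^sup>2 \<noteq> 0" for x :: real by (metis less_irrefl)
  then show ?thesis unfolding near_weight_def by (intro continuous_intros) auto
qed

text \<open>Dominated convergence: the weight is at most \<open>1\<close> and tends to \<open>0\<close> for every angle, including \<open>0\<close>, where it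
vanishes. The convergence is not uniform, so there is no cruder argument by the supremum.\<close>

lemma near_weight_integral_small:
  assumes "\<epsilon> > 0" "c > 0"
  shows "\<exists>\<delta>>0. \<delta> \<le> \<epsilon> \<and> integral {-pi..pi} (near_weight \<delta>) < c"
proof -
  define d where "d k = \<epsilon> / real (Suc k)" for k
  have d: "d k > 0" "d k \<le> \<epsilon>" for k
    using assms by (auto simp: d_def divide_le_eq mult_le_cancel_left1)
  have d0: "d \<longlonglongrightarrow> 0"
    unfolding d_def using tendsto_mult_right_zero[OF LIMSEQ_inverse_real_of_nat, of \<epsilon>] by (simp add: divide_inverse)
  have "(\<lambda>k. integral {-pi..pi} (near_weight (d k))) \<longlonglongrightarrow> integral {-pi..pi} (\<lambda>\<theta>. 0)"
  proof (rule dominated_convergence(2))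
    show "near_weight (d k) integrable_on {-pi..pi}" for k
      by (intro integrable_continuous_real continuous_on_near_weight d)
    show "(\<lambda>\<theta>. 1::real) integrable_on {-pi..pi}" by (rule integrable_const_ivl)
    show "norm (near_weight (d k) \<theta>) \<le> 1" for k \<theta>
    proof -
      define s where "s = sin (\<theta>/2)"
      define r where "r = sqrt ((d k)\<^sup>2 + s\<^sup>2)"
      have r: "d k \<le> r" "s\<^sup>2 \<le> r\<^sup>2" "0 < r"
        using d(1)[of k] by (auto simp: r_def add_pos_nonneg intro: real_le_rsqrt)
      have "d k * s\<^sup>2 \<le> r * r\<^sup>2" using r d(1)[of k] by (intro mult_mono) auto
      also have "\<dots> = r ^ 3" by (simp add: power3_eq_cube power2_eq_square)
      finally have "near_weight (d k) \<theta> \<le> 1"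
        using r unfolding near_weight_def s_def[symmetric] r_def[symmetric] by simp
      moreover have "near_weight (d k) \<theta> \<ge> 0" using d(1)[of k] by (simp add: near_weight_def)
      ultimately show ?thesis by simp
    qed
    show "(\<lambda>k. near_weight (d k) \<theta>) \<longlonglongrightarrow> 0" for \<theta>
    proof (cases "sin (\<theta>/2) = 0")
      case False
      have "(\<lambda>k. d k * (sin (\<theta>/2))\<^sup>2 / sqrt ((d k)\<^sup>2 + (sin (\<theta>/2))\<^sup>2) ^ 3)
          \<longlonglongrightarrow> 0 * (sin (\<theta>/2))\<^sup>2 / sqrt (0\<^sup>2 + (sin (\<theta>/2))\<^sup>2) ^ 3"
        by (intro tendsto_intros d0) (use False in auto)
      then show ?thesis by (simp add: near_weight_def)
    qed (simp add: near_weight_def)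
  qed
  then have "(\<lambda>k. integral {-pi..pi} (near_weight (d k))) \<longlonglongrightarrow> 0" by simp
  from order_tendstoD(2)[OF this \<open>c > 0\<close>] obtain k where "integral {-pi..pi} (near_weight (d k)) < c"
    by (auto simp: eventually_sequentially)
  then show ?thesis using d[of k] by blast
qed

lemma inverse_cube_sqrt_lipschitz:
  fixes A B r :: real
  assumes "0 < r" "r\<^sup>2 \<le> A" "r\<^sup>2 \<le> B"
  shows "\<bar>1 / sqrt A ^ 3 - 1 / sqrt B ^ 3\<bar> \<le> 2 * \<bar>A - B\<bar> / r ^ 5"
proof -
  define a where "a = sqrt A"
  define b where "b = sqrt B"
  have "0 < r\<^sup>2" using assms by simp
  then have pos: "0 < A" "0 < B" using assms by linarith+
  then have ab: "r \<le> a" "r \<le> b" "0 < a" "0 < b"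
    using assms by (auto simp: a_def b_def intro: real_le_rsqrt)
  have sq: "A = a\<^sup>2" "B = b\<^sup>2" using pos by (auto simp: a_def b_def)
  have "1 / a ^ 3 - 1 / b ^ 3 = (b - a) * (a\<^sup>2 + a * b + b\<^sup>2) / (a ^ 3 * b ^ 3)"
    using ab by (simp add: field_simps power2_eq_square power3_eq_cube)
  then have "\<bar>1 / a ^ 3 - 1 / b ^ 3\<bar> = \<bar>b - a\<bar> * (a\<^sup>2 + a * b + b\<^sup>2) / (a ^ 3 * b ^ 3)"
    using ab by (simp add: abs_mult)
  also have "\<dots> \<le> \<bar>b - a\<bar> * (a + b)\<^sup>2 / (a ^ 3 * b ^ 3)"
    using ab by (intro divide_right_mono mult_left_mono) (auto simp: power2_eq_square algebra_simps)
  also have "\<dots> = \<bar>A - B\<bar> * ((a + b) / (a ^ 3 * b ^ 3))"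
  proof -
    have "A - B = (a - b) * (a + b)" unfolding sq by (simp add: power2_eq_square algebra_simps)
    then have "\<bar>A - B\<bar> = \<bar>b - a\<bar> * (a + b)" using ab by (simp add: abs_mult abs_minus_commute)
    then show ?thesis by (simp add: power2_eq_square)
  qed
  also have "\<dots> \<le> \<bar>A - B\<bar> * (2 / r ^ 5)"
  proof (rule mult_left_mono)
    have "(a + b) / (a ^ 3 * b ^ 3) = 1 / (a\<^sup>2 * b ^ 3) + 1 / (a ^ 3 * b\<^sup>2)"
      using ab by (simp add: field_simps power2_eq_square power3_eq_cube)
    also have "\<dots> \<le> 1 / r ^ 5 + 1 / r ^ 5"
    proof -
      have "r\<^sup>2 * r ^ 3 \<le> a\<^sup>2 * b ^ 3" "r ^ 3 * r\<^sup>2 \<le> a ^ 3 * b\<^sup>2"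
        by (intro mult_mono power_mono; use ab assms in simp)+
      moreover have "r\<^sup>2 * r ^ 3 = r ^ 5" "r ^ 3 * r\<^sup>2 = r ^ 5" by (simp_all flip: power_add)
      ultimately show ?thesis using ab assms by (intro add_mono divide_left_mono) auto
    qed
    finally show "(a + b) / (a ^ 3 * b ^ 3) \<le> 2 / r ^ 5" by simp
  qed simp
  finally show ?thesis by (simp add: a_def b_def mult.commute)
qed

text \<open>Deviation from the attraction \<open>2 z / |z|^2\<close> of a straight wire of density \<open>1\<close> at \<open>1\<close>, at distances of order \<open>\<delta>\<close>
and rescaled to order \<open>1\<close>.\<close>

definition near_perturbation :: "real \<Rightarrow> complex \<Rightarrow> complex" where
  "near_perturbation \<delta> z = z /\<^sub>R norm z ^ 2 - (\<delta> / 2) *\<^sub>R ring_pull (1 + \<delta> *\<^sub>R z)"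

text \<open>The squared distance from \<open>1 + \<delta> z\<close> to the ring point at angle \<open>\<theta>\<close>, arranged as a sum of two terms that are
positive near the ring.\<close>

definition near_distance_sq :: "real \<Rightarrow> complex \<Rightarrow> real \<Rightarrow> real" where
  "near_distance_sq \<delta> z \<theta> = (\<delta> * norm z)\<^sup>2 + 4 * (1 + \<delta> * Re z) * (sin (\<theta>/2))\<^sup>2"

text \<open>The part of the rescaled attraction that is left when the factor \<open>1\<close> of \<open>\<delta>\<^sup>2 *\<^sub>R z\<close> is replaced by
\<open>1 - cos (\<theta>/2)\<close>. The part with \<open>cos (\<theta>/2)\<close> has an elementary primitive.\<close>

definition near_remainder :: "real \<Rightarrow> complex \<Rightarrow> real \<Rightarrow> complex" where
  "near_remainder \<delta> z \<theta> = ((\<delta>\<^sup>2 * (1 - cos (\<theta>/2))) *\<^sub>R z + of_real (2 * \<delta> * (sin (\<theta>/2))\<^sup>2))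
     /\<^sub>R sqrt (near_distance_sq \<delta> z \<theta>) ^ 3"

lemma near_distance_sq_eq:
  "(norm (1 + \<delta> *\<^sub>R z))\<^sup>2 + 1 - 2 * Re (1 + \<delta> *\<^sub>R z) * cos \<theta> = near_distance_sq \<delta> z \<theta>"
proof -
  have c: "cos \<theta> = 1 - 2 * (sin (\<theta>/2))\<^sup>2" using cos_double_sin[of "\<theta>/2"] by simp
  show ?thesis unfolding c near_distance_sq_def power_mult_distrib cmod_power2
    by (simp add: power2_eq_square algebra_simps)
qed

context
  fixes \<delta> :: real
  assumes \<delta>: "0 < \<delta>" "\<delta> \<le> 1/6"
begin

lemma near_distance_sq_lower:
  assumes "1/2 \<le> norm z" "norm z \<le> 3/2"
  shows "(sqrt (\<delta>\<^sup>2 + (sin (\<theta>/2))\<^sup>2) / 2)\<^sup>2 \<le> near_distance_sq \<delta> z \<theta>"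
proof -
  have "\<delta> * \<bar>Re z\<bar> \<le> 1/6 * (3/2)"
    using \<delta> assms abs_Re_le_cmod[of z] by (intro mult_mono) auto
  then have "\<bar>\<delta> * Re z\<bar> \<le> 1/4" using \<delta> by (simp add: abs_mult)
  then have "3/4 \<le> 1 + \<delta> * Re z" by (simp add: abs_le_iff)
  then have "1/4 \<le> 4 * (1 + \<delta> * Re z)" by simp
  then have "1/4 * (sin (\<theta>/2))\<^sup>2 \<le> 4 * (1 + \<delta> * Re z) * (sin (\<theta>/2))\<^sup>2"
    by (rule mult_right_mono) simp
  moreover have "(\<delta> * (1/2))\<^sup>2 \<le> (\<delta> * norm z)\<^sup>2"
    using \<delta> assms by (intro power_mono mult_left_mono) auto
  ultimately show ?thesis
    by (simp add: near_distance_sq_def power_divide power_mult_distrib add_divide_distrib)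
qed

lemma near_distance_sq_pos:
  assumes "1/2 \<le> norm z" "norm z \<le> 3/2"
  shows "near_distance_sq \<delta> z \<theta> > 0"
proof -
  have "(sqrt (\<delta>\<^sup>2 + (sin (\<theta>/2))\<^sup>2) / 2)\<^sup>2 > 0" using \<delta> by (simp add: add_pos_nonneg)
  then show ?thesis using near_distance_sq_lower[OF assms] by (rule less_le_trans)
qed

lemma continuous_on_near_remainder:
  assumes "1/2 \<le> norm z" "norm z \<le> 3/2"
  shows "continuous_on S (near_remainder \<delta> z)"
proof -
  have "sqrt (near_distance_sq \<delta> z \<theta>) \<noteq> 0" for \<theta>
    using near_distance_sq_pos[OF assms, of \<theta>] by simp
  then show ?thesis
    unfolding near_remainder_def near_distance_sq_def by (intro continuous_intros) auto
qed

text \<open>The integral of \<open>cos (\<theta>/2) / D^3\<close>, with \<open>D\<close> the distance to the ring point, is elementary and produces the field of the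
wire up to the factor \<open>2 / |2 + \<delta> z|\<close>, which tends to \<open>1\<close>. The half angle requires the symmetric interval from
\<open>-pi\<close> to \<open>pi\<close>, with the closest ring point in the middle and not at the ends.\<close>

lemma near_perturbation_split:
  assumes z: "1/2 \<le> norm z" "norm z \<le> 3/2"
  shows "near_perturbation \<delta> z = (1 - 2 / norm (2 + \<delta> *\<^sub>R z)) *\<^sub>R (z /\<^sub>R norm z ^ 2)
    - (1/2) *\<^sub>R integral {-pi..pi} (near_remainder \<delta> z)"
proof -
  define D where "D = near_distance_sq \<delta> z"
  have Dpos: "D \<theta> > 0" for \<theta> unfolding D_def by (rule near_distance_sq_pos[OF z])
  have D0: "D \<theta> \<noteq> 0" for \<theta> using Dpos[of \<theta>] by simp
  have cD: "continuous_on S D" for S unfolding D_def near_distance_sq_def by (intro continuous_intros) auto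
  define f where "f \<theta> = (1 + \<delta> *\<^sub>R z - of_real (cos \<theta>)) /\<^sub>R sqrt (D \<theta>) ^ 3" for \<theta>
  have cf: "continuous_on S f" for S
    unfolding f_def by (intro continuous_intros cD) (use D0 in auto)
  have per: "f (t + 2*pi) = f t" for t
    unfolding f_def D_def near_distance_sq_eq[symmetric] by simp
  have "ring_pull (1 + \<delta> *\<^sub>R z) = integral {0..2*pi} f"
    by (simp only: ring_pull_def near_distance_sq_eq f_def[abs_def] D_def)
  also have "\<dots> = integral {-pi..-pi + 2*pi} f"
    using integral_over_period(1)[of f "-pi", OF cf per] by simp
  finally have pull: "\<delta> *\<^sub>R ring_pull (1 + \<delta> *\<^sub>R z) = integral {-pi..pi} (\<lambda>\<theta>. \<delta> *\<^sub>R f \<theta>)"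
    by simp
  define g where "g \<theta> = cos (\<theta>/2) / sqrt (D \<theta>) ^ 3" for \<theta>
  \<comment> \<open>In the variable \<open>s = sin (\<theta>/2)\<close> the integrand is \<open>2 / sqrt (A + B s\<^sup>2) ^ 3\<close>, which has the primitive
    \<open>2 s / (A sqrt (A + B s\<^sup>2))\<close>.\<close>
  define G where "G \<theta> = 2 * sin (\<theta>/2) / ((\<delta> * norm z)\<^sup>2 * sqrt (D \<theta>))" for \<theta>
  have cg: "continuous_on S g" for S
    unfolding g_def by (intro continuous_intros cD) (use D0 in auto)
  have split: "\<delta> *\<^sub>R f \<theta> = (\<delta>\<^sup>2 * g \<theta>) *\<^sub>R z + near_remainder \<delta> z \<theta>" for \<theta>
  proof -
    have c: "cos \<theta> = 1 - 2 * (sin (\<theta>/2))\<^sup>2" using cos_double_sin[of "\<theta>/2"] by simp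
    have "\<delta> *\<^sub>R (i *\<^sub>R (1 + \<delta> *\<^sub>R z - of_real (1 - 2 * s))) =
        (\<delta>\<^sup>2 * (c * i)) *\<^sub>R z + i *\<^sub>R ((\<delta>\<^sup>2 * (1 - c)) *\<^sub>R z + of_real (2 * \<delta> * s))" for i s c :: real
      by (simp add: complex_eq_iff power2_eq_square algebra_simps)
    then show ?thesis
      unfolding f_def g_def near_remainder_def D_def[symmetric] c divide_inverse .
  qed
  have nz: "\<delta> * norm z \<noteq> 0" using \<delta> z by auto
  have dG: "(G has_real_derivative g \<theta>) (at \<theta>)" for \<theta>
  proof -
    define r where "r = sqrt (D \<theta>)"
    define e where "e = (\<delta> * norm z)\<^sup>2"
    define m where "m = 4 * (1 + \<delta> * Re z)"
    have r: "r > 0" "r\<^sup>2 = e + m * (sin (\<theta>/2))\<^sup>2"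
      using Dpos[of \<theta>] by (auto simp: r_def e_def m_def D_def near_distance_sq_def)
    have e: "e \<noteq> 0" using nz by (simp add: e_def)
    have dD: "(D has_real_derivative m * sin (\<theta>/2) * cos (\<theta>/2)) (at \<theta>)"
      unfolding D_def near_distance_sq_def[abs_def] m_def by (auto intro!: derivative_eq_intros)
    have dS: "((\<lambda>t. sqrt (D t)) has_real_derivative m * sin (\<theta>/2) * cos (\<theta>/2) * (inverse r / 2)) (at \<theta>)"
      using DERIV_chain2[OF DERIV_real_sqrt[OF Dpos[of \<theta>]] dD] by (simp add: r_def mult.commute)
    have "(G has_real_derivative (cos (\<theta>/2) * (e * r) - 2 * sin (\<theta>/2) * (e * (m * sin (\<theta>/2) * cos (\<theta>/2) * (inverse r / 2)))) / ((e * r) * (e * r))) (at \<theta>)"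
    proof -
      have num: "((\<lambda>t. 2 * sin (t/2)) has_real_derivative cos (\<theta>/2)) (at \<theta>)"
        by (auto intro!: derivative_eq_intros)
      have "e * sqrt (D \<theta>) \<noteq> 0" using e r by (simp add: r_def)
      from DERIV_divide[OF num DERIV_cmult[OF dS] this]
      show ?thesis unfolding G_def[abs_def] e_def[symmetric] r_def[symmetric] .
    qed
    moreover have "(cos (\<theta>/2) * (e * r) - 2 * sin (\<theta>/2) * (e * (m * sin (\<theta>/2) * cos (\<theta>/2) * (inverse r / 2)))) / ((e * r) * (e * r))
        = cos (\<theta>/2) * (r\<^sup>2 - m * (sin (\<theta>/2))\<^sup>2) / (e * r ^ 3)"
      using e r(1) by (simp add: field_simps power2_eq_square power3_eq_cube)
    moreover have "\<dots> = g \<theta>" unfolding r(2) g_def r_def[symmetric] using e by simp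
    ultimately show ?thesis by simp
  qed
  have "(g has_integral (G pi - G (-pi))) {-pi..pi}"
    by (rule fundamental_theorem_of_calculus)
      (auto intro!: has_field_derivative_at_within dG simp: has_real_derivative_iff_has_vector_derivative[symmetric])
  then have "integral {-pi..pi} g = G pi - G (-pi)" by (rule integral_unique)
  also have "\<dots> = 4 / ((\<delta> * norm z)\<^sup>2 * norm (2 + \<delta> *\<^sub>R z))"
  proof -
    have "D pi = (norm (2 + \<delta> *\<^sub>R z))\<^sup>2" "D (- pi) = D pi"
      unfolding D_def near_distance_sq_def power_mult_distrib cmod_power2
      by (simp_all add: power2_eq_square algebra_simps)
    then show ?thesis by (simp add: G_def)
  qed
  finally have ig: "integral {-pi..pi} g = 4 / ((\<delta> * norm z)\<^sup>2 * norm (2 + \<delta> *\<^sub>R z))" .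
  have "\<delta> *\<^sub>R ring_pull (1 + \<delta> *\<^sub>R z) = integral {-pi..pi} (\<lambda>\<theta>. (\<delta>\<^sup>2 * g \<theta>) *\<^sub>R z)
      + integral {-pi..pi} (near_remainder \<delta> z)"
    unfolding pull split
    by (intro integral_add integrable_continuous_real continuous_on_near_remainder z continuous_intros cg)
  also have "integral {-pi..pi} (\<lambda>\<theta>. (\<delta>\<^sup>2 * g \<theta>) *\<^sub>R z) = (\<delta>\<^sup>2 * integral {-pi..pi} g) *\<^sub>R z"
  proof -
    have "(\<lambda>\<theta>. \<delta>\<^sup>2 * g \<theta>) integrable_on {-pi..pi}"
      by (intro integrable_continuous_real continuous_intros cg)
    from integral_linear[OF this bounded_linear_scaleR_left[of z]] show ?thesis
      by (simp add: o_def)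
  qed
  also have "(\<delta>\<^sup>2 * integral {-pi..pi} g) *\<^sub>R z = (4 / norm (2 + \<delta> *\<^sub>R z)) *\<^sub>R (z /\<^sub>R norm z ^ 2)"
  proof -
    have "\<delta>\<^sup>2 * (4 / ((\<delta> * norm z)\<^sup>2 * N)) = 4 / N * inverse (norm z ^ 2)" for N
      using \<delta> by (simp add: power_mult_distrib inverse_eq_divide)
    then show ?thesis unfolding ig scaleR_scaleR by simp
  qed
  finally have main: "\<delta> *\<^sub>R ring_pull (1 + \<delta> *\<^sub>R z) = (4 / norm (2 + \<delta> *\<^sub>R z)) *\<^sub>R (z /\<^sub>R norm z ^ 2)
      + integral {-pi..pi} (near_remainder \<delta> z)" .
  have "near_perturbation \<delta> z = z /\<^sub>R norm z ^ 2 - (1/2) *\<^sub>R (\<delta> *\<^sub>R ring_pull (1 + \<delta> *\<^sub>R z))"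
    by (simp add: near_perturbation_def)
  then show ?thesis unfolding main by (simp add: scaleR_add_right scaleR_diff_left left_diff_distrib)
qed

text \<open>The numerator is \<open>O(\<delta> s\<^sup>2)\<close> because \<open>1 - cos (\<theta>/2) \<le> s\<^sup>2\<close>, and the squared distance is comparable to
\<open>d\<^sup>2 = \<delta>\<^sup>2 + s\<^sup>2\<close>, with \<open>s = sin (\<theta>/2)\<close>. Changing \<open>z\<close> changes the squared distance by
\<open>O(d\<^sup>2) * |z - z'|\<close>, so the Lipschitz constant has the same order as the value.\<close>

lemma near_remainder_estimates:
  assumes z: "1/2 \<le> norm z" "norm z \<le> 3/2" and z': "1/2 \<le> norm z'" "norm z' \<le> 3/2"
    and \<theta>: "\<theta> \<in> {-pi..pi}"
  shows "norm (near_remainder \<delta> z \<theta>) \<le> 32 * near_weight \<delta> \<theta>"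
    and "norm (near_remainder \<delta> z \<theta> - near_remainder \<delta> z' \<theta>) \<le> 1032 * near_weight \<delta> \<theta> * norm (z - z')"
proof -
  define s where "s = sin (\<theta>/2)"
  define c where "c = cos (\<theta>/2)"
  define d where "d = sqrt (\<delta>\<^sup>2 + s\<^sup>2)"
  have d: "d > 0" "d\<^sup>2 = \<delta>\<^sup>2 + s\<^sup>2" using \<delta> by (auto simp: d_def add_pos_nonneg)
  have c: "0 \<le> c" "c \<le> 1" unfolding c_def using \<theta> by (auto intro!: cos_ge_zero)
  have "1 - c \<le> (1 - c) * (1 + c)" using c by (simp add: mult_le_cancel_left1)
  also have "\<dots> = s\<^sup>2"
    using sin_cos_squared_add[of "\<theta>/2"] by (simp add: s_def c_def power2_eq_square algebra_simps)
  finally have c1: "0 \<le> 1 - c" "1 - c \<le> s\<^sup>2" using c by auto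
  define n where "n z = (\<delta>\<^sup>2 * (1 - c)) *\<^sub>R z + of_real (2 * \<delta> * s\<^sup>2)" for z :: complex
  define h where "h z = 1 / sqrt (near_distance_sq \<delta> z \<theta>) ^ 3" for z
  have k: "near_remainder \<delta> z \<theta> = h z *\<^sub>R n z" for z
    by (simp only: near_remainder_def h_def n_def s_def c_def inverse_eq_divide)
  have w: "near_weight \<delta> \<theta> = \<delta> * s\<^sup>2 / d ^ 3" by (simp add: near_weight_def s_def d_def)
  have \<delta>2: "\<delta>\<^sup>2 \<le> \<delta>" using \<delta> by (simp add: power2_eq_square mult_le_cancel_left1)
  have dc: "\<delta>\<^sup>2 * (1 - c) \<le> \<delta> * s\<^sup>2" using \<delta>2 c1 \<delta> by (intro mult_mono) auto
  have n: "norm (n z) \<le> 4 * (\<delta> * s\<^sup>2)" if "norm z \<le> 3/2" for z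
  proof -
    have "norm (n z) \<le> norm ((\<delta>\<^sup>2 * (1 - c)) *\<^sub>R z) + norm (complex_of_real (2 * \<delta> * s\<^sup>2))"
      unfolding n_def by (rule norm_triangle_ineq)
    also have "\<dots> = (\<delta>\<^sup>2 * (1 - c)) * norm z + 2 * (\<delta> * s\<^sup>2)"
      using c1 \<delta> by (simp only: norm_scaleR norm_of_real) simp
    also have "(\<delta>\<^sup>2 * (1 - c)) * norm z \<le> (\<delta> * s\<^sup>2) * (3/2)"
      using mult_mono[OF dc that] \<delta> by simp
    finally have "norm (n z) \<le> (\<delta> * s\<^sup>2) * (3/2) + 2 * (\<delta> * s\<^sup>2)" by simp
    moreover have "0 \<le> \<delta> * s\<^sup>2" using \<delta> by simp
    ultimately show ?thesis by linarith
  qed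
  have nd: "norm (n z - n z') \<le> (\<delta> * s\<^sup>2) * norm (z - z')"
  proof -
    have "n z - n z' = (\<delta>\<^sup>2 * (1 - c)) *\<^sub>R (z - z')" by (simp add: n_def scaleR_diff_right)
    then have "norm (n z - n z') = (\<delta>\<^sup>2 * (1 - c)) * norm (z - z')" using c1 \<delta> by simp
    then show ?thesis using dc by (simp add: mult_right_mono)
  qed
  have low: "(d/2)\<^sup>2 \<le> near_distance_sq \<delta> z \<theta>" if "1/2 \<le> norm z" "norm z \<le> 3/2" for z
    using near_distance_sq_lower[OF that, of \<theta>] by (simp add: d_def s_def)
  have hb: "\<bar>h z\<bar> \<le> 8 / d ^ 3" if "1/2 \<le> norm z" "norm z \<le> 3/2" for z
  proof -
    have "d/2 \<le> sqrt (near_distance_sq \<delta> z \<theta>)" using low[OF that] d by (intro real_le_rsqrt)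
    then have "(d/2) ^ 3 \<le> sqrt (near_distance_sq \<delta> z \<theta>) ^ 3" using d by (intro power_mono) auto
    moreover have "h z \<le> 1 / (d/2) ^ 3" unfolding h_def using d calculation near_distance_sq_pos[OF that, of \<theta>]
      by (intro divide_left_mono) auto
    moreover have "h z \<ge> 0" using near_distance_sq_pos[OF that, of \<theta>] by (simp add: h_def)
    ultimately show ?thesis by (simp add: power_divide)
  qed
  have Dl: "\<bar>near_distance_sq \<delta> z \<theta> - near_distance_sq \<delta> z' \<theta>\<bar> \<le> 4 * d\<^sup>2 * norm (z - z')"
  proof -
    have "near_distance_sq \<delta> z \<theta> - near_distance_sq \<delta> z' \<theta> =
        \<delta>\<^sup>2 * ((norm z + norm z') * (norm z - norm z')) + (4 * \<delta> * s\<^sup>2) * Re (z - z')"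
      unfolding near_distance_sq_def s_def[symmetric] power_mult_distrib
      by (simp add: power2_eq_square algebra_simps)
    also have "\<bar>\<dots>\<bar> \<le> \<bar>\<delta>\<^sup>2 * ((norm z + norm z') * (norm z - norm z'))\<bar> + \<bar>(4 * \<delta> * s\<^sup>2) * Re (z - z')\<bar>"
      by (rule abs_triangle_ineq)
    also have "\<bar>\<delta>\<^sup>2 * ((norm z + norm z') * (norm z - norm z'))\<bar> = \<delta>\<^sup>2 * ((norm z + norm z') * \<bar>norm z - norm z'\<bar>)"
      by (simp add: abs_mult)
    also have "\<dots> \<le> \<delta>\<^sup>2 * (3 * norm (z - z'))"
      using z z' norm_triangle_ineq3[of z z'] by (intro mult_left_mono mult_mono) auto
    also have "\<bar>(4 * \<delta> * s\<^sup>2) * Re (z - z')\<bar> = (4 * \<delta> * s\<^sup>2) * \<bar>Re (z - z')\<bar>"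
      using \<delta> by (simp add: abs_mult)
    also have "\<dots> \<le> (4 * 1 * s\<^sup>2) * norm (z - z')"
      using \<delta> abs_Re_le_cmod[of "z - z'"] by (intro mult_mono) auto
    also have "\<delta>\<^sup>2 * (3 * norm (z - z')) + (4 * 1 * s\<^sup>2) * norm (z - z') \<le> 4 * d\<^sup>2 * norm (z - z')"
    proof -
      have "3 * \<delta>\<^sup>2 + 4 * s\<^sup>2 \<le> 4 * d\<^sup>2" unfolding d(2) by simp
      from mult_right_mono[OF this, of "norm (z - z')"] show ?thesis by (simp add: algebra_simps)
    qed
    finally show ?thesis by simp
  qed
  have hd: "\<bar>h z - h z'\<bar> \<le> 256 / d ^ 3 * norm (z - z')"
  proof -
    have "\<bar>h z - h z'\<bar> \<le> 2 * \<bar>near_distance_sq \<delta> z \<theta> - near_distance_sq \<delta> z' \<theta>\<bar> / (d/2) ^ 5"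
      unfolding h_def by (rule inverse_cube_sqrt_lipschitz) (use d low z z' in auto)
    also have "\<dots> \<le> 2 * (4 * d\<^sup>2 * norm (z - z')) / (d/2) ^ 5"
      using Dl d by (intro divide_right_mono mult_left_mono) auto
    also have "\<dots> = 256 / d ^ 3 * norm (z - z')"
    proof -
      have "2 * (4 * d\<^sup>2 * X) / (d/2) ^ 5 = 256 * (d\<^sup>2 * X) / d ^ 5" for X by (simp add: power_divide)
      moreover have "256 * (p * X) / (p * q) = 256 / q * X" if "p \<noteq> 0" for p q X :: real using that by simp
      moreover have "d ^ 5 = d\<^sup>2 * d ^ 3" by (simp flip: power_add)
      ultimately show ?thesis using d(1) by (metis less_irrefl power_not_zero)
    qed
    finally show ?thesis .
  qed
  have "norm (near_remainder \<delta> z \<theta>) = \<bar>h z\<bar> * norm (n z)" by (simp add: k)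
  also have "\<dots> \<le> (8 / d ^ 3) * (4 * (\<delta> * s\<^sup>2))"
    using hb[OF z] n[OF z(2)] d by (intro mult_mono) auto
  finally show "norm (near_remainder \<delta> z \<theta>) \<le> 32 * near_weight \<delta> \<theta>" by (simp add: w)
  have "near_remainder \<delta> z \<theta> - near_remainder \<delta> z' \<theta> = h z *\<^sub>R (n z - n z') + (h z - h z') *\<^sub>R n z'"
    by (simp add: k scaleR_diff_left scaleR_diff_right)
  then have "norm (near_remainder \<delta> z \<theta> - near_remainder \<delta> z' \<theta>) \<le> \<bar>h z\<bar> * norm (n z - n z') + \<bar>h z - h z'\<bar> * norm (n z')"
    using norm_triangle_ineq[of "h z *\<^sub>R (n z - n z')" "(h z - h z') *\<^sub>R n z'"] by simp
  also have "\<dots> \<le> (8 / d ^ 3) * ((\<delta> * s\<^sup>2) * norm (z - z')) + (256 / d ^ 3 * norm (z - z')) * (4 * (\<delta> * s\<^sup>2))"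
    using hb[OF z] nd hd n[OF z'(2)] d by (intro add_mono mult_mono) auto
  also have "\<dots> = 1032 * near_weight \<delta> \<theta> * norm (z - z')" by (simp add: w field_simps)
  finally show "norm (near_remainder \<delta> z \<theta> - near_remainder \<delta> z' \<theta>) \<le> 1032 * near_weight \<delta> \<theta> * norm (z - z')" .
qed

lemma near_perturbation_estimates:
  assumes z: "1/2 \<le> norm z" "norm z \<le> 3/2" and z': "1/2 \<le> norm z'" "norm z' \<le> 3/2"
  defines "I \<equiv> integral {-pi..pi} (near_weight \<delta>)"
  shows "norm (near_perturbation \<delta> z) \<le> 3 * \<delta> + 16 * I"
    and "norm (near_perturbation \<delta> z - near_perturbation \<delta> z') \<le> (10 * \<delta> + 516 * I) * norm (z - z')"
proof -
  define m where "m z = 1 - 2 / norm (2 + \<delta> *\<^sub>R z)" for z :: complex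
  define e where "e z = z /\<^sub>R norm z ^ 2" for z :: complex
  define J where "J z = integral {-pi..pi} (near_remainder \<delta> z)" for z
  have split: "near_perturbation \<delta> z = m z *\<^sub>R e z - (1/2) *\<^sub>R J z" if "1/2 \<le> norm z" "norm z \<le> 3/2" for z
    using near_perturbation_split[OF that] by (simp add: m_def e_def J_def)
  have iw: "near_weight \<delta> integrable_on {-pi..pi}"
    by (intro integrable_continuous_real continuous_on_near_weight \<delta>)
  have ir: "near_remainder \<delta> z integrable_on {-pi..pi}" if "1/2 \<le> norm z" "norm z \<le> 3/2" for z
    by (intro integrable_continuous_real continuous_on_near_remainder that)
  have "norm (J z) \<le> integral {-pi..pi} (\<lambda>\<theta>. 32 * near_weight \<delta> \<theta>)"
    unfolding J_def
    by (rule integral_norm_bound_integral[OF ir[OF z]])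
      (use near_remainder_estimates(1)[OF z z'] iw in \<open>auto intro: integrable_on_mult_right\<close>)
  then have J1: "norm (J z) \<le> 32 * I" by (simp add: I_def)
  have "J z - J z' = integral {-pi..pi} (\<lambda>\<theta>. near_remainder \<delta> z \<theta> - near_remainder \<delta> z' \<theta>)"
    unfolding J_def by (rule integral_diff[symmetric, OF ir[OF z] ir[OF z']])
  also have "norm \<dots> \<le> integral {-pi..pi} (\<lambda>\<theta>. 1032 * near_weight \<delta> \<theta> * norm (z - z'))"
    by (rule integral_norm_bound_integral[OF integrable_diff[OF ir[OF z] ir[OF z']]])
      (use near_remainder_estimates(2)[OF z z'] iw in \<open>auto intro: integrable_on_mult_right integrable_on_mult_left\<close>)
  finally have J2: "norm (J z - J z') \<le> 1032 * I * norm (z - z')" by (simp add: I_def)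
  have big: "norm (2 + \<delta> *\<^sub>R z) \<ge> 1" if "norm z \<le> 3/2" for z :: complex
  proof -
    have "\<delta> * norm z \<le> 1/6 * (3/2)" using \<delta> that by (intro mult_mono) auto
    then show ?thesis using norm_diff_ineq[of 2 "\<delta> *\<^sub>R z"] \<delta> by simp
  qed
  have m1: "\<bar>m z\<bar> \<le> 3/2 * \<delta>" if "norm z \<le> 3/2" for z
  proof -
    have "m z = (norm (2 + \<delta> *\<^sub>R z) - norm (2::complex)) / norm (2 + \<delta> *\<^sub>R z)"
    proof -
      have "2 + \<delta> *\<^sub>R z \<noteq> 0" using big[OF that] by (metis norm_zero not_one_le_zero)
      then show ?thesis by (simp add: m_def diff_divide_distrib)
    qed
    then have "\<bar>m z\<bar> = \<bar>norm (2 + \<delta> *\<^sub>R z) - norm (2::complex)\<bar> / norm (2 + \<delta> *\<^sub>R z)"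
      by simp
    also have "\<dots> \<le> \<bar>norm (2 + \<delta> *\<^sub>R z) - norm (2::complex)\<bar> / 1"
      using big[OF that] by (intro divide_left_mono) auto
    also have "\<dots> \<le> norm (\<delta> *\<^sub>R z)" using norm_triangle_ineq3[of "2 + \<delta> *\<^sub>R z" 2] by simp
    also have "\<dots> \<le> 3/2 * \<delta>" using that \<delta> by (simp add: mult.commute)
    finally show ?thesis .
  qed
  have m2: "\<bar>m z - m z'\<bar> \<le> 2 * \<delta> * norm (z - z')"
  proof -
    define a where "a = norm (2 + \<delta> *\<^sub>R z)"
    define b where "b = norm (2 + \<delta> *\<^sub>R z')"
    have ab: "a \<ge> 1" "b \<ge> 1" using big z z' by (auto simp: a_def b_def)
    have "m z - m z' = 2 * (a - b) / (a * b)" using ab by (simp add: m_def a_def[symmetric] b_def[symmetric] field_simps)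
    then have "\<bar>m z - m z'\<bar> = \<bar>2\<bar> * \<bar>a - b\<bar> / (\<bar>a\<bar> * \<bar>b\<bar>)" by (simp only: abs_divide abs_mult)
    then have "\<bar>m z - m z'\<bar> = 2 * \<bar>a - b\<bar> / (a * b)" using ab by simp
    also have "\<dots> \<le> 2 * \<bar>a - b\<bar> / 1"
      using ab mult_mono[of 1 a 1 b] by (intro divide_left_mono) auto
    also have "\<bar>a - b\<bar> \<le> norm (\<delta> *\<^sub>R (z - z'))"
      using norm_triangle_ineq3[of "2 + \<delta> *\<^sub>R z" "2 + \<delta> *\<^sub>R z'"] by (simp add: a_def b_def scaleR_diff_right)
    finally show ?thesis using \<delta> by simp
  qed
  have e1: "norm (e z) \<le> 2" if "1/2 \<le> norm z" for z
  proof -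
    have "norm z > 0" using that by linarith
    then have "norm (e z) = 1 / norm z" by (simp add: e_def power2_eq_square inverse_eq_divide)
    also have "\<dots> \<le> 1 / (1/2)" using that by (intro divide_left_mono) auto
    also have "\<dots> = 2" by simp
    finally show ?thesis .
  qed
  have e2: "norm (e z - e z') \<le> 4 * norm (z - z')"
  proof -
    have einv: "e z = inverse (cnj z)" if "z \<noteq> 0" for z
      using that complex_norm_square[of z] unfolding e_def
      by (simp add: scaleR_conv_of_real field_simps del: complex_mult_cnj)
    have "z \<noteq> 0" "z' \<noteq> 0" using z z' by auto
    then have "e z - e z' = cnj (z' - z) / (cnj z * cnj z')" by (simp add: einv field_simps)
    then have "norm (e z - e z') = norm (z - z') / (norm z * norm z')"
      by (simp add: norm_divide norm_mult norm_minus_commute del: complex_cnj_diff)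
    also have "\<dots> \<le> norm (z - z') / (1/4)"
      using mult_mono[of "1/2" "norm z" "1/2" "norm z'"] z z' by (intro divide_left_mono) auto
    finally show ?thesis by simp
  qed
  have "norm (m z *\<^sub>R e z) \<le> (3/2 * \<delta>) * 2" unfolding norm_scaleR
    using m1[OF z(2)] e1[OF z(1)] \<delta> by (intro mult_mono) auto
  then show "norm (near_perturbation \<delta> z) \<le> 3 * \<delta> + 16 * I"
    unfolding split[OF z] using J1 norm_triangle_ineq4[of "m z *\<^sub>R e z" "(1/2) *\<^sub>R J z"] by simp
  have "norm (m z *\<^sub>R e z - m z' *\<^sub>R e z') \<le> \<bar>m z - m z'\<bar> * norm (e z) + \<bar>m z'\<bar> * norm (e z - e z')"
  proof -
    have "m z *\<^sub>R e z - m z' *\<^sub>R e z' = (m z - m z') *\<^sub>R e z + m z' *\<^sub>R (e z - e z')"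
      by (simp add: algebra_simps)
    then show ?thesis by (metis norm_triangle_ineq norm_scaleR)
  qed
  also have "\<dots> \<le> (2 * \<delta> * norm (z - z')) * 2 + (3/2 * \<delta>) * (4 * norm (z - z'))"
    using m1[OF z'(2)] m2 e1[OF z(1)] e2 \<delta> by (intro add_mono mult_mono) auto
  finally have me: "norm (m z *\<^sub>R e z - m z' *\<^sub>R e z') \<le> 10 * \<delta> * norm (z - z')" by simp
  have "near_perturbation \<delta> z - near_perturbation \<delta> z' = (m z *\<^sub>R e z - m z' *\<^sub>R e z') - (1/2) *\<^sub>R (J z - J z')"
    unfolding split[OF z] split[OF z'] by (simp add: scaleR_diff_right)
  then have "norm (near_perturbation \<delta> z - near_perturbation \<delta> z') \<le> norm (m z *\<^sub>R e z - m z' *\<^sub>R e z') + 1/2 * norm (J z - J z')"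
    using norm_triangle_ineq4[of "m z *\<^sub>R e z - m z' *\<^sub>R e z'" "(1/2) *\<^sub>R (J z - J z')"] by simp
  then show "norm (near_perturbation \<delta> z - near_perturbation \<delta> z') \<le> (10 * \<delta> + 516 * I) * norm (z - z')"
    using me J2 by (simp add: algebra_simps)
qed

end

lemma near_perturbation_mild:
  assumes "\<mu> > 0" "\<epsilon> > 0"
  shows "\<exists>\<delta>>0. \<delta> \<le> \<epsilon> \<and> mild_symmetric_perturbation pi \<mu> (near_perturbation \<delta>)"
proof -
  obtain \<delta> where \<delta>: "\<delta> > 0" "\<delta> \<le> min \<epsilon> (min (1/6) (\<mu>/20))" and I: "integral {-pi..pi} (near_weight \<delta>) < \<mu> / 1032"
    using near_weight_integral_small[of "min \<epsilon> (min (1/6) (\<mu>/20))" "\<mu> / 1032"] assms by auto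
  define I where "I = integral {-pi..pi} (near_weight \<delta>)"
  have \<delta>6: "\<delta> \<le> 1/6" "\<delta> \<le> \<mu>/20" using \<delta> by auto
  have I: "I < \<mu> / 1032" "0 \<le> I"
    using I \<delta> by (auto simp: I_def near_weight_def intro!: integral_nonneg integrable_continuous_real continuous_on_near_weight[unfolded near_weight_def[abs_def]])
  have ball: "1/2 \<le> norm z" "norm z \<le> 3/2" if "norm u = 1" "z \<in> cball u (1/2)" for u z :: complex
    using that norm_triangle_ineq2[of u z] norm_triangle_ineq2[of z u] by (auto simp: dist_norm norm_minus_commute)
  have "mild_symmetric_perturbation pi \<mu> (near_perturbation \<delta>)"
    unfolding mild_symmetric_perturbation_def
  proof (intro conjI allI impI ballI)
    fix z :: complex
    have "1 + \<delta> *\<^sub>R cnj z = cnj (1 + \<delta> *\<^sub>R z)" by simp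
    then show "near_perturbation \<delta> (cnj z) = cnj (near_perturbation \<delta> z)"
      unfolding near_perturbation_def by (simp only: ring_pull_cnj complex_mod_cnj) simp
    show "near_perturbation \<delta> (cis (2 * pi) * z) = cis (2 * pi) * near_perturbation \<delta> z"
      by (simp add: cis_2pi)
  next
    fix u :: complex assume u: "norm u = 1"
    have "norm (near_perturbation \<delta> u) \<le> 3 * \<delta> + 16 * I"
      unfolding I_def by (rule near_perturbation_estimates(1)[OF \<delta>(1) \<delta>6(1), of u u]) (use u in auto)
    also have "\<dots> \<le> \<mu>" using \<delta>6 I assms(1) by linarith
    finally show "norm (near_perturbation \<delta> u) \<le> \<mu>" .
  next
    fix u z z' :: complex assume u: "norm u = 1" and z: "z \<in> cball u (1/2)" and z': "z' \<in> cball u (1/2)"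
    have "norm (near_perturbation \<delta> z - near_perturbation \<delta> z') \<le> (10 * \<delta> + 516 * I) * norm (z - z')"
      unfolding I_def by (rule near_perturbation_estimates(2)[OF \<delta>(1) \<delta>6(1)]) (use ball[OF u z] ball[OF u z'] in auto)
    also have "\<dots> \<le> \<mu> * norm (z - z')"
      by (intro mult_right_mono) (use \<delta>6 I in auto)
    finally show "norm (near_perturbation \<delta> z - near_perturbation \<delta> z') \<le> \<mu> * norm (z - z')" .
  qed
  then show ?thesis using \<delta> by auto
qed

section \<open>Periodic orbits in vertical planes\<close>

lemma vertical_plane_meridian:
  assumes "vertical_plane \<Lambda>"
  obtains \<alpha> where "\<Lambda> = range (meridian \<alpha>)"
proof -
  have aff: "affine \<Lambda>" and dim: "aff_dim \<Lambda> = 2" and z: "z_axis \<subseteq> \<Lambda>"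
    using assms by (auto simp: vertical_plane_def)
  have "0 \<in> \<Lambda>" using z by (auto simp: z_axis_def)
  then have sub: "subspace \<Lambda>" using aff by (simp add: subspace_affine)
  have dim2: "dim \<Lambda> = 2" using aff_dim_subspace[OF sub] dim by simp
  have e3: "k *\<^sub>R axis 3 1 \<in> \<Lambda>" for k using z by (auto simp: z_axis_def axis_def)
  have "\<not> \<Lambda> \<subseteq> span {axis 3 1 :: real^3}"
  proof
    assume "\<Lambda> \<subseteq> span {axis 3 1 :: real^3}"
    then have "dim \<Lambda> \<le> card {axis 3 1 :: real^3}" by (intro dim_le_card) auto
    then show False using dim2 by simp
  qed
  then obtain v where v: "v \<in> \<Lambda>" "v \<notin> span {axis 3 1 :: real^3}" by blast
  define h where "h = v - v $ 3 *\<^sub>R axis 3 1"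
  have h: "h \<in> \<Lambda>" unfolding h_def by (intro subspace_diff[OF sub] v e3)
  have h_nth: "h $ 1 = v $ 1" "h $ 2 = v $ 2" "h $ 3 = 0" by (simp_all add: h_def axis_def)
  have "h \<noteq> 0" using v(2) by (auto simp: h_def span_singleton)
  then have n: "norm h > 0" by simp
  have "(h $ 1 / norm h)\<^sup>2 + (h $ 2 / norm h)\<^sup>2 = ((h $ 1)\<^sup>2 + (h $ 2)\<^sup>2) / (norm h)\<^sup>2"
    by (simp add: power_divide add_divide_distrib)
  also have "(h $ 1)\<^sup>2 + (h $ 2)\<^sup>2 = (norm h)\<^sup>2" by (simp add: norm_vec3_sq h_nth(3))
  finally have "(h $ 1 / norm h)\<^sup>2 + (h $ 2 / norm h)\<^sup>2 = 1" using n by simp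
  then obtain \<alpha> where \<alpha>: "h $ 1 / norm h = cos \<alpha>" "h $ 2 / norm h = sin \<alpha>"
    using sincos_total_2pi by metis
  have dir: "cos \<alpha> *\<^sub>R axis 1 1 + sin \<alpha> *\<^sub>R axis 2 1 = (1 / norm h) *\<^sub>R h"
    by (simp add: vec_eq_iff forall_3 axis_def h_nth(3) flip: \<alpha>)
  have "range (meridian \<alpha>) \<subseteq> \<Lambda>"
  proof
    fix x assume "x \<in> range (meridian \<alpha>)"
    then obtain q where x: "x = meridian \<alpha> q" by blast
    show "x \<in> \<Lambda>" unfolding x meridian_def dir
      by (intro subspace_add[OF sub] subspace_scale[OF sub] h e3)
  qed
  moreover have lin: "linear (meridian \<alpha>)" by (rule bounded_linear.linear[OF bounded_linear_meridian])
  have "subspace (range (meridian \<alpha>))" by (rule linear_subspace_image[OF lin subspace_UNIV])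
  moreover have "dim (range (meridian \<alpha>)) = 2"
  proof -
    have "inj (meridian \<alpha>)"
      by (subst linear_injective_0[OF lin]) (metis norm_meridian norm_eq_zero)
    from dim_image_eq[OF lin inj_on_subset[OF this subset_UNIV]] show ?thesis
      by (metis DIM_complex dim_UNIV)
  qed
  ultimately have "range (meridian \<alpha>) = \<Lambda>"
    using subspace_dim_equal[OF _ sub] dim2 by simp
  then show thesis using that by blast
qed

lemma meridian_orbit:
  assumes q: "\<And>t. (q has_vector_derivative v t) (at t)"
    and v: "\<And>t. (v has_vector_derivative - (dens *\<^sub>R ring_pull (q t))) (at t)"
    and off: "\<And>t. q t \<noteq> 1 \<and> q t \<noteq> -1"
  shows "circle_orbit dens (\<lambda>t. meridian \<alpha> (q t))"
  unfolding circle_orbit_def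
proof (intro conjI allI exI)
  fix t
  show "meridian \<alpha> (q t) \<notin> unit_circle" using off by (simp add: meridian_in_unit_circle)
  show "((\<lambda>t. meridian \<alpha> (q t)) has_vector_derivative meridian \<alpha> (v t)) (at t)"
    by (rule bounded_linear.has_vector_derivative[OF bounded_linear_meridian q])
  show "((\<lambda>t. meridian \<alpha> (v t)) has_vector_derivative meridian \<alpha> (- (dens *\<^sub>R ring_pull (q t)))) (at t)"
    by (rule bounded_linear.has_vector_derivative[OF bounded_linear_meridian v])
  have "- meridian \<alpha> (- (dens *\<^sub>R ring_pull (q t))) = dens *\<^sub>R meridian \<alpha> (ring_pull (q t))"
    using bounded_linear.linear[OF bounded_linear_meridian, of \<alpha>] by (simp add: linear_neg linear_scale)
  then show "GDERIV (circle_potential dens) (meridian \<alpha> (q t)) :> - meridian \<alpha> (- (dens *\<^sub>R ring_pull (q t)))"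
    using meridian_gradient[of "q t" dens \<alpha>] off by simp
qed

lemma meridian_cnj: "vector [meridian \<alpha> q $ 1, meridian \<alpha> q $ 2, - (meridian \<alpha> q $ 3)] = meridian \<alpha> (cnj q)"
  by (simp add: vec_eq_iff forall_3 meridian_nth vector_3)

lemma meridian_neg_cnj: "vector [- (meridian \<alpha> q $ 1), - (meridian \<alpha> q $ 2), meridian \<alpha> q $ 3] = meridian \<alpha> (- cnj q)"
  by (simp add: vec_eq_iff forall_3 meridian_nth vector_3)

text \<open>Rescaling length by \<open>\<rho>\<close> and time by \<open>\<Omega>\<close> multiplies accelerations by \<open>\<rho> * \<Omega>\<^sup>2\<close>. Reversibility of \<open>Q\<close> becomes the
symmetry with respect to the horizontal plane.\<close>

lemma near_circular_motion_orbit: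
  fixes c \<rho> \<Omega> \<alpha> :: real
  assumes Q: "near_circular_motion L \<epsilon> F Q Q'" and e: "\<epsilon> \<le> 1/8" and per: "\<And>t. Q (t + 2*pi) = Q t"
    and pos: "\<rho> > 0" "\<Omega> > 0"
    and force: "\<And>z. (\<rho> * \<Omega>\<^sup>2) *\<^sub>R F z = - (dens *\<^sub>R ring_pull (of_real c + \<rho> *\<^sub>R z))"
    and off: "\<And>t. of_real c + \<rho> *\<^sub>R Q t \<noteq> 1 \<and> of_real c + \<rho> *\<^sub>R Q t \<noteq> -1"
  defines "r \<equiv> \<lambda>t. meridian \<alpha> (of_real c + \<rho> *\<^sub>R Q (\<Omega> * t))"
  shows "periodic_circle_orbit dens r" "simple_closed_curve (range r)"
    "symmetric_horizontal_plane (range r)" "encloses_in (range (meridian \<alpha>)) (range r) (meridian \<alpha> (of_real c))"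
proof -
  have dQ: "\<And>t. (Q has_vector_derivative Q' t) (at t)"
    and dQ': "\<And>t. (Q' has_vector_derivative F (Q t)) (at t)"
    and sym: "\<And>t. Q (- t) = cnj (Q t)"
    using Q unfolding near_circular_motion_def by auto
  have chain: "((\<lambda>t. f (\<Omega> * t)) has_vector_derivative \<Omega> *\<^sub>R f' (\<Omega> * t)) (at t)"
    if "\<And>t. (f has_vector_derivative f' t) (at t)" for f f' :: "real \<Rightarrow> complex" and t
  proof -
    have "((\<lambda>t. \<Omega> * t) has_vector_derivative \<Omega>) (at t)" by (auto intro!: derivative_eq_intros)
    from vector_diff_chain_at[OF this that] show ?thesis by (simp add: o_def)
  qed
  have "circle_orbit dens r" unfolding r_def
  proof (rule meridian_orbit)
    fix t
    show "((\<lambda>t. of_real c + \<rho> *\<^sub>R Q (\<Omega> * t)) has_vector_derivative (\<rho> * \<Omega>) *\<^sub>R Q' (\<Omega> * t)) (at t)"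
      using has_vector_derivative_add[OF has_vector_derivative_const
        bounded_linear.has_vector_derivative[OF bounded_linear_scaleR_right[of \<rho>] chain[OF dQ]], of "of_real c" t]
      by simp
    show "((\<lambda>t. (\<rho> * \<Omega>) *\<^sub>R Q' (\<Omega> * t)) has_vector_derivative
        - (dens *\<^sub>R ring_pull (of_real c + \<rho> *\<^sub>R Q (\<Omega> * t)))) (at t)"
      using bounded_linear.has_vector_derivative[OF bounded_linear_scaleR_right[of "\<rho> * \<Omega>"] chain[OF dQ'], of t]
        force[of "Q (\<Omega> * t)"] by (simp add: power2_eq_square mult.assoc)
    show "of_real c + \<rho> *\<^sub>R Q (\<Omega> * t) \<noteq> 1 \<and> of_real c + \<rho> *\<^sub>R Q (\<Omega> * t) \<noteq> -1" by (rule off)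
  qed
  moreover have "r (t + 2*pi/\<Omega>) = r t" for t
    using pos per[of "\<Omega> * t"] by (simp add: r_def distrib_left)
  moreover have "2*pi/\<Omega> > 0" using pos by simp
  ultimately show "periodic_circle_orbit dens r" unfolding periodic_circle_orbit_def by blast
  define A where "A z = meridian \<alpha> (of_real c + \<rho> *\<^sub>R z)" for z
  define B where "B x = (1/\<rho>) *\<^sub>R (Complex (x$1 * cos \<alpha> + x$2 * sin \<alpha>) (x$3) - of_real c)" for x :: "real^3"
  have range: "range r = A ` range Q"
  proof -
    have surj: "range ((*) \<Omega>) = UNIV" by (rule surjI[of _ "\<lambda>t. t / \<Omega>"]) (use pos in simp)
    have "range r = (\<lambda>t. A (Q t)) ` range ((*) \<Omega>)" by (simp only: r_def A_def image_image)
    then show ?thesis unfolding surj by (simp only: image_image)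
  qed
  have cA: "continuous_on S A" for S
    unfolding A_def by (intro bounded_linear.continuous_on[OF bounded_linear_meridian] continuous_intros)
  have cB: "continuous_on UNIV B" unfolding B_def Complex_eq by (intro continuous_intros)
  have BA: "B (A z) = z" for z
  proof -
    have "x * cos \<alpha> * cos \<alpha> + x * sin \<alpha> * sin \<alpha> = x" for x :: real
      using sin_cos_squared_add3[of \<alpha>] by (metis distrib_left mult.assoc mult.right_neutral)
    then show ?thesis using pos unfolding B_def A_def meridian_nth by (simp add: complex_eq_iff)
  qed
  have "range A = range (meridian \<alpha>)"
  proof
    show "range A \<subseteq> range (meridian \<alpha>)" by (auto simp: A_def)
    show "range (meridian \<alpha>) \<subseteq> range A"
    proof
      fix x assume "x \<in> range (meridian \<alpha>)"
      then obtain q where "x = meridian \<alpha> q" by blast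
      then have "x = A ((1/\<rho>) *\<^sub>R (q - of_real c))" using pos by (simp add: A_def)
      then show "x \<in> range A" by blast
    qed
  qed
  from encloses_affine_image[OF cA this cB BA near_circular_trace(4)[OF Q e per]]
  show "encloses_in (range (meridian \<alpha>)) (range r) (meridian \<alpha> (of_real c))"
    unfolding range by (simp add: A_def)
  define \<gamma> where "\<gamma> = (\<lambda>\<tau>. Q (2 * pi * \<tau>))"
  note \<gamma> = near_circular_trace(1,2,3)[OF Q e per, folded \<gamma>_def]
  have "inj_on A (path_image \<gamma>)" by (rule inj_on_inverseI[of _ B]) (rule BA)
  from simple_path_continuous_image[OF \<gamma>(1) cA this]
  have "simple_path (A \<circ> \<gamma>)" .
  moreover have "pathfinish (A \<circ> \<gamma>) = pathstart (A \<circ> \<gamma>)"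
    using \<gamma>(2) by (simp add: pathfinish_def pathstart_def)
  moreover have "path_image (A \<circ> \<gamma>) = range r"
    unfolding range \<gamma>(3)[symmetric] by (rule path_image_compose)
  ultimately show "simple_closed_curve (range r)" unfolding simple_closed_curve_def by blast
  have "vector [r t $ 1, r t $ 2, - (r t $ 3)] = r (- t)" for t
    using sym[of "\<Omega> * t"] unfolding r_def meridian_cnj by simp
  then have "(\<lambda>x. vector [x$1, x$2, - (x$3)]) ` range r = range (\<lambda>t. r (- t))"
    by (simp add: image_image)
  also have "\<dots> = r ` range uminus" by (simp only: image_image)
  also have "range (uminus :: real \<Rightarrow> real) = UNIV" by (rule surj_uminus)
  finally show "symmetric_horizontal_plane (range r)" unfolding symmetric_horizontal_plane_def .
qed

text \<open>The period \<open>pi\<close> of \<open>w\<close> in the rotating frame gives \<open>Q (t + pi) = - Q t\<close>; together with reversibility this is the symmetry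
about the \<open>z\<close>-axis.\<close>

lemma far_periodic_orbit:
  assumes "dens > 0" "\<epsilon> > 0"
  shows "\<exists>r. periodic_circle_orbit dens r \<and> range r \<subseteq> range (meridian \<alpha>) \<and>
    (\<forall>t. norm (r t) \<ge> 1 / \<epsilon>) \<and> simple_closed_curve (range r) \<and>
    symmetric_horizontal_plane (range r) \<and> symmetric_z_axis (range r) \<and>
    encloses_in (range (meridian \<alpha>)) (range r) 0"
proof -
  obtain \<mu> where \<mu>: "\<mu> > 0" and orbit: "\<And>P. mild_symmetric_perturbation (pi/2) \<mu> P \<Longrightarrow>
     \<exists>Q Q'. near_circular_motion (pi/2) (1/8) (\<lambda>z. P z - z /\<^sub>R norm z ^ 3) Q Q'"
    using perturbed_circular_orbit[of 3 "pi/2" "1/8"] by auto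
  obtain R0 where R0: "R0 > 0" and mild: "\<And>R. R \<ge> R0 \<Longrightarrow> mild_symmetric_perturbation (pi/2) \<mu> (far_perturbation R)"
    using far_perturbation_mild[OF \<mu>] by blast
  \<comment> \<open>The orbit stays within a factor \<open>7/8\<close> and \<open>9/8\<close> of \<open>R\<close>, so this keeps it off the ring and beyond \<open>1/\<epsilon>\<close>.\<close>
  define R where "R = max R0 (max 2 (2/\<epsilon>))"
  have R: "R \<ge> R0" "R \<ge> 2" "R \<ge> 2/\<epsilon>" "R > 0" by (auto simp: R_def)
  obtain Q Q' where Q: "near_circular_motion (pi/2) (1/8) (\<lambda>z. far_perturbation R z - z /\<^sub>R norm z ^ 3) Q Q'"
    using orbit[OF mild[OF R(1)]] by blast
  have sym: "\<And>t. Q (- t) = cnj (Q t)" and half: "\<And>t. Q (t + pi) = - Q t" and Qc: "\<And>t. norm (Q t - cis t) \<le> 1/8"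
    using Q unfolding near_circular_motion_def by auto
  have per: "Q (t + 2*pi) = Q t" for t using half[of t] half[of "t + pi"] by (simp add: algebra_simps)
  have Qn: "norm (Q t) \<ge> 7/8" for t
    using Qc[of t] norm_triangle_ineq2[of "cis t" "Q t"] by (simp add: norm_minus_commute)
  have big: "norm (R *\<^sub>R Q t) \<ge> 7/8 * R" for t
    using mult_left_mono[OF Qn[of t], of R] R by simp
  \<comment> \<open>Kepler's third law for the total mass \<open>2 * pi * dens\<close>.\<close>
  define \<Omega> where "\<Omega> = sqrt (2 * pi * dens / R ^ 3)"
  have \<Omega>: "\<Omega> > 0" "R * \<Omega>\<^sup>2 * (R\<^sup>2 / (2*pi)) = dens"
    using R assms by (auto simp: \<Omega>_def power2_eq_square power3_eq_cube)
  have force: "(R * \<Omega>\<^sup>2) *\<^sub>R (far_perturbation R z - z /\<^sub>R norm z ^ 3) = - (dens *\<^sub>R ring_pull (of_real 0 + R *\<^sub>R z))" for z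
    using \<Omega>(2) by (simp add: far_perturbation_def)
  have off: "of_real 0 + R *\<^sub>R Q t \<noteq> 1 \<and> of_real 0 + R *\<^sub>R Q t \<noteq> -1" for t
  proof -
    have "norm (R *\<^sub>R Q t) > 1" using big[of t] R by linarith
    then have "norm (R *\<^sub>R Q t) \<noteq> norm (1::complex)" "norm (R *\<^sub>R Q t) \<noteq> norm (- 1::complex)" by auto
    then show ?thesis by (metis add_0 of_real_0)
  qed
  define r where "r t = meridian \<alpha> (of_real 0 + R *\<^sub>R Q (\<Omega> * t))" for t
  note props = near_circular_motion_orbit[OF Q order_refl per R(4) \<Omega>(1) force off, of \<alpha>, folded r_def[abs_def]]
  have "norm (r t) \<ge> 1 / \<epsilon>" for t
  proof -
    have "1/\<epsilon> \<le> 7/8 * R" using R(3,4) assms(2) by simp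
    then show ?thesis using big[of "\<Omega> * t"] by (simp add: r_def norm_meridian)
  qed
  moreover have "symmetric_z_axis (range r)"
  proof -
    have "vector [- (r t $ 1), - (r t $ 2), r t $ 3] = r (pi/\<Omega> - t)" for t
    proof -
      have "- cnj (Q (\<Omega> * t)) = Q (\<Omega> * (pi/\<Omega> - t))"
        using half[of "- (\<Omega> * t)"] sym[of "\<Omega> * t"] \<Omega>(1) by (simp add: right_diff_distrib)
      from this[symmetric] show ?thesis unfolding r_def meridian_neg_cnj by simp
    qed
    then have "(\<lambda>x. vector [- (x$1), - (x$2), x$3]) ` range r = range (\<lambda>t. r (pi/\<Omega> - t))"
      by (simp add: image_image)
    also have "\<dots> = r ` range (\<lambda>t. pi/\<Omega> - t)" by (simp only: image_image)
    also have "range (\<lambda>t. pi/\<Omega> - t) = UNIV" by (rule surjI[of _ "\<lambda>t. pi/\<Omega> - t"]) simp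
    finally show ?thesis unfolding symmetric_z_axis_def .
  qed
  moreover have "range r \<subseteq> range (meridian \<alpha>)" by (auto simp: r_def)
  moreover have "meridian \<alpha> (of_real 0) = 0" by (simp add: meridian_def)
  ultimately show ?thesis using props by metis
qed

text \<open>The radial frequency \<open>sqrt 2\<close> of the wire lies strictly between \<open>1\<close> and \<open>2\<close>, so there is no resonance over a full turn.\<close>

lemma near_periodic_orbit:
  assumes "dens > 0" "\<epsilon> > 0"
  shows "\<exists>s. periodic_circle_orbit dens s \<and> range s \<subseteq> range (meridian \<alpha>) \<and>
    (\<forall>t. infdist (s t) unit_circle \<le> \<epsilon>) \<and> simple_closed_curve (range s) \<and>
    symmetric_horizontal_plane (range s) \<and>
    (\<exists>p \<in> unit_circle \<inter> range (meridian \<alpha>). encloses_in (range (meridian \<alpha>)) (range s) p)"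
proof -
  have "sqrt 2 > 1" "sqrt 2 < 2" by (auto simp: real_less_lsqrt)
  then have "sin (sqrt 2 * pi) < 0" by (intro sin_lt_zero) auto
  then have "sin (sqrt (4 - real 2) * pi) \<noteq> 0" by simp
  then obtain \<mu> where \<mu>: "\<mu> > 0" and orbit: "\<And>P. mild_symmetric_perturbation pi \<mu> P \<Longrightarrow>
     \<exists>Q Q'. near_circular_motion pi (1/8) (\<lambda>z. P z - z /\<^sub>R norm z ^ 2) Q Q'"
    using perturbed_circular_orbit[of 2 pi "1/8"] by auto
  obtain \<delta> where \<delta>: "\<delta> > 0" "\<delta> \<le> min (\<epsilon>/2) (1/2)"
    and mild: "mild_symmetric_perturbation pi \<mu> (near_perturbation \<delta>)"
    using near_perturbation_mild[OF \<mu>, of "min (\<epsilon>/2) (1/2)"] assms by auto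
  obtain Q Q' where Q: "near_circular_motion pi (1/8) (\<lambda>z. near_perturbation \<delta> z - z /\<^sub>R norm z ^ 2) Q Q'"
    using orbit[OF mild] by blast
  have per: "\<And>t. Q (t + 2*pi) = Q t" and Qc: "\<And>t. norm (Q t - cis t) \<le> 1/8"
    using Q unfolding near_circular_motion_def by (auto simp: cis_2pi)
  have Qn: "norm (Q t) \<ge> 7/8" "norm (Q t) \<le> 9/8" for t
    using Qc[of t] norm_triangle_ineq2[of "cis t" "Q t"] norm_triangle_ineq2[of "Q t" "cis t"]
    by (auto simp: norm_minus_commute)
  have small: "norm (\<delta> *\<^sub>R Q t) \<le> 9/8 * \<delta>" for t
    using mult_left_mono[OF Qn(2)[of t], of \<delta>] \<delta> by simp
  define \<Omega> where "\<Omega> = sqrt (2 * dens) / \<delta>"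
  have \<Omega>: "\<Omega> > 0" "\<delta> * \<Omega>\<^sup>2 * (\<delta> / 2) = dens"
    using \<delta> assms by (auto simp: \<Omega>_def power_divide power2_eq_square)
  have force: "(\<delta> * \<Omega>\<^sup>2) *\<^sub>R (near_perturbation \<delta> z - z /\<^sub>R norm z ^ 2) = - (dens *\<^sub>R ring_pull (of_real 1 + \<delta> *\<^sub>R z))" for z
    using \<Omega>(2) by (simp add: near_perturbation_def)
  have off: "of_real 1 + \<delta> *\<^sub>R Q t \<noteq> 1 \<and> of_real 1 + \<delta> *\<^sub>R Q t \<noteq> -1" for t
  proof
    show "of_real 1 + \<delta> *\<^sub>R Q t \<noteq> 1" using Qn(1)[of t] \<delta> by auto
    show "of_real 1 + \<delta> *\<^sub>R Q t \<noteq> -1"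
    proof
      assume "of_real 1 + \<delta> *\<^sub>R Q t = -1"
      then have "\<delta> *\<^sub>R Q t = -1 - of_real 1" by (metis add_diff_cancel_left')
      then have "norm (\<delta> *\<^sub>R Q t) = 2" by simp
      then show False using small[of t] \<delta> by simp
    qed
  qed
  define s where "s t = meridian \<alpha> (of_real 1 + \<delta> *\<^sub>R Q (\<Omega> * t))" for t
  note props = near_circular_motion_orbit[OF Q order_refl per \<delta>(1) \<Omega>(1) force off, of \<alpha>, folded s_def[abs_def]]
  have p: "meridian \<alpha> (of_real 1) \<in> unit_circle" by (simp add: meridian_in_unit_circle)
  have "infdist (s t) unit_circle \<le> \<epsilon>" for t
  proof -
    have "s t - meridian \<alpha> (of_real 1) = meridian \<alpha> (\<delta> *\<^sub>R Q (\<Omega> * t))"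
      using bounded_linear.linear[OF bounded_linear_meridian, of \<alpha>] by (simp add: s_def linear_add)
    then have "dist (s t) (meridian \<alpha> (of_real 1)) = norm (\<delta> *\<^sub>R Q (\<Omega> * t))"
      by (simp add: dist_norm norm_meridian)
    also have "\<dots> \<le> \<epsilon>" by (rule order_trans[OF small]) (use \<delta> in simp)
    finally show ?thesis using infdist_le2[OF p] by blast
  qed
  moreover have "range s \<subseteq> range (meridian \<alpha>)" by (auto simp: s_def)
  ultimately show ?thesis using props p by blast
qed

theorem theoremA:
  fixes dens \<epsilon> :: real and \<Lambda> :: "(real^3) set"
  assumes "dens > 0" and "\<epsilon> > 0" and "vertical_plane \<Lambda>"
  shows "\<exists>r s :: real \<Rightarrow> real^3.
    periodic_circle_orbit dens r \<and> range r \<subseteq> \<Lambda> \<and>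
    periodic_circle_orbit dens s \<and> range s \<subseteq> \<Lambda> \<and>
    ((\<forall>t. norm (r t) \<ge> 1 / \<epsilon>) \<and>
      simple_closed_curve (range r) \<and>
      symmetric_horizontal_plane (range r) \<and>
      symmetric_z_axis (range r) \<and>
      encloses_in \<Lambda> (range r) 0) \<and>
    ((\<forall>t. infdist (s t) unit_circle \<le> \<epsilon>) \<and>
      simple_closed_curve (range s) \<and>
      symmetric_horizontal_plane (range s) \<and>
      (\<exists>p \<in> unit_circle \<inter> \<Lambda>. encloses_in \<Lambda> (range s) p))"
proof -
  obtain \<alpha> where \<Lambda>: "\<Lambda> = range (meridian \<alpha>)" using vertical_plane_meridian[OF assms(3)] .
  from far_periodic_orbit[OF assms(1,2), of \<alpha>] near_periodic_orbit[OF assms(1,2), of \<alpha>]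
  show ?thesis unfolding \<Lambda> by blast
qed


end
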